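(* Let $\boldsymbol{\pi}(\mathrm{d}x)=\pi(x)\,\mathrm{d}x$ be an absolutely continuous probability distribution on $(0,\infty)$ and $(L_t)_{t\ge0}$ a Lévy process in $\mathbb{R}$ such that: (b1) $\pi$ is a positive, piecewise weakly differentiable function on $(0,\infty)$, and there exist constants $C,C',\alpha>0$ such that $\lim_{x\to\infty}\pi(x)e^{\alpha x}=C$ and $\int_0^x\pi(z)\,\mathrm{d}z\le C'\pi(x)x$ for all sufficiently small $x>0$; (b2) $(L_t)_{t\ge0}$ is a spectrally positive compound Poisson process with characteristic triplet $(0,0,\mu)$, where $\operatorname{supp}\mu\subset[0,\infty)$ and $\int_0^\infty(1\vee z)\,\mu(\mathrm{d}z)<\infty$. Let $(X_t)_{t\ge0}$ be a solution of $\mathrm{d}X_t=\phi(X_t)\,\mathrm{d}t+\mathrm{d}L_t$ with $$\phi(x)=-\mathbf{1}_{(0,\infty)}(x)\,\frac{(\overline\mu_s*\pi)(x)}{\pi(x)} .$$ Additionally assume that $\mu=\mu_1+\mu_2$ with measures $\mu_1,\mu_2$, where $\mu_1$ is arbitrary and $\mu_2$ is absolutely continuous (with respect to Lebesgue measure) and satisfies $\mu_2(I)>0$ for all nonempty open intervals $I\subset(0,\infty)$. Then the $1$-skeleton chain of $(X_t)_{t\ge0}$ is irreducible, and $(X_t)_{t\ge0}$ is ergodic.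
   Context: Piecewise weak differentiability. Let $\mathcal{P}$ be the set of all sequences $(x_i)_{i\in\mathbb{Z}}\subset(0,\infty)$ with $x_i<x_{i+1}$ for all $i\in\mathbb{Z}$ and such that $0$ is the unique accumulation point of $(x_i)_{i\in\mathbb{Z}}$. A function $f\in L^1_{\mathrm{loc}}(0,\infty)$ is piecewise weakly differentiable if there is $(x_i)_{i\in\mathbb{Z}}\in\mathcal{P}$ with $f|_{(x_i,x_{i+1})}\in W^{1,1}(x_i,x_{i+1})$ for all $i$. The spectrally positive compound Poisson process with triplet $(0,0,\mu)$, $|\mu|:=\mu(\mathbb{R})<\infty$, $\mu(\{0\})=0$, is $L_t=\sum_{i=1}^{N_t}\xi_i$ with $(N_t)$ a Poisson process of intensity $|\mu|$ and $(\xi_i)$ i.i.d. with law $\mu/|\mu|$, independent of $(N_t)$. The signed integrated tail is $\overline\mu_s(x)=\mu((x,\infty))$ for $x>0$ and $\overline\mu_s(x)=0$ for $x\le0$; $\pi$ is extended by $0$ to $(-\infty,0]$, so $(\overline\mu_s*\pi)(x)=\int_0^x\mu((x-z,\infty))\pi(z)\,\mathrm{d}z$ for $x>0$. Solutions are regarded as Markov processes started in, and with state space, $(0,\infty)$; $\mathbb{P}^x(\cdot)=\mathbb{P}(\cdot\mid X_0=x)$. For $\Delta>0$ the $\Delta$-skeleton chain $(X_{n\Delta})_{n\in\mathbb{N}}$ is irreducible if for all Borel sets $B\subset(0,\infty)$ with positive Lebesgue measure and all $x\in(0,\infty)$ there exists $n\in\mathbb{N}$ with $\mathbb{P}^x(X_{n\Delta}\in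 B)>0$. A probability distribution $\boldsymbol{\eta}$ is limiting for $(X_t)$ if $\lim_{t\to\infty}\|\mathbb{P}^x(X_t\in\cdot)-\boldsymbol{\eta}\|_{\mathrm{TV}}=0$ for all $x$ in the state space, where $\|\cdot\|_{\mathrm{TV}}$ is the total variation norm. The process $(X_t)$ is called ergodic if a limiting distribution exists. *)

theory Defs
  imports "HOL-Probability.Probability"
begin

section \<open>Piecewise weak differentiability\<close>

definition L1_loc :: "real set \<Rightarrow> (real \<Rightarrow> real) \<Rightarrow> bool" where
  "L1_loc U f \<longleftrightarrow> (\<forall>K. compact K \<and> K \<subseteq> U \<longrightarrow> set_integrable lborel K f)"

definition test_function :: "real set \<Rightarrow> (real \<Rightarrow> real) \<Rightarrow> bool" where
  "test_function U \<psi> \<longleftrightarrow>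
     (\<forall>n x. (deriv ^^ n) \<psi> field_differentiable (at x)) \<and>
     compact (closure {x. \<psi> x \<noteq> 0}) \<and> closure {x. \<psi> x \<noteq> 0} \<subseteq> U"

definition weak_derivative_on :: "real set \<Rightarrow> (real \<Rightarrow> real) \<Rightarrow> (real \<Rightarrow> real) \<Rightarrow> bool" where
  "weak_derivative_on U f g \<longleftrightarrow>
     (\<forall>\<psi>. test_function U \<psi> \<longrightarrow>
        (LINT x:U|lborel. f x * deriv \<psi> x) = - (LINT x:U|lborel. g x * \<psi> x))"

definition W11 :: "real set \<Rightarrow> (real \<Rightarrow> real) \<Rightarrow> bool" where
  "W11 U f \<longleftrightarrow> set_integrable lborel U f \<and>
     (\<exists>g. set_integrable lborel U g \<and> weak_derivative_on U f g)"

text \<open>The sequences are injective, so accumulation points of the sequence are limit points of its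
  range. As accumulation points are real, having \<open>0\<close> as the only one forces the sequence to
  tend to \<open>\<infinity>\<close> for \<open>i \<rightarrow> \<infinity>\<close>.\<close>

definition partition_seqs :: "(int \<Rightarrow> real) set" where
  "partition_seqs = {x. (\<forall>i. 0 < x i) \<and> (\<forall>i. x i < x (i + 1)) \<and> {y. y islimpt range x} = {0}}"

definition piecewise_weakly_differentiable :: "(real \<Rightarrow> real) \<Rightarrow> bool" where
  "piecewise_weakly_differentiable f \<longleftrightarrow>
     L1_loc {0<..} f \<and> (\<exists>x\<in>partition_seqs. \<forall>i. W11 {x i<..<x (i + 1)} f)"

section \<open>Compound Poisson processes\<close>

text \<open>The constant \<open>prob_space.indep_var\<close> requires both random variables to have the same value type.\<close>

definition indep_rv :: "'a measure \<Rightarrow> 'b measure \<Rightarrow> ('a \<Rightarrow> 'b) \<Rightarrow> 'c measure \<Rightarrow> ('a \<Rightarrow> 'c) \<Rightarrow> bool" where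
  "indep_rv M S X T Y \<longleftrightarrow> X \<in> M \<rightarrow>\<^sub>M S \<and> Y \<in> M \<rightarrow>\<^sub>M T \<and>
     prob_space.indep_set M {X -` A \<inter> space M |A. A \<in> sets S} {Y -` B \<inter> space M |B. B \<in> sets T}"

text \<open>Only the values at times \<open>t \<ge> 0\<close> matter. The truncated subtraction on \<open>nat\<close> is harmless because
  almost all paths are nondecreasing; right-continuity is with respect to the discrete topology
  of \<open>nat\<close>.\<close>

definition poisson_process :: "'a measure \<Rightarrow> real \<Rightarrow> (real \<Rightarrow> 'a \<Rightarrow> nat) \<Rightarrow> bool" where
  "poisson_process M r N \<longleftrightarrow> prob_space M \<and> 0 < r \<and>
     (\<forall>t\<ge>0. N t \<in> M \<rightarrow>\<^sub>M count_space UNIV) \<and>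
     (AE \<omega> in M. N 0 \<omega> = 0) \<and>
     (AE \<omega> in M. mono_on {0..} (\<lambda>t. N t \<omega>) \<and> (\<forall>t\<ge>0. continuous (at_right t) (\<lambda>s. N s \<omega>))) \<and>
     (\<forall>n (t :: nat \<Rightarrow> real). mono t \<and> 0 \<le> t 0 \<longrightarrow>
        prob_space.indep_vars M (\<lambda>_. count_space UNIV)
          (\<lambda>i \<omega>. N (t (Suc i)) \<omega> - N (t i) \<omega>) {..<n}) \<and>
     (\<forall>s t. 0 \<le> s \<and> s < t \<longrightarrow>
        distr M (count_space UNIV) (\<lambda>\<omega>. N t \<omega> - N s \<omega>) = measure_pmf (poisson_pmf (r * (t - s))))"

definition compound_poisson_process :: "'a measure \<Rightarrow> real measure \<Rightarrow> (real \<Rightarrow> 'a \<Rightarrow> real) \<Rightarrow> bool"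
where
  "compound_poisson_process M \<mu> L \<longleftrightarrow> prob_space M \<and>
     sets \<mu> = sets borel \<and> finite_measure \<mu> \<and> emeasure \<mu> {0} = 0 \<and>
     (\<exists>N \<xi>. poisson_process M (measure \<mu> UNIV) N \<and>
        prob_space.indep_vars M (\<lambda>_. borel) \<xi> (UNIV :: nat set) \<and>
        (\<forall>i. distr M borel (\<xi> i) = scale_measure (inverse (emeasure \<mu> UNIV)) \<mu>) \<and>
        indep_rv M
          (PiM {0..} (\<lambda>_. count_space UNIV)) (\<lambda>\<omega>. \<lambda>t\<in>{0..}. N t \<omega>)
          (PiM UNIV (\<lambda>_. borel)) (\<lambda>\<omega> i. \<xi> i \<omega>) \<and>
        (AE \<omega> in M. \<forall>t\<ge>0. L t \<omega> = (\<Sum>i<N t \<omega>. \<xi> i \<omega>)))"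

definition measure_support :: "real measure \<Rightarrow> real set" where
  "measure_support \<mu> = {x. \<forall>U. open U \<and> x \<in> U \<longrightarrow> 0 < emeasure \<mu> U}"

section \<open>The drift coefficient\<close>

definition signed_tail :: "real measure \<Rightarrow> real \<Rightarrow> real" where
  "signed_tail \<mu> x = (if 0 < x then measure \<mu> {x<..} else 0)"

definition zero_ext :: "(real \<Rightarrow> real) \<Rightarrow> real \<Rightarrow> real" where
  "zero_ext f x = (if 0 < x then f x else 0)"

definition fun_convolution :: "(real \<Rightarrow> real) \<Rightarrow> (real \<Rightarrow> real) \<Rightarrow> real \<Rightarrow> real" where
  "fun_convolution f g x = (LINT z|lborel. f (x - z) * g z)"

definition drift :: "real measure \<Rightarrow> (real \<Rightarrow> real) \<Rightarrow> real \<Rightarrow> real" where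
  "drift \<mu> p x = - indicator {0<..} x * (fun_convolution (signed_tail \<mu>) (zero_ext p) x / p x)"

section \<open>Solutions on the state space \<open>(0, \<infinity>)\<close>\<close>

abbreviation state_space :: "real measure" where
  "state_space \<equiv> restrict_space borel {0<..}"

text \<open>The noise \<open>L\<close> has independent increments relative to the filtration \<open>F\<close>, and the solution is
  adapted. The integral equation is required simultaneously for all times, outside a null set.
  Measurability of \<open>X t\<close> into \<^const>\<open>state_space\<close> means that \<open>X\<close> takes values in \<open>(0, \<infinity>)\<close>.\<close>

definition sde_solution ::
  "(real \<Rightarrow> real) \<Rightarrow> 'a measure \<Rightarrow> (real \<Rightarrow> 'a measure) \<Rightarrow> (real \<Rightarrow> 'a \<Rightarrow> real) \<Rightarrow> (real \<Rightarrow> 'a \<Rightarrow> real) \<Rightarrow> bool"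
where
  "sde_solution \<phi> M F L X \<longleftrightarrow> prob_space M \<and>
     filtration (space M) F \<and> (\<forall>t. subalgebra M (F t)) \<and>
     (\<forall>t\<ge>0. L t \<in> F t \<rightarrow>\<^sub>M borel) \<and>
     (\<forall>s t. 0 \<le> s \<and> s < t \<longrightarrow>
        indep_rv M (F s) (\<lambda>\<omega>. \<omega>) borel (\<lambda>\<omega>. L t \<omega> - L s \<omega>)) \<and>
     (\<forall>t\<ge>0. X t \<in> F t \<rightarrow>\<^sub>M state_space) \<and>
     (AE \<omega> in M. \<forall>t\<ge>0. set_integrable lborel {0..t} (\<lambda>s. \<phi> (X s \<omega>)) \<and>
        X t \<omega> = X 0 \<omega> + (LINT s:{0..t}|lborel. \<phi> (X s \<omega>)) + L t \<omega>)"

text \<open>For a family \<open>P\<close> of measures, \<open>P x\<close> being the law under which \<open>X\<close> starts in \<open>x\<close>:\<close>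

definition transition :: "(real \<Rightarrow> 'a measure) \<Rightarrow> (real \<Rightarrow> 'a \<Rightarrow> real) \<Rightarrow> real \<Rightarrow> real \<Rightarrow> real measure"
where
  "transition P X t x = distr (P x) state_space (X t)"

definition markov_process ::
  "(real \<Rightarrow> 'a measure) \<Rightarrow> (real \<Rightarrow> 'a measure) \<Rightarrow> (real \<Rightarrow> 'a \<Rightarrow> real) \<Rightarrow> bool"
where
  "markov_process P F X \<longleftrightarrow>
     (\<forall>x>0. prob_space (P x) \<and> filtration (space (P x)) F \<and> (\<forall>t. subalgebra (P x) (F t)) \<and>
        (\<forall>t\<ge>0. X t \<in> F t \<rightarrow>\<^sub>M state_space) \<and> (AE \<omega> in P x. X 0 \<omega> = x)) \<and>
     (\<forall>t\<ge>0. transition P X t \<in> state_space \<rightarrow>\<^sub>M prob_algebra state_space) \<and>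
     (\<forall>x>0. \<forall>s\<ge>0. \<forall>t\<ge>0. \<forall>B\<in>sets state_space.
        AE \<omega> in P x. real_cond_exp (P x) (F s) (\<lambda>\<omega>. indicator B (X (s + t) \<omega>)) \<omega>
          = measure (transition P X t (X s \<omega>)) B)"

section \<open>Irreducibility and ergodicity\<close>

text \<open>The times \<open>n\<close> range over \<open>n \<ge> 1\<close>. Admitting \<open>n = 0\<close> would give an equivalent notion, since \<open>B\<close>
  may be replaced by \<open>B - {x}\<close>.\<close>

definition skeleton_irreducible :: "(real \<Rightarrow> 'a measure) \<Rightarrow> (real \<Rightarrow> 'a \<Rightarrow> real) \<Rightarrow> real \<Rightarrow> bool" where
  "skeleton_irreducible P X \<Delta> \<longleftrightarrow>
     (\<forall>B\<in>sets borel. B \<subseteq> {0<..} \<and> 0 < emeasure lborel B \<longrightarrow>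
        (\<forall>x>0. \<exists>n\<ge>1. 0 < measure (transition P X (real n * \<Delta>) x) B))"

text \<open>Total variation norm \<open>sup \<nu> - inf \<nu>\<close> of a finite signed measure \<open>\<nu>\<close>, which is the total mass of
  its variation measure.\<close>

definition tv_norm :: "'b measure \<Rightarrow> ('b set \<Rightarrow> real) \<Rightarrow> real" where
  "tv_norm S \<nu> = (SUP A\<in>sets S. \<nu> A) - (INF A\<in>sets S. \<nu> A)"

definition limiting_distribution ::
  "(real \<Rightarrow> 'a measure) \<Rightarrow> (real \<Rightarrow> 'a \<Rightarrow> real) \<Rightarrow> real measure \<Rightarrow> bool"
where
  "limiting_distribution P X \<eta> \<longleftrightarrow> prob_space \<eta> \<and> sets \<eta> = sets state_space \<and>
     (\<forall>x>0. ((\<lambda>t. tv_norm state_space (\<lambda>A. measure (transition P X t x) A - measure \<eta> A))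
        \<longlongrightarrow> 0) at_top)"

definition ergodic :: "(real \<Rightarrow> 'a measure) \<Rightarrow> (real \<Rightarrow> 'a \<Rightarrow> real) \<Rightarrow> bool" where
  "ergodic P X \<longleftrightarrow> (\<exists>\<eta>. limiting_distribution P X \<eta>)"

end

theory Submission
  imports Defs
begin

text \<open>
  Let \<open>\<kappa>\<close> be the transition kernel. Between jumps the solution follows the flow of the strictly
  negative drift, which carries every starting point towards the boundary point 0, reached only
  in infinite time. So with positive probability the process first moves close to 0 without a
  jump and then makes exactly one jump, of an absolutely continuous size. The law obtained in this
  way depends continuously, in total variation, on the point from which the jump is made, because
  translation is continuous in \<open>L\<^sup>1\<close>, and this continuity extends to the boundary point 0. Close to 0
  it therefore is almost a fixed law, which charges every set of positive Lebesgue measure. This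
  gives irreducibility, and it shows that the laws from any two starting points in a bounded set
  overlap.

  For large \<open>x\<close> the downward drift is faster than the mean jump rate, so \<open>X\<close> is dominated by a
  Lindley recursion with negative drift, and the laws \<open>\<kappa> t x\<close> are tight, with most of the mass
  eventually in a bounded set that does not depend on \<open>x\<close>. Overlap and tightness make
  \<open>\<kappa> t x\<close> a Cauchy family in total variation with a limit that does not depend on \<open>x\<close>. Neither an
  invariant law nor the generator is needed.
\<close>

section \<open>A uniform ergodic theorem for tight kernels\<close>

text \<open>The drift need not be continuous, so uniqueness for the deterministic motion between
  jumps cannot rest on a Lipschitz condition. It rests on travel time: with \<open>G\<close> an
  antiderivative of the reciprocal speed, the motion is translation in the coordinate
  \<open>G\<close>. The two conditions on \<open>\<pi>\<close> govern the two ends of the half-line.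
  The bound of the integral of \<open>\<pi>\<close> over (0,x) by \<open>C' * \<pi> x * x\<close>
  makes the reciprocal speed at least a constant over x near 0, hence not integrable there. The
  exponential tail makes the speed at infinity exceed the mean jump rate. The state space is not
  compact, so overlap holds only for bounded sets of starting points, after a time depending on the
  bound. What must not depend on it is the amount of overlap. To achieve this, the process is first
  run until at least half of its mass lies in a fixed set \<open>{0<..R0}\<close>; the waiting and
  the single jump start from there. The comparison with a random walk is made at integer times,
  where the jump sums of unit intervals serve as increments.\<close>

lemma integral_diff_le_oscillation:
  fixes f :: "'a \<Rightarrow> real"
  assumes "prob_space p" "prob_space q" and sets: "sets p = sets q"
    and f[measurable]: "f \<in> borel_measurable p"
    and bounds: "\<And>x. x \<in> space p \<Longrightarrow> a \<le> f x \<and> f x \<le> a + \<delta>"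
    and "0 \<le> \<delta>" "0 \<le> d"
    and d: "\<And>A. A \<in> sets p \<Longrightarrow> measure p A - measure q A \<le> d"
  shows "(\<integral>x. f x \<partial>p) - (\<integral>x. f x \<partial>q) \<le> \<delta> * d"
proof -
  interpret p: prob_space p by fact
  interpret q: prob_space q by fact
  have space: "space p = space q" using sets by (rule sets_eq_imp_space_eq)
  have fq[measurable]: "f \<in> borel_measurable q"
    using f measurable_cong_sets[OF sets refl] by blast
  define g where "g x = f x - a" for x
  have gp[measurable]: "g \<in> borel_measurable p" and gq[measurable]: "g \<in> borel_measurable q"
    unfolding g_def by simp_all
  have g_bounds: "0 \<le> g x" "g x \<le> \<delta>" if "x \<in> space p" for x
    using bounds[OF that] by (auto simp: g_def)
  \<comment> \<open>Layer cake formula: the integral of \<open>g\<close> is the integral over the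
    levels t in [0,\<delta>] of the mass of \<open>t < g\<close>. Each level is a set, so there the
    two measures are compared by \<open>d\<close>, and the levels accumulate to
    \<open>\<delta> * d\<close>.\<close>
  have layer: "(\<integral>\<^sup>+x. ennreal (g x) \<partial>r) =
      (\<integral>\<^sup>+t. emeasure r {x\<in>space r. t < g x} * indicator {0..\<delta>} t \<partial>lborel)"
    if r: "prob_space r" and space': "space r = space p" and [measurable]: "g \<in> borel_measurable r" for r
  proof -
    interpret r: prob_space r by fact
    interpret pair_sigma_finite r lborel ..
    have "(\<integral>\<^sup>+x. ennreal (g x) \<partial>r)
        = (\<integral>\<^sup>+x. (\<integral>\<^sup>+t. indicator {t. 0 \<le> t \<and> t < g x} t \<partial>lborel) \<partial>r)"
    proof (rule nn_integral_cong)
      fix x assume "x \<in> space r"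
      then have "0 \<le> g x" using g_bounds space' by simp
      moreover have "{t. 0 \<le> t \<and> t < g x} = {0..<g x}" by auto
      ultimately show "ennreal (g x) = (\<integral>\<^sup>+t. indicator {t. 0 \<le> t \<and> t < g x} t \<partial>lborel)"
        by simp
    qed
    also have "\<dots> = (\<integral>\<^sup>+x. (\<integral>\<^sup>+t. indicator {z\<in>space (r \<Otimes>\<^sub>M lborel). 0 \<le> snd z \<and> snd z < g (fst z)} (x, t) \<partial>lborel) \<partial>r)"
      by (intro nn_integral_cong) (auto simp: space_pair_measure split: split_indicator)
    also have "\<dots> = (\<integral>\<^sup>+t. (\<integral>\<^sup>+x. indicator {z\<in>space (r \<Otimes>\<^sub>M lborel). 0 \<le> snd z \<and> snd z < g (fst z)} (x, t) \<partial>r) \<partial>lborel)"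
      by (rule Fubini'[symmetric]) measurable
    also have "\<dots> = (\<integral>\<^sup>+t. (\<integral>\<^sup>+x. indicator {x\<in>space r. t < g x} x * indicator {0..\<delta>} t \<partial>r) \<partial>lborel)"
      using g_bounds unfolding space'[symmetric]
      by (intro nn_integral_cong)
         (fastforce simp: space_pair_measure split: split_indicator)
    also have "\<dots> = (\<integral>\<^sup>+t. emeasure r {x\<in>space r. t < g x} * indicator {0..\<delta>} t \<partial>lborel)"
      by (intro nn_integral_cong) (simp add: nn_integral_multc)
    finally show ?thesis .
  qed
  have le: "emeasure p {x\<in>space p. t < g x} \<le> emeasure q {x\<in>space q. t < g x} + ennreal d" for t
  proof -
    have "{x\<in>space p. t < g x} \<in> sets p" by measurable
    from d[OF this] show ?thesis
      using \<open>0 \<le> d\<close> by (simp add: p.emeasure_eq_measure q.emeasure_eq_measure space flip: ennreal_plus)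
  qed
  have "(\<integral>\<^sup>+x. ennreal (g x) \<partial>p) =
      (\<integral>\<^sup>+t. emeasure p {x\<in>space p. t < g x} * indicator {0..\<delta>} t \<partial>lborel)"
    by (rule layer) (auto simp: p.prob_space_axioms)
  also have "\<dots> \<le> (\<integral>\<^sup>+t. (emeasure q {x\<in>space q. t < g x} + ennreal d) * indicator {0..\<delta>} t \<partial>lborel)"
    using le by (intro nn_integral_mono mult_right_mono) auto
  also have "\<dots> = (\<integral>\<^sup>+t. emeasure q {x\<in>space q. t < g x} * indicator {0..\<delta>} t \<partial>lborel)
      + (\<integral>\<^sup>+t. ennreal d * indicator {0..\<delta>} t \<partial>lborel)"
  proof -
    interpret pair_sigma_finite q lborel ..
    have [measurable]: "(\<lambda>t. emeasure q {x\<in>space q. t < g x}) \<in> borel_measurable borel"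
    proof -
      have "(\<lambda>t. emeasure q (Pair t -` {z\<in>space (lborel \<Otimes>\<^sub>M q). fst z < g (snd z)})) \<in> borel_measurable lborel"
        by (rule q.measurable_emeasure_Pair) measurable
      moreover have "Pair t -` {z\<in>space (lborel \<Otimes>\<^sub>M q). fst z < g (snd z)} = {x\<in>space q. t < g x}" for t
        by (auto simp: space_pair_measure)
      ultimately show ?thesis by simp
    qed
    show ?thesis by (subst nn_integral_add[symmetric]) (auto simp: distrib_right)
  qed
  also have "(\<integral>\<^sup>+t. emeasure q {x\<in>space q. t < g x} * indicator {0..\<delta>} t \<partial>lborel)
      = (\<integral>\<^sup>+x. ennreal (g x) \<partial>q)"
    by (rule layer[symmetric]) (auto simp: q.prob_space_axioms space)
  also have "(\<integral>\<^sup>+t. ennreal d * indicator {0..\<delta>} t \<partial>lborel) = ennreal (\<delta> * d)"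
    using \<open>0 \<le> \<delta>\<close> \<open>0 \<le> d\<close> by (simp add: nn_integral_cmult mult.commute ennreal_mult')
  finally have *: "(\<integral>\<^sup>+x. ennreal (g x) \<partial>p) \<le> (\<integral>\<^sup>+x. ennreal (g x) \<partial>q) + ennreal (\<delta> * d)" .
  have int_p: "integrable p g"
    by (rule p.integrable_const_bound[where B=\<delta>]) (use g_bounds in auto)
  have int_q: "integrable q g"
    by (rule q.integrable_const_bound[where B=\<delta>]) (use g_bounds space in auto)
  have pos: "0 \<le> (\<integral>x. g x \<partial>q)"
    using g_bounds space by (intro integral_nonneg_AE AE_I2) auto
  have "ennreal (\<integral>x. g x \<partial>p) \<le> ennreal (\<integral>x. g x \<partial>q) + ennreal (\<delta> * d)"
    using * nn_integral_eq_integral[OF int_p AE_I2] nn_integral_eq_integral[OF int_q AE_I2] g_bounds(1) space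
    by simp
  then have main: "(\<integral>x. g x \<partial>p) \<le> (\<integral>x. g x \<partial>q) + \<delta> * d"
    using pos \<open>0 \<le> \<delta>\<close> \<open>0 \<le> d\<close> by (simp flip: ennreal_plus)
  have fg: "f = (\<lambda>x. g x + a)" by (auto simp: g_def)
  have "(\<integral>x. f x \<partial>p) = (\<integral>x. g x \<partial>p) + a"
    unfolding fg using int_p by (simp add: p.prob_space)
  moreover have "(\<integral>x. f x \<partial>q) = (\<integral>x. g x \<partial>q) + a"
    unfolding fg using int_q by (simp add: q.prob_space)
  ultimately show ?thesis using main by simp
qed

text \<open>Oscillation is controlled only on bounded sets. This lemma pays for altering the
  integrand elsewhere: beyond \<open>R\<close> the loss is at most 1, so the price is the tail mass.
  It is used in both directions, the original integrand playing the role of \<open>f\<close> in one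
  and of \<open>f'\<close> in the other.\<close>

lemma integral_le_truncated:
  fixes f :: "real \<Rightarrow> real"
  assumes "prob_space p" and sets: "sets p = sets state_space"
    and [measurable]: "f \<in> borel_measurable p" "f' \<in> borel_measurable p"
    and "\<And>x. 0 < x \<Longrightarrow> x \<le> R \<Longrightarrow> f x \<le> f' x" "\<And>x. 0 < x \<Longrightarrow> f x \<le> f' x + 1"
    and bd: "\<And>x. 0 < x \<Longrightarrow> \<bar>f x\<bar> \<le> b" "\<And>x. 0 < x \<Longrightarrow> \<bar>f' x\<bar> \<le> b"
    and tail: "0 < R" "measure p {R<..} \<le> e"
  shows "(\<integral>x. f x \<partial>p) \<le> (\<integral>x. f' x \<partial>p) + e"
proof -
  interpret prob_space p by fact
  have space: "space p = {0<..}" using sets_eq_imp_space_eq[OF sets] by (simp add: space_restrict_space)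
  have R: "{R<..} \<in> sets p" unfolding sets using \<open>0 < R\<close>
    by (auto simp: sets_restrict_space intro!: image_eqI[of _ _ "{R<..}"])
  have i: "integrable p f" "integrable p f'"
    by (rule integrable_const_bound[where B=b]; use bd space in auto)+
  have ii: "integrable p (indicat_real {R<..})" using R by (simp add: emeasure_eq_measure)
  have "(\<integral>x. f x \<partial>p) \<le> (\<integral>x. f' x + indicator {R<..} x \<partial>p)"
    using assms(5,6) space i ii by (intro integral_mono) (auto split: split_indicator)
  also have "\<dots> = (\<integral>x. f' x \<partial>p) + measure p {R<..}"
    using i ii R sets.sets_into_space[OF R] by (simp add: Int_absorb1)
  finally show ?thesis using tail by simp
qed

section \<open>Markov kernels on the half-line: contraction and convergence\<close>

locale markov_kernel =
  fixes \<kappa> :: "real \<Rightarrow> real \<Rightarrow> real measure"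
  assumes kernel: "0 \<le> t \<Longrightarrow> \<kappa> t \<in> state_space \<rightarrow>\<^sub>M prob_algebra state_space"
    and kernel_0: "\<lbrakk>0 < x; B \<in> sets state_space\<rbrakk> \<Longrightarrow> emeasure (\<kappa> 0 x) B = indicator B x"
    and chapman_kolmogorov: "\<lbrakk>0 \<le> s; 0 \<le> t; 0 < x; B \<in> sets state_space\<rbrakk> \<Longrightarrow>
      measure (\<kappa> (s + t) x) B = (\<integral>y. measure (\<kappa> t y) B \<partial>\<kappa> s x)"

begin

lemma
  assumes "0 \<le> t" "0 < x"
  shows prob_space_kernel: "prob_space (\<kappa> t x)"
    and sets_kernel: "sets (\<kappa> t x) = sets state_space"
proof -
  have "\<kappa> t x \<in> space (prob_algebra state_space)"
    using measurable_space[OF kernel[OF assms(1)], of x] assms by (simp add: space_restrict_space)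
  then show "prob_space (\<kappa> t x)" "sets (\<kappa> t x) = sets state_space"
    by (auto simp: space_prob_algebra)
qed

lemma measurable_kernel:
  assumes "0 \<le> t" "A \<in> sets state_space"
  shows "(\<lambda>y. measure (\<kappa> t y) A) \<in> borel_measurable state_space"
  using measurable_compose[OF measurable_prob_algebraD[OF kernel[OF assms(1)]] measurable_measure_subprob_algebra[OF assms(2)]]
  by simp

lemma measurable_kernel':
  assumes "0 \<le> t" "A \<in> sets state_space" "0 \<le> s" "0 < x"
  shows "(\<lambda>y. measure (\<kappa> t y) A) \<in> borel_measurable (\<kappa> s x)"
  using measurable_kernel[OF assms(1,2)] measurable_cong_sets[OF sets_kernel[OF assms(3,4)] refl] by blast

lemma emeasure_chapman_kolmogorov:
  assumes "0 \<le> s" "0 \<le> t" "0 < x" "B \<in> sets state_space"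
  shows "emeasure (\<kappa> (s + t) x) B = (\<integral>\<^sup>+y. emeasure (\<kappa> t y) B \<partial>\<kappa> s x)"
proof -
  interpret s: prob_space "\<kappa> s x" by (rule prob_space_kernel) fact+
  interpret st: prob_space "\<kappa> (s + t) x" by (rule prob_space_kernel) (use assms in auto)
  have pos: "0 < y" if "y \<in> space (\<kappa> s x)" for y
    using that sets_eq_imp_space_eq[OF sets_kernel[OF assms(1,3)]] by (simp add: space_restrict_space)
  have "emeasure (\<kappa> (s + t) x) B = ennreal (\<integral>y. measure (\<kappa> t y) B \<partial>\<kappa> s x)"
    using chapman_kolmogorov[OF assms] by (simp add: st.emeasure_eq_measure)
  also have "\<dots> = (\<integral>\<^sup>+y. ennreal (measure (\<kappa> t y) B) \<partial>\<kappa> s x)"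
    by (intro nn_integral_eq_integral[symmetric] s.integrable_const_bound[where B=1] measurable_kernel' AE_I2)
       (use assms pos prob_space.prob_le_1[OF prob_space_kernel] in auto)
  also have "\<dots> = (\<integral>\<^sup>+y. emeasure (\<kappa> t y) B \<partial>\<kappa> s x)"
    using pos by (intro nn_integral_cong)
      (simp add: finite_measure.emeasure_eq_measure prob_space_kernel assms prob_space.finite_measure)
  finally show ?thesis .
qed

end

text \<open>\<open>overlap\<close> means that the laws from any two points of \<open>{0<..R}\<close>
  share mass at least \<open>\<gamma>\<close> at a common time. The time may depend on
  \<open>R\<close>, but \<open>\<gamma>\<close> is fixed: the contraction is iterated over changing
  radii, and a constant varying with the radius could destroy the geometric rate.\<close>

locale tight_contracting_kernel = markov_kernel +
  fixes \<gamma> :: real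
  assumes \<gamma>: "0 < \<gamma>" "\<gamma> < 1"
    and overlap: "\<exists>t\<ge>0. \<forall>x\<in>{0<..R}. \<forall>y\<in>{0<..R}. \<forall>A\<in>sets state_space.
      measure (\<kappa> t x) A - measure (\<kappa> t y) A \<le> 1 - \<gamma>"
    and tight: "0 < \<epsilon> \<Longrightarrow> \<exists>R'>0. \<forall>t\<ge>0. \<forall>x\<in>{0<..R}. measure (\<kappa> t x) {R'<..} \<le> \<epsilon>"
begin

text \<open>After the overlap time s the laws from \<open>{0<..R}\<close> differ by at most
  \<open>1 - \<gamma>\<close>. By tightness they sit almost entirely in some
  \<open>{0<..R'}\<close>, where the induction hypothesis bounds the oscillation of the map from z
  to \<open>measure (\<kappa> t z) A\<close>. The two factors multiply. Every step changes the
  radius, so the induction generalises over \<open>R\<close>.\<close>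

lemma contraction:
  "\<exists>t\<ge>0. \<forall>x\<in>{0<..R}. \<forall>y\<in>{0<..R}. \<forall>A\<in>sets state_space.
      measure (\<kappa> t x) A - measure (\<kappa> t y) A \<le> (1 - \<gamma> / 2) ^ n"
proof (induction n arbitrary: R)
  case 0
  have "measure (\<kappa> 0 x) A - measure (\<kappa> 0 y) A \<le> 1" if "0 < x" for x y A
    using prob_space.prob_le_1[OF prob_space_kernel[OF order_refl that], of A]
      measure_nonneg[of "\<kappa> 0 y" A] by linarith
  then show ?case by (intro exI[of _ 0]) auto
next
  case (Suc n)
  define \<delta> where "\<delta> = (1 - \<gamma> / 2) ^ n"
  have \<delta>: "0 < \<delta>" "\<delta> \<le> 1" using \<gamma> by (auto simp: \<delta>_def intro!: power_le_one)
  \<comment> \<open>The two truncations below cost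
    \<open>2 * \<epsilon> = \<gamma> * \<delta> / 2\<close> together, which turns
    \<open>(1 - \<gamma>) * \<delta>\<close> into \<open>(1 - \<gamma> / 2) * \<delta>\<close>. This
    is why the rate in the statement has \<open>\<gamma> / 2\<close>.\<close>
  define \<epsilon> where "\<epsilon> = \<gamma> * \<delta> / 4"
  have "\<epsilon> > 0" using \<gamma> \<delta> by (simp add: \<epsilon>_def)
  obtain s where s: "s \<ge> 0" "\<And>x y A. \<lbrakk>x\<in>{0<..R}; y\<in>{0<..R}; A\<in>sets state_space\<rbrakk> \<Longrightarrow>
      measure (\<kappa> s x) A - measure (\<kappa> s y) A \<le> 1 - \<gamma>"
    using overlap[of R] by blast
  obtain R' where R': "R' > 0" "\<And>t x. t \<ge> 0 \<Longrightarrow> x\<in>{0<..R} \<Longrightarrow> measure (\<kappa> t x) {R'<..} \<le> \<epsilon>"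
    using tight[OF \<open>\<epsilon> > 0\<close>, of R] by blast
  obtain t where t: "t \<ge> 0" "\<And>x y A. \<lbrakk>x\<in>{0<..R'}; y\<in>{0<..R'}; A\<in>sets state_space\<rbrakk> \<Longrightarrow>
      measure (\<kappa> t x) A - measure (\<kappa> t y) A \<le> \<delta>"
    using Suc.IH[of R'] unfolding \<delta>_def by blast
  have "measure (\<kappa> (s + t) x) A - measure (\<kappa> (s + t) y) A \<le> (1 - \<gamma> / 2) * \<delta>"
    if xy: "x\<in>{0<..R}" "y\<in>{0<..R}" and A: "A\<in>sets state_space" for x y A
  proof -
    have pos: "0 < x" "0 < y" using xy by auto
    define f where "f z = measure (\<kappa> t z) A" for z
    have f[measurable]: "f \<in> borel_measurable (\<kappa> s x)" "f \<in> borel_measurable (\<kappa> s y)"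
      unfolding f_def by (rule measurable_kernel'; use t s A pos in auto)+
    have f01: "0 \<le> f z" "f z \<le> 1" if "0 < z" for z
      using prob_space.prob_le_1[OF prob_space_kernel[OF t(1) that], of A] by (auto simp: f_def)
    define a where "a = (INF z\<in>{0<..R'}. f z)"
    have bdd: "bdd_below (f ` {0<..R'})" using f01 by (intro bdd_belowI[of _ 0]) auto
    have ne: "{0<..R'} \<noteq> {}" using R' by auto
    have a_le: "a \<le> f z" if "z\<in>{0<..R'}" for z
      unfolding a_def by (rule cINF_lower[OF bdd that])
    have le_a: "f z \<le> a + \<delta>" if "z\<in>{0<..R'}" for z
    proof -
      have "f z - \<delta> \<le> a" unfolding a_def
        using t(2)[OF that _ A] by (intro cINF_greatest[OF ne]) (auto simp: f_def algebra_simps)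
      then show ?thesis by simp
    qed
    have "0 \<le> a" unfolding a_def using f01 by (intro cINF_greatest[OF ne]) auto
    have "a \<le> 1" using a_le[of R'] f01[of R'] R' by auto
    \<comment> \<open>The clamped function agrees with \<open>f\<close> on \<open>{0<..R'}\<close>
      and stays in a band of width \<open>\<delta>\<close> everywhere, as the oscillation bound
      requires.\<close>
    define f' where "f' z = min (max (f z) a) (a + \<delta>)" for z
    have f'[measurable]: "f' \<in> borel_measurable (\<kappa> s x)" "f' \<in> borel_measurable (\<kappa> s y)"
      unfolding f'_def by measurable
    have f'_eq: "f' z = f z" if "z\<in>{0<..R'}" for z
      using a_le[OF that] le_a[OF that] by (auto simp: f'_def)
    have f'_b: "a \<le> f' z" "f' z \<le> a + \<delta>" for z using \<delta> by (auto simp: f'_def)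
    have *: "f z \<le> f' z + 1" "f' z \<le> f z + 1" if "0 < z" for z
      using f01[OF that] \<open>a \<le> 1\<close> \<open>0 \<le> a\<close> \<delta> by (auto simp: f'_def)
    have b: "\<bar>f z\<bar> \<le> 2" "\<bar>f' z\<bar> \<le> 2" if "0 < z" for z
      using f01[OF that] f'_b[of z] \<open>a \<le> 1\<close> \<open>0 \<le> a\<close> \<delta> by auto
    have 1: "(\<integral>z. f z \<partial>\<kappa> s x) \<le> (\<integral>z. f' z \<partial>\<kappa> s x) + \<epsilon>"
      by (rule integral_le_truncated[where R=R' and b=2])
        (use prob_space_kernel sets_kernel s pos f'_eq * b R' xy in auto)
    have 2: "(\<integral>z. f' z \<partial>\<kappa> s y) \<le> (\<integral>z. f z \<partial>\<kappa> s y) + \<epsilon>"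
      by (rule integral_le_truncated[where R=R' and b=2])
        (use prob_space_kernel sets_kernel s pos f'_eq * b R' xy in auto)
    have 3: "(\<integral>z. f' z \<partial>\<kappa> s x) - (\<integral>z. f' z \<partial>\<kappa> s y) \<le> \<delta> * (1 - \<gamma>)"
      by (rule integral_diff_le_oscillation[where a=a])
        (use prob_space_kernel sets_kernel s(1) pos f'_b \<delta> \<gamma> s(2)[OF xy] in auto)
    have "measure (\<kappa> (s + t) x) A - measure (\<kappa> (s + t) y) A = (\<integral>z. f z \<partial>\<kappa> s x) - (\<integral>z. f z \<partial>\<kappa> s y)"
      using s t A pos by (simp add: chapman_kolmogorov f_def)
    also have "\<dots> \<le> \<delta> * (1 - \<gamma>) + 2 * \<epsilon>" using 1 2 3 by linarith
    also have "\<dots> = (1 - \<gamma> / 2) * \<delta>" by (simp add: \<epsilon>_def algebra_simps)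
    finally show ?thesis .
  qed
  then show ?case using s(1) t(1) unfolding \<delta>_def by (intro exI[of _ "s + t"]) auto
qed

lemma contraction':
  assumes "0 < \<epsilon>"
  shows "\<exists>t\<ge>0. \<forall>x\<in>{0<..R}. \<forall>y\<in>{0<..R}. \<forall>A\<in>sets state_space.
      measure (\<kappa> t x) A - measure (\<kappa> t y) A \<le> \<epsilon>"
proof -
  have "(\<lambda>n. (1 - \<gamma> / 2) ^ n) \<longlonglongrightarrow> 0" using \<gamma> by (intro LIMSEQ_power_zero) auto
  then have "eventually (\<lambda>n. (1 - \<gamma> / 2) ^ n < \<epsilon>) sequentially" using assms by (rule order_tendstoD)
  then obtain n where "(1 - \<gamma> / 2) ^ n < \<epsilon>" by (auto simp: eventually_sequentially)
  then show ?thesis using contraction[of R n] by (meson less_imp_le order_trans)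
qed

text \<open>For s beyond the contraction time t, the law \<open>\<kappa> s z\<close> is an average
  of the laws \<open>\<kappa> t w\<close> with w distributed by \<open>\<kappa> (s - t) z\<close>.
  Most of these w lie in a bounded set, on which \<open>\<kappa> t w\<close> is within e of
  \<open>\<kappa> t z\<close>. Hence every later law is within \<open>2 * e\<close> of the one at
  time t, and comparing the two starting points at time t adds one more e: five in total.\<close>

lemma uniformly_cauchy:
  assumes "0 < x" "0 < y" "0 < \<epsilon>"
  shows "\<exists>T\<ge>0. \<forall>s\<ge>T. \<forall>t\<ge>T. \<forall>A\<in>sets state_space. measure (\<kappa> s x) A - measure (\<kappa> t y) A \<le> \<epsilon>"
proof -
  define e where "e = \<epsilon> / 5"
  have "e > 0" using assms by (simp add: e_def)
  obtain R' where R': "R' > 0" "\<And>t z. t \<ge> 0 \<Longrightarrow> z\<in>{0<..max x y} \<Longrightarrow> measure (\<kappa> t z) {R'<..} \<le> e"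
    using tight[OF \<open>e > 0\<close>, of "max x y"] by blast
  define R where "R = max R' (max x y)"
  obtain t where t: "t \<ge> 0" "\<And>x y A. \<lbrakk>x\<in>{0<..R}; y\<in>{0<..R}; A\<in>sets state_space\<rbrakk> \<Longrightarrow>
      measure (\<kappa> t x) A - measure (\<kappa> t y) A \<le> e"
    using contraction'[OF \<open>e > 0\<close>, of R] by blast
  have near: "\<bar>measure (\<kappa> s z) A - measure (\<kappa> t z) A\<bar> \<le> 2 * e"
    if "s \<ge> t" "z = x \<or> z = y" and A: "A \<in> sets state_space" for s z A
  proof -
    have z: "0 < z" "z \<le> R" "z \<in> {0<..max x y}" using that assms by (auto simp: R_def)
    have s: "0 \<le> s - t" using that by simp
    interpret prob_space "\<kappa> (s - t) z" by (rule prob_space_kernel[OF s z(1)])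
    define f where "f z = measure (\<kappa> t z) A" for z
    have f[measurable]: "f \<in> borel_measurable (\<kappa> (s - t) z)"
      unfolding f_def by (rule measurable_kernel') (use t s A z in auto)
    have f01: "0 \<le> f z" "f z \<le> 1" if "0 < z" for z
      using prob_space.prob_le_1[OF prob_space_kernel[OF t(1) that], of A] by (auto simp: f_def)
    have close: "\<bar>f w - f z\<bar> \<le> e" if "0 < w" "w \<le> R'" for w
    proof -
      have "w \<in> {0<..R}" "z \<in> {0<..R}" using that z by (auto simp: R_def)
      from t(2)[OF this A] t(2)[OF this(2,1) A] show ?thesis by (simp add: f_def)
    qed
    have eq: "measure (\<kappa> s z) A = (\<integral>w. f w \<partial>\<kappa> (s - t) z)"
      using chapman_kolmogorov[OF s t(1) z(1) A] by (simp add: f_def)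
    have b: "\<bar>f w\<bar> \<le> 2" "\<bar>f z + e\<bar> \<le> 2 + e" "\<bar>f z - e\<bar> \<le> 2 + e" if "0 < w" for w
      using f01[OF that] f01[OF z(1)] \<open>e > 0\<close> by auto
    have "(\<integral>w. f w \<partial>\<kappa> (s - t) z) \<le> (\<integral>w. f z + e \<partial>\<kappa> (s - t) z) + e"
      by (rule integral_le_truncated[where R=R' and b="2+e"])
        (use prob_space_axioms sets_kernel[OF s z(1)] close b R' s z f01 \<open>e > 0\<close> in \<open>auto simp: abs_le_iff add_increasing\<close>; smt (verit) close f01 z(1))+
    moreover have "(\<integral>w. f z - e \<partial>\<kappa> (s - t) z) \<le> (\<integral>w. f w \<partial>\<kappa> (s - t) z) + e"
      by (rule integral_le_truncated[where R=R' and b="2+e"])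
        (use prob_space_axioms sets_kernel[OF s z(1)] close b R' s z f01 \<open>e > 0\<close> in \<open>auto simp: abs_le_iff add_increasing\<close>; smt (verit) close f01 z(1))+
    ultimately show ?thesis unfolding eq f_def by (simp add: prob_space abs_le_iff)
  qed
  have "measure (\<kappa> s x) A - measure (\<kappa> u y) A \<le> \<epsilon>" if "s \<ge> t" "u \<ge> t" "A \<in> sets state_space" for s u A
  proof -
    have "measure (\<kappa> t x) A - measure (\<kappa> t y) A \<le> e"
      using assms that by (intro t(2)) (auto simp: R_def)
    moreover have "\<bar>measure (\<kappa> s x) A - measure (\<kappa> t x) A\<bar> \<le> 2 * e"
      "\<bar>measure (\<kappa> u y) A - measure (\<kappa> t y) A\<bar> \<le> 2 * e"
      using near that by auto
    moreover have "\<epsilon> = 5 * e" by (simp add: e_def)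
    ultimately show ?thesis by linarith
  qed
  then show ?thesis using t(1) by blast
qed

text \<open>The limit is taken set by set along integer times from the arbitrary starting point 1.
  Uniformity over sets is what makes it countably additive: continuity at the empty set is inherited
  from the single measure \<open>\<kappa> T 1\<close> with T large.\<close>

lemma uniform_limit_measure:
  "\<exists>\<eta>. prob_space \<eta> \<and> sets \<eta> = sets state_space \<and>
    (\<forall>x>0. \<forall>\<epsilon>>0. \<exists>T\<ge>0. \<forall>t\<ge>T. \<forall>A\<in>sets state_space. \<bar>measure (\<kappa> t x) A - measure \<eta> A\<bar> \<le> \<epsilon>)"
proof -
  have cauchy: "Cauchy (\<lambda>n. measure (\<kappa> (real n) 1) A)" if A: "A \<in> sets state_space" for A
  proof (rule metric_CauchyI)
    fix e :: real assume "0 < e"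
    obtain T where T: "\<And>s t A. \<lbrakk>s\<ge>T; t\<ge>T; A\<in>sets state_space\<rbrakk> \<Longrightarrow> measure (\<kappa> s 1) A - measure (\<kappa> t 1) A \<le> e / 2"
      using uniformly_cauchy[of 1 1 "e / 2"] \<open>0 < e\<close> by auto
    obtain N where N: "real N \<ge> T" using real_arch_simple by blast
    show "\<exists>M. \<forall>m\<ge>M. \<forall>n\<ge>M. dist (measure (\<kappa> (real m) 1) A) (measure (\<kappa> (real n) 1) A) < e"
    proof (intro exI allI impI)
      fix m n assume "m \<ge> N" "n \<ge> N"
      then have "real m \<ge> T" "real n \<ge> T" using N by linarith+
      then show "dist (measure (\<kappa> (real m) 1) A) (measure (\<kappa> (real n) 1) A) < e"
        using T[of "real m" "real n" A] T[of "real n" "real m" A] A \<open>0 < e\<close> by (auto simp: dist_real_def)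
    qed
  qed
  define h where "h A = lim (\<lambda>n. measure (\<kappa> (real n) 1) A)" for A
  have h: "(\<lambda>n. measure (\<kappa> (real n) 1) A) \<longlonglongrightarrow> h A" if "A \<in> sets state_space" for A
    unfolding h_def using cauchy[OF that] by (simp add: Cauchy_convergent flip: convergent_LIMSEQ_iff)
  have unif: "\<exists>T\<ge>0. \<forall>t\<ge>T. \<forall>A\<in>sets state_space. \<bar>measure (\<kappa> t x) A - h A\<bar> \<le> \<epsilon>"
    if x\<epsilon>: "0 < x" "0 < \<epsilon>" for x \<epsilon>
  proof -
    obtain T1 where T1: "T1 \<ge> 0" "\<And>s t A. \<lbrakk>s\<ge>T1; t\<ge>T1; A\<in>sets state_space\<rbrakk> \<Longrightarrow> measure (\<kappa> s x) A - measure (\<kappa> t 1) A \<le> \<epsilon>"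
      using uniformly_cauchy[OF x\<epsilon>(1) zero_less_one x\<epsilon>(2)] by metis
    obtain T2 where T2: "\<And>s t A. \<lbrakk>s\<ge>T2; t\<ge>T2; A\<in>sets state_space\<rbrakk> \<Longrightarrow> measure (\<kappa> s 1) A - measure (\<kappa> t x) A \<le> \<epsilon>"
      using uniformly_cauchy[OF zero_less_one x\<epsilon>] by metis
    obtain N where N: "real N \<ge> max T1 T2" using real_arch_simple by blast
    have "\<bar>measure (\<kappa> t x) A - h A\<bar> \<le> \<epsilon>" if t: "t \<ge> max T1 T2" and A: "A \<in> sets state_space" for t A
    proof -
      have *: "\<forall>\<^sub>F n in sequentially. measure (\<kappa> (real n) 1) A \<le> measure (\<kappa> t x) A + \<epsilon>"
        "\<forall>\<^sub>F n in sequentially. measure (\<kappa> t x) A - \<epsilon> \<le> measure (\<kappa> (real n) 1) A"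
        using T1(2)[of t _ A] T2[of _ t A] t A N
        by (auto simp: eventually_sequentially algebra_simps intro!: exI[of _ N])
      have "h A \<le> measure (\<kappa> t x) A + \<epsilon>" using h[OF A] *(1) by (intro tendsto_upperbound) auto
      moreover have "measure (\<kappa> t x) A - \<epsilon> \<le> h A" using h[OF A] *(2) by (intro tendsto_lowerbound) auto
      ultimately show ?thesis by linarith
    qed
    then show ?thesis using T1(1) by (intro exI[of _ "max T1 T2"]) auto
  qed
  have pr: "prob_space (\<kappa> (real n) 1)" and st: "sets (\<kappa> (real n) 1) = sets state_space" for n
    using prob_space_kernel sets_kernel by auto
  have h_nonneg: "0 \<le> h A" if "A \<in> sets state_space" for A
    using h[OF that] by (rule LIMSEQ_le_const) auto
  have h_empty: "h {} = 0" using h[of "{}"] by (simp add: LIMSEQ_const_iff)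
  have sp: "space state_space = {0<..}" by (simp add: space_restrict_space)
  have h_space: "h {0<..} = 1"
  proof -
    have "measure (\<kappa> (real n) 1) {0<..} = 1" for n
      using prob_space.prob_space[OF pr[of n]] sets_eq_imp_space_eq[OF st[of n]] sp by simp
    moreover have "{0<..} \<in> sets state_space" using sets.top[of state_space] unfolding sp .
    ultimately show ?thesis using h[of "{0<..}"] by (simp add: LIMSEQ_const_iff)
  qed
  have h_add: "h (A \<union> B) = h A + h B" if "A \<in> sets state_space" "B \<in> sets state_space" "A \<inter> B = {}" for A B
  proof -
    have "measure (\<kappa> (real n) 1) (A \<union> B) = measure (\<kappa> (real n) 1) A + measure (\<kappa> (real n) 1) B" for n
    proof -
      interpret prob_space "\<kappa> (real n) 1" by (rule pr)
      show ?thesis using that st by (intro finite_measure_Union) auto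
    qed
    then have "(\<lambda>n. measure (\<kappa> (real n) 1) (A \<union> B)) \<longlonglongrightarrow> h A + h B"
      using tendsto_add[OF h[OF that(1)] h[OF that(2)]] by simp
    then show ?thesis using h[of "A \<union> B"] that by (auto intro: LIMSEQ_unique)
  qed
  define \<eta> where "\<eta> = measure_of {0<..} (sets state_space) (\<lambda>A. ennreal (h A))"
  interpret S: sigma_algebra "{0<..}" "sets state_space"
    using sets.sigma_algebra_axioms[of state_space] unfolding sp .
  have ca: "countably_additive (sets state_space) (\<lambda>A. ennreal (h A))"
  proof (rule S.empty_continuous_imp_countably_additive)
    show "positive (sets state_space) (\<lambda>A. ennreal (h A))" by (simp add: positive_def h_empty)
    show "additive (sets state_space) (\<lambda>A. ennreal (h A))"
      by (auto simp: additive_def h_add h_nonneg)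
    show "\<forall>A\<in>sets state_space. ennreal (h A) \<noteq> \<infinity>" by simp
    fix A :: "nat \<Rightarrow> real set" assume A: "range A \<subseteq> sets state_space" "decseq A" "\<Inter> (range A) = {}"
    have "(\<lambda>i. h (A i)) \<longlonglongrightarrow> 0"
    proof (rule LIMSEQ_I)
      fix e :: real assume "0 < e"
      obtain T where T: "T \<ge> 0" "\<And>t A. \<lbrakk>t \<ge> T; A\<in>sets state_space\<rbrakk> \<Longrightarrow> \<bar>measure (\<kappa> t 1) A - h A\<bar> \<le> e / 3"
        using unif[of 1 "e / 3"] \<open>0 < e\<close> by auto
      interpret prob_space "\<kappa> T 1" using prob_space_kernel T by simp
      have "(\<lambda>i. measure (\<kappa> T 1) (A i)) \<longlonglongrightarrow> measure (\<kappa> T 1) (\<Inter> (range A))"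
        using A sets_kernel[OF T(1), of 1] by (intro finite_Lim_measure_decseq) auto
      then have "(\<lambda>i. measure (\<kappa> T 1) (A i)) \<longlonglongrightarrow> 0" using A by simp
      then have "\<forall>\<^sub>F i in sequentially. measure (\<kappa> T 1) (A i) < e / 3"
        using \<open>0 < e\<close> by (intro order_tendstoD) auto
      then obtain N where N: "\<And>i. i \<ge> N \<Longrightarrow> measure (\<kappa> T 1) (A i) < e / 3" by (auto simp: eventually_sequentially)
      show "\<exists>no. \<forall>n\<ge>no. norm (h (A n) - 0) < e"
      proof (intro exI allI impI)
        fix n assume "n \<ge> N"
        have An: "A n \<in> sets state_space" using A(1) by auto
        have "\<bar>measure (\<kappa> T 1) (A n) - h (A n)\<bar> \<le> e / 3" by (rule T(2)[OF order_refl An])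
        then have "h (A n) \<le> measure (\<kappa> T 1) (A n) + e / 3" unfolding abs_le_iff by linarith
        then show "norm (h (A n) - 0) < e"
          using N[OF \<open>n \<ge> N\<close>] h_nonneg[OF An] \<open>0 < e\<close> by simp
      qed
    qed
    then show "(\<lambda>i. ennreal (h (A i))) \<longlonglongrightarrow> 0" using tendsto_ennrealI by fastforce
  qed
  have sets_eta: "sets \<eta> = sets state_space" unfolding \<eta>_def
    using S.sets_measure_of_eq by simp
  have space_eta: "space \<eta> = {0<..}" using sets_eq_imp_space_eq[OF sets_eta] sp by simp
  have em: "emeasure \<eta> A = ennreal (h A)" if "A \<in> sets state_space" for A
    unfolding \<eta>_def
    by (rule emeasure_measure_of_sigma[OF S.sigma_algebra_axioms _ ca that]) (simp add: positive_def h_empty)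
  have m: "measure \<eta> A = h A" if "A \<in> sets state_space" for A
    using em[OF that] h_nonneg[OF that] by (simp add: measure_def)
  have "prob_space \<eta>"
    by (rule prob_spaceI) (use em[of "{0<..}"] S.top h_space space_eta in simp)
  then show ?thesis using sets_eta unif m by (intro exI[of _ \<eta>]) simp
qed

end

lemma tv_norm_tendsto_0:
  fixes m :: "real \<Rightarrow> 'b set \<Rightarrow> real"
  assumes m0: "\<And>t. m t {} = 0"
    and unif: "\<And>\<epsilon>. \<epsilon> > 0 \<Longrightarrow> \<exists>T\<ge>0. \<forall>t\<ge>T. \<forall>A\<in>sets S. \<bar>m t A\<bar> \<le> \<epsilon>"
  shows "((\<lambda>t. tv_norm S (m t)) \<longlongrightarrow> 0) at_top"
proof (rule tendstoI)
  fix e :: real assume "0 < e"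
  obtain T where T: "\<And>t A. t\<ge>T \<Longrightarrow> A\<in>sets S \<Longrightarrow> \<bar>m t A\<bar> \<le> e / 3"
    using unif[of "e / 3"] \<open>0 < e\<close> by auto
  have "dist (tv_norm S (m t)) 0 < e" if "t \<ge> T" for t
  proof -
    have ne: "sets S \<noteq> {}" by auto
    have b: "m t A \<le> e / 3" "- (e / 3) \<le> m t A" if "A \<in> sets S" for A
      using T[OF \<open>t \<ge> T\<close> that] by linarith+
    have "(SUP A\<in>sets S. m t A) \<le> e / 3" using b by (intro cSUP_least[OF ne])
    moreover have "- (e / 3) \<le> (INF A\<in>sets S. m t A)" using b by (intro cINF_greatest[OF ne])
    moreover have "0 \<le> (SUP A\<in>sets S. m t A)"
      using b m0[of t] by (intro cSUP_upper2[where x="{}"] bdd_aboveI[of _ "e/3"]) auto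
    moreover have "(INF A\<in>sets S. m t A) \<le> 0"
      using b m0[of t] by (intro cINF_lower2[where x="{}"] bdd_belowI[of _ "- (e/3)"]) auto
    ultimately show ?thesis using \<open>0 < e\<close> by (simp add: tv_norm_def dist_real_def)
  qed
  then show "\<forall>\<^sub>F t in at_top. dist (tv_norm S (m t)) 0 < e"
    by (auto simp: eventually_at_top_linorder)
qed

lemma ergodicI:
  assumes "tight_contracting_kernel (transition P X) \<gamma>"
  shows "ergodic P X"
proof -
  interpret tight_contracting_kernel "transition P X" \<gamma> by fact
  obtain \<eta> where \<eta>: "prob_space \<eta>" "sets \<eta> = sets state_space"
    "\<And>x \<epsilon>. \<lbrakk>x>0; \<epsilon>>0\<rbrakk> \<Longrightarrow> \<exists>T\<ge>0. \<forall>t\<ge>T. \<forall>A\<in>sets state_space. \<bar>measure (transition P X t x) A - measure \<eta> A\<bar> \<le> \<epsilon>"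
    using uniform_limit_measure by blast
  have "((\<lambda>t. tv_norm state_space (\<lambda>A. measure (transition P X t x) A - measure \<eta> A)) \<longlongrightarrow> 0) at_top"
    if "0 < x" for x
    by (rule tv_norm_tendsto_0) (use \<eta>(3)[OF that] in auto)
  then show ?thesis using \<eta>(1,2) unfolding ergodic_def limiting_distribution_def by blast
qed

section \<open>Random walks with negative drift\<close>

text \<open>The maximum over k at most n of the partial sums with k terms \<open>z i - c\<close>.
  Splitting off the first increment, not the last, exhibits the shifted sequence, which has the same
  law when the increments are i.i.d.\<close>

primrec walk_max :: "real \<Rightarrow> nat \<Rightarrow> (nat \<Rightarrow> real) \<Rightarrow> real" where
  "walk_max c 0 z = 0"
| "walk_max c (Suc n) z = max 0 (z 0 - c + walk_max c n (\<lambda>i. z (Suc i)))"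

lemma walk_max_nonneg: "0 \<le> walk_max c n z"
  by (cases n) auto

lemma walk_max_mono_Suc: "walk_max c n z \<le> walk_max c (Suc n) z"
proof (induction n arbitrary: z)
  case (Suc n)
  show ?case using Suc.IH[of "\<lambda>i. z (Suc i)"] by (subst (1 2) walk_max.simps(2)) linarith
qed simp

lemma sum_shift_Suc: "(\<Sum>i<Suc k. z i - c :: real) = z 0 - c + (\<Sum>i<k. z (Suc i) - c)"
  by (rule sum.lessThan_Suc_shift)

lemma sum_le_walk_max: "(\<Sum>i<n. z i - c) \<le> walk_max c n z"
proof (induction n arbitrary: z)
  case (Suc n)
  show ?case using Suc.IH[of "\<lambda>i. z (Suc i)"] by (simp only: sum_shift_Suc walk_max.simps)
qed simp

lemma walk_max_measurable[measurable]:
  assumes [measurable_cong]: "sets \<rho> = sets borel"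
  shows "walk_max c n \<in> borel_measurable (PiM UNIV (\<lambda>_::nat. \<rho>))"
proof (induction n)
  case (Suc n)
  have [measurable]: "(\<lambda>z i. z (Suc i)) \<in> PiM UNIV (\<lambda>_::nat. \<rho>) \<rightarrow>\<^sub>M PiM UNIV (\<lambda>_::nat. \<rho>)"
    by (intro measurable_PiM_single') (auto simp: space_PiM PiE_iff)
  note [measurable] = Suc.IH
  show ?case by simp
qed simp

section \<open>Random walks with i.i.d. real increments\<close>

locale real_sequence_space = sequence_space \<rho> for \<rho> :: "real measure" +
  assumes sets_rho[measurable_cong, simp]: "sets \<rho> = sets borel"
begin

lemma space_rho[simp]: "space \<rho> = UNIV" using sets_eq_imp_space_eq[OF sets_rho] by simp
lemma space_S[simp]: "space S = UNIV" by (auto simp: space_PiM PiE_UNIV_domain)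

lemma prob_rho_UNIV[simp]: "measure \<rho> UNIV = 1" using M.prob_space by simp

lemma integral_S_iter:
  fixes F :: "(nat \<Rightarrow> real) \<Rightarrow> real"
  assumes [measurable]: "F \<in> borel_measurable S"
  shows "(\<integral>z. F z \<partial>S) = (\<integral>x. F (case_nat (fst x) (snd x)) \<partial>(\<rho> \<Otimes>\<^sub>M S))"
    "integrable S F \<longleftrightarrow> integrable (\<rho> \<Otimes>\<^sub>M S) (\<lambda>x. F (case_nat (fst x) (snd x)))"
proof -
  show "(\<integral>z. F z \<partial>S) = (\<integral>x. F (case_nat (fst x) (snd x)) \<partial>(\<rho> \<Otimes>\<^sub>M S))"
    by (subst PiM_iter[symmetric], subst integral_distr) (auto simp: case_prod_beta)
  show "integrable S F \<longleftrightarrow> integrable (\<rho> \<Otimes>\<^sub>M S) (\<lambda>x. F (case_nat (fst x) (snd x)))"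
    by (subst PiM_iter[symmetric], subst integrable_distr_eq) (auto simp: case_prod_beta)
qed

lemma emeasure_S_iter:
  assumes [measurable]: "E \<in> sets S"
  shows "emeasure S E = (\<integral>\<^sup>+s. emeasure S {\<omega>. case_nat s \<omega> \<in> E} \<partial>\<rho>)"
proof -
  have "emeasure S E = emeasure (\<rho> \<Otimes>\<^sub>M S) {x. case_nat (fst x) (snd x) \<in> E}"
    by (subst PiM_iter[symmetric], subst emeasure_distr)
       (auto simp: case_prod_beta space_pair_measure intro!: arg_cong[where f="emeasure _"])
  also have "\<dots> = (\<integral>\<^sup>+s. emeasure S (Pair s -` {x. case_nat (fst x) (snd x) \<in> E}) \<partial>\<rho>)"
  proof (rule P.emeasure_pair_measure_alt)
    have "{x \<in> space (\<rho> \<Otimes>\<^sub>M S). case_nat (fst x) (snd x) \<in> E} \<in> sets (\<rho> \<Otimes>\<^sub>M S)" by measurable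
    then show "{x. case_nat (fst x) (snd x) \<in> E} \<in> sets (\<rho> \<Otimes>\<^sub>M S)" by (simp add: space_pair_measure)
  qed
  finally show ?thesis by (simp add: vimage_def)
qed

lemma integrable_pair:
  fixes f :: "real \<Rightarrow> real" and g :: "(nat \<Rightarrow> real) \<Rightarrow> real"
  shows integrable_pair_fst: "integrable \<rho> f \<Longrightarrow> integrable (\<rho> \<Otimes>\<^sub>M S) (\<lambda>x. f (fst x))"
    and integrable_pair_snd: "integrable S g \<Longrightarrow> integrable (\<rho> \<Otimes>\<^sub>M S) (\<lambda>x. g (snd x))"
proof -
  assume f: "integrable \<rho> f"
  have "integrable (distr (\<rho> \<Otimes>\<^sub>M S) \<rho> fst) f" using f by (simp add: distr_pair_fst)
  then show "integrable (\<rho> \<Otimes>\<^sub>M S) (\<lambda>x. f (fst x))" by (rule integrable_distr[rotated]) measurable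
next
  interpret rS: pair_prob_space \<rho> S ..
  assume g: "integrable S g"
  have "distr (\<rho> \<Otimes>\<^sub>M S) S snd = S"
    by (subst rS.distr_pair_swap)
       (simp add: distr_distr comp_def case_prod_beta M.distr_pair_fst)
  then have "integrable (distr (\<rho> \<Otimes>\<^sub>M S) S snd) g" using g by simp
  then show "integrable (\<rho> \<Otimes>\<^sub>M S) (\<lambda>x. g (snd x))" by (rule integrable_distr[rotated]) measurable
qed

lemma integrable_walk_max:
  assumes "integrable \<rho> (\<lambda>x. x)"
  shows "integrable S (walk_max c n)"
proof (induction n)
  case (Suc n)
  interpret rS: pair_prob_space \<rho> S ..
  have "integrable (\<rho> \<Otimes>\<^sub>M S) (\<lambda>x. fst x - c)" 
    using integrable_pair_fst[OF assms] rS.finite_measure_axioms by simp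
  moreover have "integrable (\<rho> \<Otimes>\<^sub>M S) (\<lambda>x. walk_max c n (snd x))"
    by (rule integrable_pair_snd[OF Suc.IH])
  ultimately show ?case by (subst integral_S_iter(2)) auto
qed simp

text \<open>The event that the walk is unbounded is invariant under the shift and hence independent of
  the first increment. Comparing the expected running maximum on this event at times \<open>n + 1\<close>
  and \<open>n\<close> shows that a walk with negative mean cannot be unbounded with positive probability.\<close>

lemma AE_walk_bounded:
  assumes int: "integrable \<rho> (\<lambda>x. x)" and mean: "(\<integral>x. x \<partial>\<rho>) < c"
  shows "AE z in S. \<exists>r. \<forall>k. (\<Sum>i<k. z i - c) \<le> r"
proof -
  define E :: "(nat \<Rightarrow> real) set" where "E = {z. \<forall>r::nat. \<exists>k. (\<Sum>i<k. z i - c) > real r}"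
  have "{z\<in>space S. \<forall>r::nat. \<exists>k. (\<Sum>i<k. z i - c) > real r} \<in> sets S" by measurable
  then have E[measurable]: "E \<in> sets S" by (simp add: E_def)
  have shift: "case_nat s \<omega> \<in> E \<longleftrightarrow> \<omega> \<in> E" for s \<omega>
  proof -
    let ?z = "case_nat s \<omega>"
    have step: "(\<Sum>i<Suc k. ?z i - c) = s - c + (\<Sum>i<k. \<omega> i - c)" for k
      by (subst sum_shift_Suc) simp
    show ?thesis
    proof
      assume *: "?z \<in> E"
      show "\<omega> \<in> E" unfolding E_def
      proof safe
        fix r :: nat
        obtain r' :: nat where r': "real r + \<bar>s - c\<bar> \<le> real r'" using real_arch_simple by blast
        obtain k where k: "(\<Sum>i<k. ?z i - c) > real r'" using * by (auto simp: E_def)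
        then obtain k' where "k = Suc k'" by (cases k) auto
        then show "\<exists>k. real r < (\<Sum>i<k. \<omega> i - c)" using k r' step[of k'] by (intro exI[of _ k']) auto
      qed
    next
      assume *: "\<omega> \<in> E"
      show "?z \<in> E" unfolding E_def
      proof safe
        fix r :: nat
        obtain r' :: nat where r': "real r + \<bar>s - c\<bar> \<le> real r'" using real_arch_simple by blast
        obtain k where k: "(\<Sum>i<k. \<omega> i - c) > real r'" using * by (auto simp: E_def)
        show "\<exists>k. real r < (\<Sum>i<k. ?z i - c)"
          by (rule exI[of _ "Suc k"], subst step) (use k r' in auto)
      qed
    qed
  qed
  let ?W = "walk_max c" and ?P = "\<rho> \<Otimes>\<^sub>M S"
  interpret rS: pair_prob_space \<rho> S ..
  have iW: "integrable S (\<lambda>z. indicator E z * ?W n z)" for n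
    using integrable_mult_indicator[OF E integrable_walk_max[OF int, of c n]] by simp
  have i1: "integrable ?P (\<lambda>x. fst x - c)" using integrable_pair_fst[OF int] by simp
  have D_le: "\<bar>indicator E z * max (- ?W n z) u\<bar> \<le> \<bar>u\<bar>" for n z u
    using walk_max_nonneg[of c n z] by (auto simp: max_def split: split_indicator)
  have iD: "integrable ?P (\<lambda>x. indicator E (snd x) * max (- ?W n (snd x)) (fst x - c))" for n
  proof (rule Bochner_Integration.integrable_bound[OF i1])
    show "AE x in ?P. norm (indicator E (snd x) * max (- ?W n (snd x)) (fst x - c)) \<le> norm (fst x - c)"
      using D_le by simp
  qed measurable
  \<comment> \<open>Prefixing an increment s changes the running maximum W by
    \<open>max (- W) (s - c)\<close>. On \<open>E\<close> the expected running maximum at time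
    \<open>n + 1\<close> is at least that at time n, so the expectation of this change is
    nonnegative.\<close>
  have nonneg: "0 \<le> (\<integral>x. indicator E (snd x) * max (- ?W n (snd x)) (fst x - c) \<partial>?P)" for n
  proof -
    have "(\<integral>z. indicator E z * ?W n z \<partial>S) \<le> (\<integral>z. indicator E z * ?W (Suc n) z \<partial>S)"
      by (intro integral_mono iW mult_left_mono walk_max_mono_Suc) auto
    also have "\<dots> = (\<integral>x. indicator E (snd x) * max 0 (fst x - c + ?W n (snd x)) \<partial>?P)"
    proof (subst integral_S_iter)
      show "(\<lambda>z. indicator E z * ?W (Suc n) z) \<in> borel_measurable S"
        by (intro borel_measurable_times borel_measurable_indicator E walk_max_measurable sets_rho)
    qed (simp add: indicator_def shift)
    also have "\<dots> = (\<integral>x. indicator E (snd x) * ?W n (snd x)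
        + indicator E (snd x) * max (- ?W n (snd x)) (fst x - c) \<partial>?P)"
      by (intro Bochner_Integration.integral_cong) (auto split: split_indicator)
    also have "\<dots> = (\<integral>x. indicator E (snd x) * ?W n (snd x) \<partial>?P)
        + (\<integral>x. indicator E (snd x) * max (- ?W n (snd x)) (fst x - c) \<partial>?P)"
      by (intro Bochner_Integration.integral_add integrable_pair_snd[OF iW] iD)
    also have "(\<integral>x. indicator E (snd x) * ?W n (snd x) \<partial>?P) = (\<integral>z. indicator E z * ?W n z \<partial>S)"
      by (subst rS.integral_fst'[symmetric]) (auto intro!: integrable_pair_snd[OF iW] simp: M.prob_space)
    finally show ?thesis by simp
  qed
  \<comment> \<open>On \<open>E\<close> the running maximum tends to infinity, so
    \<open>max (- W) (s - c)\<close> is eventually \<open>s - c\<close>; it is dominated by the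
    integrable \<open>\<bar>s - c\<bar>\<close>.\<close>
  have lim: "(\<lambda>n. \<integral>x. indicator E (snd x) * max (- ?W n (snd x)) (fst x - c) \<partial>?P)
      \<longlonglongrightarrow> (\<integral>x. indicator E (snd x) * (fst x - c) \<partial>?P)"
  proof (rule integral_dominated_convergence[where w="\<lambda>x. \<bar>fst x - c\<bar>"])
    show "integrable ?P (\<lambda>x. \<bar>fst x - c\<bar>)" using i1 by simp
    show "AE x in ?P. norm (indicator E (snd x) * max (- ?W n (snd x)) (fst x - c)) \<le> \<bar>fst x - c\<bar>" for n
      using D_le by simp
    have "(\<lambda>n. indicator E z * max (- ?W n z) (s - c)) \<longlonglongrightarrow> indicator E z * (s - c)" for s z
    proof (cases "z \<in> E")
      case True
      obtain r :: nat where r: "\<bar>s - c\<bar> \<le> real r" using real_arch_simple by blast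
      obtain k where k: "(\<Sum>i<k. z i - c) > real r" using True by (auto simp: E_def)
      have "?W n z > real r" if "n \<ge> k" for n
        using k sum_le_walk_max[of z c k] lift_Suc_mono_le[of "\<lambda>n. ?W n z" k n, OF walk_max_mono_Suc that]
        by linarith
      then have "\<forall>\<^sub>F n in sequentially. indicator E z * max (- ?W n z) (s - c) = indicator E z * (s - c)"
      proof (intro eventually_sequentiallyI[of k])
        fix n assume "k \<le> n"
        then have "max (- ?W n z) (s - c) = s - c" using \<open>\<And>n. n \<ge> k \<Longrightarrow> ?W n z > real r\<close>[of n] r by linarith
        then show "indicator E z * max (- ?W n z) (s - c) = indicator E z * (s - c)" by simp
      qed
      then show ?thesis by (rule tendsto_eventually)
    qed simp
    then show "AE x in ?P. (\<lambda>n. indicator E (snd x) * max (- ?W n (snd x)) (fst x - c))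
        \<longlonglongrightarrow> indicator E (snd x) * (fst x - c)" by simp
  qed measurable
  \<comment> \<open>Independence of the first increment from the shift-invariant event factorises
    the limit. Its second factor is negative and the limit is nonnegative, so \<open>E\<close> has
    probability zero.\<close>
  have "(\<integral>x. indicator E (snd x) * (fst x - c) \<partial>?P) = measure S E * ((\<integral>x. x \<partial>\<rho>) - c)"
  proof -
    have "integrable ?P (\<lambda>x. indicator E (snd x) * (fst x - c))"
      by (rule Bochner_Integration.integrable_bound[OF i1]) (auto split: split_indicator)
    then have "(\<integral>x. indicator E (snd x) * (fst x - c) \<partial>?P) = (\<integral>s. \<integral>z. indicator E z * (s - c) \<partial>S \<partial>\<rho>)"
      by (subst rS.integral_fst'[symmetric]) simp_all
    also have "\<dots> = (\<integral>s. measure S E * (s - c) \<partial>\<rho>)" by simp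
    also have "\<dots> = measure S E * ((\<integral>x. x \<partial>\<rho>) - c)"
      using int M.prob_space by simp
    finally show ?thesis .
  qed
  moreover have "0 \<le> (\<integral>x. indicator E (snd x) * (fst x - c) \<partial>?P)"
    using nonneg by (intro LIMSEQ_le_const[OF lim]) auto
  ultimately have "measure S E = 0" using mean measure_nonneg[of S E]
    by (simp add: zero_le_mult_iff)
  then have "E \<in> null_sets S" by (intro null_setsI E) (simp add: P.emeasure_eq_measure)
  then have "AE z in S. z \<notin> E" by (rule AE_not_in)
  then show ?thesis
    by eventually_elim (auto simp: E_def not_less)
qed

lemma walk_bounded_prob:
  assumes int: "integrable \<rho> (\<lambda>x. x)" and mean: "(\<integral>x. x \<partial>\<rho>) < c" and "0 < \<epsilon>"
  shows "\<exists>r>0. measure S {z. \<not> (\<forall>k. (\<Sum>i<k. z i - c) \<le> r)} \<le> \<epsilon>"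
proof -
  define A :: "nat \<Rightarrow> (nat \<Rightarrow> real) set" where "A n = {z. \<not> (\<forall>k. (\<Sum>i<k. z i - c) \<le> real n)}" for n
  have "{z\<in>space S. \<not> (\<forall>k. (\<Sum>i<k. z i - c) \<le> real n)} \<in> sets S" for n by measurable
  then have A[measurable]: "A n \<in> sets S" for n by (simp add: A_def)
  have "(\<lambda>n. measure S (A n)) \<longlonglongrightarrow> measure S (\<Inter>n. A n)"
  proof (rule P.finite_Lim_measure_decseq)
    show "decseq A" unfolding decseq_def A_def
      by (auto intro: order_trans of_nat_mono)
  qed auto
  moreover have "measure S (\<Inter>n. A n) = 0"
  proof -
    have "AE z in S. z \<notin> (\<Inter>n. A n)"
      using AE_walk_bounded[OF int mean]
    proof eventually_elim
      case (elim z)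
      then obtain r where r: "\<forall>k. (\<Sum>i<k. z i - c) \<le> r" by blast
      obtain n where "r \<le> real n" using real_arch_simple by blast
      then show ?case using r by (auto simp: A_def intro!: exI[of _ n] intro: order_trans)
    qed
    then have "(\<Inter>n. A n) \<in> null_sets S" by (subst AE_iff_null_sets) auto
    then show ?thesis by (simp add: measure_eq_0_null_sets)
  qed
  ultimately have "\<forall>\<^sub>F n in sequentially. measure S (A n) < \<epsilon>"
    using \<open>0 < \<epsilon>\<close> by (intro order_tendstoD) auto
  then obtain n where n: "\<And>m. m \<ge> n \<Longrightarrow> measure S (A m) < \<epsilon>" by (auto simp: eventually_sequentially)
  show ?thesis using n[of "Suc n"] by (intro exI[of _ "real (Suc n)"]) (auto simp: A_def)
qed

end

text \<open>The recursion \<open>y \<mapsto> max (y - c) K + z\<close> with the increments in reversed order (\<open>z 0\<close> enters last).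
  For i.i.d. increments the law is the same, but now the partial sums of a single walk bound all
  iterates.\<close>

primrec lindley :: "real \<Rightarrow> real \<Rightarrow> nat \<Rightarrow> real \<Rightarrow> (nat \<Rightarrow> real) \<Rightarrow> real" where
  "lindley c K 0 x z = x"
| "lindley c K (Suc n) x z = max (lindley c K n x (\<lambda>i. z (Suc i)) - c) K + z 0"

lemma lindley_measurable[measurable]:
  assumes [measurable_cong]: "sets \<rho> = sets borel"
  shows "lindley c K n x \<in> borel_measurable (PiM UNIV (\<lambda>_::nat. \<rho>))"
proof (induction n)
  case (Suc n)
  have [measurable]: "(\<lambda>z i. z (Suc i)) \<in> PiM UNIV (\<lambda>_::nat. \<rho>) \<rightarrow>\<^sub>M PiM UNIV (\<lambda>_::nat. \<rho>)"
    by (intro measurable_PiM_single') (auto simp: space_PiM PiE_iff)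
  note [measurable] = Suc.IH
  show ?case by simp
qed simp

text \<open>Either the floor \<open>K\<close> never acted, and the iterate is x plus the whole sum,
  or it last acted when \<open>z k\<close> entered. In that case the value is K plus
  \<open>z k\<close> plus the sum of the \<open>z i - c\<close> with \<open>i < k\<close>, that is,
  \<open>K + c\<close> plus a partial sum with \<open>Suc k\<close> terms. The extra c is the one
  not subtracted at the floor.\<close>

lemma lindley_le:
  assumes "\<And>k. k \<le> n \<Longrightarrow> (\<Sum>i<k. z i - c) \<le> r"
  shows "lindley c K n x z \<le> max (x + (\<Sum>i<n. z i - c)) (K + c + r)"
  using assms
proof (induction n arbitrary: z r)
  case (Suc n)
  let ?z = "\<lambda>i. z (Suc i)"
  have "lindley c K n x ?z \<le> max (x + (\<Sum>i<n. ?z i - c)) (K + c + (r - (z 0 - c)))"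
  proof (rule Suc.IH)
    fix k assume "k \<le> n"
    then show "(\<Sum>i<k. ?z i - c) \<le> r - (z 0 - c)" using Suc.prems[of "Suc k"] sum_shift_Suc[of z c k] by simp
  qed
  moreover have "z 0 - c \<le> r" using Suc.prems[of 1] by simp
  ultimately show ?case unfolding sum_shift_Suc lindley.simps by linarith
qed simp

text \<open>Stochastic domination is passed on step by step. By Fubini the last increment z can be
  fixed first; the event in the current state is then a ray with a shifted threshold. The induction
  therefore needs the bound for all \<open>r\<close> at once.\<close>

lemma (in markov_kernel) tail_le_lindley:
  assumes \<rho>: "real_sequence_space \<rho>"
    and step: "\<And>y r. 0 < y \<Longrightarrow> emeasure (\<kappa> 1 y) {max r 0<..} \<le> emeasure \<rho> {z. r < max (y - c) K + z}"
    and "0 < x"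
  shows "emeasure (\<kappa> (real n) x) {max r 0<..}
    \<le> emeasure (PiM UNIV (\<lambda>_::nat. \<rho>)) {z. r < lindley c K n x z}"
proof (induction n arbitrary: r)
  case 0
  interpret real_sequence_space \<rho> by fact
  have "{max r 0<..} \<in> sets state_space"
    by (auto simp: sets_restrict_space intro!: image_eqI[of _ _ "{max r 0<..}"])
  then show ?case using kernel_0[OF \<open>0 < x\<close>] P.emeasure_space_1
    by (auto simp: indicator_def)
next
  case (Suc n)
  interpret real_sequence_space \<rho> by fact
  interpret prob_space "\<kappa> (real n) x" using \<open>0 < x\<close> by (intro prob_space_kernel) auto
  have sets_n: "sets (\<kappa> (real n) x) = sets state_space" using \<open>0 < x\<close> by (intro sets_kernel) auto
  have space_n: "space (\<kappa> (real n) x) = {0<..}"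
    using sets_eq_imp_space_eq[OF sets_n] by (simp add: space_restrict_space)
  have ray: "{max r 0<..} \<in> sets state_space" for r :: real
    by (auto simp: sets_restrict_space intro!: image_eqI[of _ _ "{max r 0<..}"])
  have id[measurable]: "(\<lambda>x. x) \<in> borel_measurable (\<kappa> (real n) x)"
    unfolding measurable_cong_sets[OF sets_n refl] by (rule measurable_restrict_space1) simp
  interpret nr: pair_sigma_finite "\<kappa> (real n) x" \<rho> ..
  have "emeasure (\<kappa> (real (Suc n)) x) {max r 0<..} = (\<integral>\<^sup>+y. emeasure (\<kappa> 1 y) {max r 0<..} \<partial>\<kappa> (real n) x)"
    using emeasure_chapman_kolmogorov[of "real n" 1 x, OF _ _ \<open>0 < x\<close> ray] by (simp add: add.commute)
  also have "\<dots> \<le> (\<integral>\<^sup>+y. emeasure \<rho> {z. r < max (y - c) K + z} \<partial>\<kappa> (real n) x)"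
    using space_n by (intro nn_integral_mono step) auto
  also have "\<dots> = (\<integral>\<^sup>+y. \<integral>\<^sup>+z. indicator {v\<in>space (\<kappa> (real n) x \<Otimes>\<^sub>M \<rho>). r < max (fst v - c) K + snd v} (y, z) \<partial>\<rho> \<partial>\<kappa> (real n) x)"
  proof (rule nn_integral_cong)
    fix y assume "y \<in> space (\<kappa> (real n) x)"
    then have "(\<integral>\<^sup>+z. indicator {v\<in>space (\<kappa> (real n) x \<Otimes>\<^sub>M \<rho>). r < max (fst v - c) K + snd v} (y, z) \<partial>\<rho>)
      = (\<integral>\<^sup>+z. indicator {z. r < max (y - c) K + z} z \<partial>\<rho>)"
      by (intro nn_integral_cong) (auto simp: space_pair_measure split: split_indicator)
    then show "emeasure \<rho> {z. r < max (y - c) K + z}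
      = (\<integral>\<^sup>+z. indicator {v\<in>space (\<kappa> (real n) x \<Otimes>\<^sub>M \<rho>). r < max (fst v - c) K + snd v} (y, z) \<partial>\<rho>)"
      by simp
  qed
  also have "\<dots> = (\<integral>\<^sup>+z. \<integral>\<^sup>+y. indicator {v\<in>space (\<kappa> (real n) x \<Otimes>\<^sub>M \<rho>). r < max (fst v - c) K + snd v} (y, z) \<partial>\<kappa> (real n) x \<partial>\<rho>)"
    by (rule nr.Fubini'[symmetric]) measurable
  also have "\<dots> \<le> (\<integral>\<^sup>+z. emeasure S {\<omega>. case_nat z \<omega> \<in> {z. r < lindley c K (Suc n) x z}} \<partial>\<rho>)"
  proof (rule nn_integral_mono)
    fix z
    let ?A = "{y\<in>space (\<kappa> (real n) x). r < max (y - c) K + z}"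
    have "(\<integral>\<^sup>+y. indicator {v\<in>space (\<kappa> (real n) x \<Otimes>\<^sub>M \<rho>). r < max (fst v - c) K + snd v} (y, z) \<partial>\<kappa> (real n) x)
      = (\<integral>\<^sup>+y. indicator ?A y \<partial>\<kappa> (real n) x)"
      by (intro nn_integral_cong) (auto simp: space_pair_measure split: split_indicator)
    also have "\<dots> = emeasure (\<kappa> (real n) x) ?A" by simp
    also have "\<dots> \<le> emeasure S {\<omega>. r < max (lindley c K n x \<omega> - c) K + z}"
    \<comment> \<open>If the floor alone exceeds \<open>r\<close>, the event is certain on both
      sides; otherwise the floor is irrelevant and the event is the ray above
      \<open>r + c - z\<close>.\<close>
    proof (cases "r < K + z")
      case True
      then have "{\<omega>. r < max (lindley c K n x \<omega> - c) K + z} = space S" by auto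
      then show ?thesis using emeasure_le_1 P.emeasure_space_1 by simp
    next
      case False
      then have "?A = {max (r + c - z) 0<..}" unfolding space_n by auto
      moreover have "{\<omega>. r < max (lindley c K n x \<omega> - c) K + z} = {\<omega>. r + c - z < lindley c K n x \<omega>}"
        using False by auto
      ultimately show ?thesis using Suc.IH[of "r + c - z"] by simp
    qed
    finally show "(\<integral>\<^sup>+y. indicator {v\<in>space (\<kappa> (real n) x \<Otimes>\<^sub>M \<rho>). r < max (fst v - c) K + snd v} (y, z) \<partial>\<kappa> (real n) x)
      \<le> emeasure S {\<omega>. case_nat z \<omega> \<in> {z. r < lindley c K (Suc n) x z}}" by simp
  qed
  also have "\<dots> = emeasure S {z. r < lindley c K (Suc n) x z}"
  proof (rule emeasure_S_iter[symmetric])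
    have "{z\<in>space S. r < lindley c K (Suc n) x z} \<in> sets S" by measurable
    then show "{z. r < lindley c K (Suc n) x z} \<in> sets S" by simp
  qed
  finally show ?case .
qed

text \<open>The surplus of c over the mean is divided: with \<open>c - \<delta>\<close> subtracted
  per step the walk still has negative drift and is bounded by some r with high probability, while
  the remaining \<open>\<delta>\<close> per step wears down the starting point x. Thus r depends
  neither on n nor on x.\<close>

lemma (in markov_kernel) uniformly_tight:
  assumes \<rho>: "real_sequence_space \<rho>"
    and step: "\<And>y r. 0 < y \<Longrightarrow> emeasure (\<kappa> 1 y) {max r 0<..} \<le> emeasure \<rho> {z. r < max (y - c) K + z}"
    and int: "integrable \<rho> (\<lambda>x. x)" and mean: "(\<integral>x. x \<partial>\<rho>) < c - \<delta>" and "0 < \<delta>" and "0 < \<epsilon>" "0 < K + c"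
  shows "\<exists>r>0. \<forall>n. \<forall>x>0. measure (\<kappa> (real n) x) {max (x - real n * \<delta>) (K + c) + r<..} \<le> \<epsilon>"
proof -
  interpret real_sequence_space \<rho> by fact
  obtain r where r: "r > 0" "measure S {z. \<not> (\<forall>k. (\<Sum>i<k. z i - (c - \<delta>)) \<le> r)} \<le> \<epsilon>"
    using walk_bounded_prob[OF int mean \<open>0 < \<epsilon>\<close>] by blast
  have "measure (\<kappa> (real n) x) {max (x - real n * \<delta>) (K + c) + r<..} \<le> \<epsilon>" if "0 < x" for n x
  proof -
    interpret k: prob_space "\<kappa> (real n) x" using \<open>0 < x\<close> by (intro prob_space_kernel) auto
    let ?b = "max (x - real n * \<delta>) (K + c) + r"
    have "emeasure (\<kappa> (real n) x) {max ?b 0<..} \<le> emeasure S {z. ?b < lindley c K n x z}"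
      by (rule tail_le_lindley[OF \<rho> step that])
    also have "\<dots> \<le> emeasure S {z. \<not> (\<forall>k. (\<Sum>i<k. z i - (c - \<delta>)) \<le> r)}"
    proof (rule emeasure_mono)
      have "{z\<in>space S. \<not> (\<forall>k. (\<Sum>i<k. z i - (c - \<delta>)) \<le> r)} \<in> sets S" by measurable
      then show "{z. \<not> (\<forall>k. (\<Sum>i<k. z i - (c - \<delta>)) \<le> r)} \<in> sets S" by simp
      show "{z. ?b < lindley c K n x z} \<subseteq> {z. \<not> (\<forall>k. (\<Sum>i<k. z i - (c - \<delta>)) \<le> r)}"
      proof safe
        fix z assume *: "?b < lindley c K n x z" and le: "\<forall>k. (\<Sum>i<k. z i - (c - \<delta>)) \<le> r"
        have sum: "(\<Sum>i<k. z i - c) = (\<Sum>i<k. z i - (c - \<delta>)) - real k * \<delta>" for k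
          by (simp add: sum_subtractf algebra_simps sum.distrib)
        have "(\<Sum>i<k. z i - c) \<le> r" for k
          using le[rule_format, of k] sum[of k] \<open>0 < \<delta>\<close> by (smt (verit) mult_nonneg_nonneg of_nat_0_le_iff)
        then have "lindley c K n x z \<le> max (x + (\<Sum>i<n. z i - c)) (K + c + r)" by (rule lindley_le)
        moreover have "(\<Sum>i<n. z i - c) \<le> r - real n * \<delta>" using le[rule_format, of n] sum[of n] by simp
        ultimately show False using * by linarith
      qed
    qed
    also have "\<dots> \<le> ennreal \<epsilon>" using r(2) unfolding P.emeasure_eq_measure by (rule ennreal_leI)
    finally have "ennreal (measure (\<kappa> (real n) x) {max ?b 0<..}) \<le> ennreal \<epsilon>"
      by (simp add: k.emeasure_eq_measure)
    then have "measure (\<kappa> (real n) x) {max ?b 0<..} \<le> \<epsilon>" using \<open>0 < \<epsilon>\<close> by simp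
    moreover have "max ?b 0 = ?b" using r(1) \<open>0 < K + c\<close> by auto
    ultimately show ?thesis by simp
  qed
  then show ?thesis using r(1) by blast
qed

section \<open>Continuity of translation in L1\<close>

text \<open>A set and its translate have equal measure, so the L1 distance is twice the integral of
  the positive part of the indicator minus its translate. This part is supported in
  \<open>U\<close>, hence dominated, and vanishes eventually at each point because \<open>U\<close>
  is open.\<close>

lemma tendsto_translation_L1_open:
  fixes U :: "real set"
  assumes "open U" and fin: "emeasure lborel U < \<infinity>" and d: "d \<longlonglongrightarrow> 0"
  shows "(\<lambda>n. \<integral>x. \<bar>indicat_real U (x - d n) - indicator U x\<bar> \<partial>lborel) \<longlonglongrightarrow> 0"
proof -
  have [measurable]: "U \<in> sets borel" using assms by auto
  have i: "integrable lborel (indicat_real U)" using fin by simp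
  have it: "integrable lborel (\<lambda>x. indicat_real U (x - d n))" for n
    using lborel_integrable_real_affine[OF i, of 1 "- d n"] by simp
  have same: "(\<integral>x. indicat_real U (x - d n) \<partial>lborel) = (\<integral>x. indicator U x \<partial>lborel)" for n
    using lborel_integral_real_affine[of 1 "indicat_real U" "- d n"] by simp
  have eq: "(\<integral>x. \<bar>indicat_real U (x - d n) - indicator U x\<bar> \<partial>lborel)
      = 2 * (\<integral>x. max 0 (indicator U x - indicat_real U (x - d n)) \<partial>lborel)" for n
  proof -
    have "(\<integral>x. \<bar>indicat_real U (x - d n) - indicator U x\<bar> \<partial>lborel)
      = (\<integral>x. 2 * max 0 (indicator U x - indicat_real U (x - d n)) + (indicat_real U (x - d n) - indicator U x) \<partial>lborel)"
      by (intro Bochner_Integration.integral_cong) (auto simp: max_def)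
    also have "\<dots> = 2 * (\<integral>x. max 0 (indicator U x - indicat_real U (x - d n)) \<partial>lborel)
        + ((\<integral>x. indicat_real U (x - d n) \<partial>lborel) - (\<integral>x. indicator U x \<partial>lborel))"
      using i it by (subst Bochner_Integration.integral_add) auto
    finally show ?thesis using same by simp
  qed
  have "(\<lambda>n. \<integral>x. max 0 (indicator U x - indicat_real U (x - d n)) \<partial>lborel) \<longlonglongrightarrow> (\<integral>x. 0 \<partial>(lborel :: real measure))"
  proof (rule integral_dominated_convergence[where w="indicat_real U"])
    show "AE x in lborel. (\<lambda>n. max 0 (indicat_real U x - indicat_real U (x - d n))) \<longlonglongrightarrow> 0"
    proof (intro AE_I2)
      fix x :: real
      show "(\<lambda>n. max 0 (indicat_real U x - indicat_real U (x - d n))) \<longlonglongrightarrow> 0"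
      proof (cases "x \<in> U")
        case True
        have "(\<lambda>n. x - d n) \<longlonglongrightarrow> x" using tendsto_diff[OF tendsto_const d, of x] by simp
        then have "\<forall>\<^sub>F n in sequentially. x - d n \<in> U" using \<open>open U\<close> True by (rule topological_tendstoD)
        then have "\<forall>\<^sub>F n in sequentially. max 0 (indicat_real U x - indicat_real U (x - d n)) = 0"
          by eventually_elim (simp add: True)
        then show ?thesis by (rule tendsto_eventually)
      next
        case False
        then have "max 0 (indicat_real U x - indicat_real U (x - d n)) = 0" for n by (simp add: indicator_def)
        then show ?thesis by simp
      qed
    qed
    show "AE x in lborel. norm (max 0 (indicat_real U x - indicat_real U (x - d n))) \<le> indicat_real U x" for n
      by (intro AE_I2) (auto simp: indicator_def)
  qed (use i in auto)
  then show ?thesis unfolding eq using tendsto_mult_left[of _ 0 sequentially 2] by force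
qed

text \<open>Integrable functions are built up from indicators by sums and limits. The auxiliary fact
  \<open>approx\<close> closes the class under L1 approximation; it serves both for indicators,
  approximated from outside by open sets of finite measure, and for limits.\<close>

lemma tendsto_translation_L1:
  fixes g :: "real \<Rightarrow> real"
  assumes "integrable lborel g" and "d \<longlonglongrightarrow> 0"
  shows "(\<lambda>n. \<integral>x. \<bar>g (x - d n) - g x\<bar> \<partial>lborel) \<longlonglongrightarrow> 0"
  using assms(1)
proof induction
  have approx: "(\<lambda>n. \<integral>x. \<bar>g (x - d n) - g x\<bar> \<partial>lborel) \<longlonglongrightarrow> 0"
    if g: "integrable lborel g" and ex: "\<And>e. e > 0 \<Longrightarrow> \<exists>f. integrable lborel f \<and>
      (\<lambda>n. \<integral>x. \<bar>f (x - d n) - f x\<bar> \<partial>lborel) \<longlonglongrightarrow> 0 \<and> (\<integral>x. \<bar>f x - g x\<bar> \<partial>lborel) < e"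
    for g :: "real \<Rightarrow> real"
  proof (rule LIMSEQ_I)
    fix e :: real assume "0 < e"
    then obtain f where f: "integrable lborel f" "(\<lambda>n. \<integral>x. \<bar>f (x - d n) - f x\<bar> \<partial>lborel) \<longlonglongrightarrow> 0"
        "(\<integral>x. \<bar>f x - g x\<bar> \<partial>lborel) < e / 3"
      using ex[of "e / 3"] by auto
    have shift: "integrable lborel (\<lambda>x. k (x - d n))" if "integrable lborel k" for k :: "real \<Rightarrow> real" and n
      using lborel_integrable_real_affine[OF that, of 1 "- d n"] by simp
    have ifg: "integrable lborel (\<lambda>x. \<bar>f x - g x\<bar>)" using f g by auto
    have le: "(\<integral>x. \<bar>g (x - d n) - g x\<bar> \<partial>lborel)
        \<le> (\<integral>x. \<bar>f (x - d n) - f x\<bar> \<partial>lborel) + 2 * (\<integral>x. \<bar>f x - g x\<bar> \<partial>lborel)" for n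
    proof -
      have "(\<integral>x. \<bar>g (x - d n) - g x\<bar> \<partial>lborel)
        \<le> (\<integral>x. \<bar>f (x - d n) - f x\<bar> + (\<bar>f (x - d n) - g (x - d n)\<bar> + \<bar>f x - g x\<bar>) \<partial>lborel)"
        using shift[OF f(1)] shift[OF g] shift[OF ifg] f g by (intro integral_mono) auto
      also have "\<dots> = (\<integral>x. \<bar>f (x - d n) - f x\<bar> \<partial>lborel)
          + ((\<integral>x. \<bar>f (x - d n) - g (x - d n)\<bar> \<partial>lborel) + (\<integral>x. \<bar>f x - g x\<bar> \<partial>lborel))"
        using shift[OF f(1)] f ifg shift[OF ifg]
        by (subst Bochner_Integration.integral_add, simp, simp, subst Bochner_Integration.integral_add) simp_all
      also have "(\<integral>x. \<bar>f (x - d n) - g (x - d n)\<bar> \<partial>lborel) = (\<integral>x. \<bar>f x - g x\<bar> \<partial>lborel)"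
        using lborel_integral_real_affine[of 1 "\<lambda>x. \<bar>f x - g x\<bar>" "- d n"] by simp
      finally show ?thesis by simp
    qed
    have "\<forall>\<^sub>F n in sequentially. (\<integral>x. \<bar>f (x - d n) - f x\<bar> \<partial>lborel) < e / 3"
      using f(2) \<open>0 < e\<close> by (intro order_tendstoD) auto
    then obtain N where N: "\<And>n. n \<ge> N \<Longrightarrow> (\<integral>x. \<bar>f (x - d n) - f x\<bar> \<partial>lborel) < e / 3"
      by (auto simp: eventually_sequentially)
    show "\<exists>no. \<forall>n\<ge>no. norm ((\<integral>x. \<bar>g (x - d n) - g x\<bar> \<partial>lborel) - 0) < e"
    proof (intro exI allI impI)
      fix n assume "N \<le> n"
      have "0 \<le> (\<integral>x. \<bar>g (x - d n) - g x\<bar> \<partial>lborel)" by (rule integral_nonneg_AE) simp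
      then show "norm ((\<integral>x. \<bar>g (x - d n) - g x\<bar> \<partial>lborel) - 0) < e"
        using le[of n] N[OF \<open>N \<le> n\<close>] f(3) by simp
    qed
  qed
  {
    case (base A c)
    have A[measurable]: "A \<in> sets borel" using base by simp
    show ?case
    proof (rule approx)
      show "integrable lborel (\<lambda>x. indicat_real A x *\<^sub>R c)" using base by simp
      fix e :: real assume "0 < e"
      define e' where "e' = e / (\<bar>c\<bar> + 1)"
      have "0 < e'" using \<open>0 < e\<close> by (simp add: e'_def)
      obtain U where U: "open U" "A \<subseteq> U" "emeasure lborel (U - A) < ennreal e'"
        using outer_regular_lborel[OF A \<open>0 < e'\<close>] by metis
      have [measurable]: "U \<in> sets borel" using U by auto
      have "emeasure lborel U \<le> emeasure lborel A + emeasure lborel (U - A)"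
        using emeasure_subadditive[of A lborel "U - A"] U(2) by (simp add: Un_absorb1)
      also have "\<dots> < \<infinity>" using base U(3) by (simp add: less_top[symmetric]) (metis ennreal_less_top less_trans order_less_irrefl)
      finally have finU: "emeasure lborel U < \<infinity>" .
      have "(\<lambda>n. \<bar>c\<bar> * (\<integral>x. \<bar>indicat_real U (x - d n) - indicator U x\<bar> \<partial>lborel)) \<longlonglongrightarrow> \<bar>c\<bar> * 0"
        by (intro tendsto_mult_left tendsto_translation_L1_open U finU assms)
      moreover have "(\<integral>x. \<bar>indicat_real U (x - d n) *\<^sub>R c - indicator U x *\<^sub>R c\<bar> \<partial>lborel)
          = \<bar>c\<bar> * (\<integral>x. \<bar>indicat_real U (x - d n) - indicator U x\<bar> \<partial>lborel)" for n
      proof -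
        have "\<bar>indicat_real U (x - d n) *\<^sub>R c - indicator U x *\<^sub>R c\<bar>
          = \<bar>c\<bar> * \<bar>indicat_real U (x - d n) - indicator U x\<bar>" for x
          by (simp add: abs_mult[symmetric] right_diff_distrib mult.commute)
        then show ?thesis by simp
      qed
      moreover have "(\<integral>x. \<bar>indicat_real U x *\<^sub>R c - indicat_real A x *\<^sub>R c\<bar> \<partial>lborel) < e"
      proof -
        have "(\<integral>x. \<bar>indicat_real U x *\<^sub>R c - indicat_real A x *\<^sub>R c\<bar> \<partial>lborel)
          = (\<integral>x. \<bar>c\<bar> * indicat_real (U - A) x \<partial>lborel)"
          using U(2) by (intro Bochner_Integration.integral_cong) (auto simp: indicator_def)
        also have "\<dots> = \<bar>c\<bar> * measure lborel (U - A)" by simp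
        also have "\<dots> \<le> \<bar>c\<bar> * e'"
        proof -
          have "emeasure lborel (U - A) = ennreal (measure lborel (U - A))"
            using U(3) by (intro emeasure_eq_ennreal_measure) auto
          then show ?thesis using U(3) \<open>0 < e'\<close> by (intro mult_left_mono) (auto simp: ennreal_less_iff)
        qed
        also have "\<dots> < e" using \<open>0 < e\<close> by (simp add: e'_def field_simps)
        finally show ?thesis .
      qed
      ultimately show "\<exists>f. integrable lborel f \<and>
        (\<lambda>n. \<integral>x. \<bar>f (x - d n) - f x\<bar> \<partial>lborel) \<longlonglongrightarrow> 0 \<and> (\<integral>x. \<bar>f x - indicat_real A x *\<^sub>R c\<bar> \<partial>lborel) < e"
        using finU by (intro exI[of _ "\<lambda>x. indicat_real U x *\<^sub>R c"]) auto
    qed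
  next
    case (add f g)
    have shift: "integrable lborel (\<lambda>x. k (x - d n))" if "integrable lborel k" for k :: "real \<Rightarrow> real" and n
      using lborel_integrable_real_affine[OF that, of 1 "- d n"] by simp
    show ?case
    proof (rule Lim_null_comparison)
      show "(\<lambda>n. (\<integral>x. \<bar>f (x - d n) - f x\<bar> \<partial>lborel) + (\<integral>x. \<bar>g (x - d n) - g x\<bar> \<partial>lborel)) \<longlonglongrightarrow> 0"
        using tendsto_add[OF add.IH] by simp
      have "(\<integral>x. \<bar>(f (x - d n) + g (x - d n)) - (f x + g x)\<bar> \<partial>lborel)
        \<le> (\<integral>x. \<bar>f (x - d n) - f x\<bar> \<partial>lborel) + (\<integral>x. \<bar>g (x - d n) - g x\<bar> \<partial>lborel)" for n
      proof -
        have i: "integrable lborel (\<lambda>x. \<bar>f (x - d n) - f x\<bar>)" "integrable lborel (\<lambda>x. \<bar>g (x - d n) - g x\<bar>)"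
          "integrable lborel (\<lambda>x. \<bar>(f (x - d n) + g (x - d n)) - (f x + g x)\<bar>)"
          using shift[OF add.hyps(1)] shift[OF add.hyps(2)] add.hyps by auto
        have "(\<integral>x. \<bar>(f (x - d n) + g (x - d n)) - (f x + g x)\<bar> \<partial>lborel)
          \<le> (\<integral>x. \<bar>f (x - d n) - f x\<bar> + \<bar>g (x - d n) - g x\<bar> \<partial>lborel)"
          using i by (intro integral_mono) auto
        then show ?thesis using i by simp
      qed
      then show "\<forall>\<^sub>F n in sequentially. norm (\<integral>x. \<bar>(f (x - d n) + g (x - d n)) - (f x + g x)\<bar> \<partial>lborel)
        \<le> (\<integral>x. \<bar>f (x - d n) - f x\<bar> \<partial>lborel) + (\<integral>x. \<bar>g (x - d n) - g x\<bar> \<partial>lborel)"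
        by (intro always_eventually) (simp add: integral_nonneg_AE)
    qed
  next
    case (lim f s)
    show ?case
    proof (rule approx)
      show "integrable lborel f" by fact
      fix e :: real assume "0 < e"
      have "(\<lambda>i. \<integral>x. \<bar>s i x - f x\<bar> \<partial>lborel) \<longlonglongrightarrow> (\<integral>x. 0 \<partial>(lborel :: real measure))"
      proof (rule integral_dominated_convergence[where w="\<lambda>x. 3 * \<bar>f x\<bar>"])
        show "AE x in lborel. (\<lambda>i. \<bar>s i x - f x\<bar>) \<longlonglongrightarrow> 0"
        proof (intro AE_I2)
          fix x :: real
          have "(\<lambda>i. s i x - f x) \<longlonglongrightarrow> f x - f x" using lim.hyps(2)[of x] by (intro tendsto_diff) auto
          then show "(\<lambda>i. \<bar>s i x - f x\<bar>) \<longlonglongrightarrow> 0" by (intro tendsto_rabs_zero) simp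
        qed
        show "AE x in lborel. norm \<bar>s i x - f x\<bar> \<le> 3 * \<bar>f x\<bar>" for i
        proof (intro AE_I2)
          fix x :: real
          show "norm \<bar>s i x - f x\<bar> \<le> 3 * \<bar>f x\<bar>" using lim.hyps(3)[of x i] by simp
        qed
      qed (use lim.hyps in auto)
      then have "\<forall>\<^sub>F i in sequentially. (\<integral>x. \<bar>s i x - f x\<bar> \<partial>lborel) < e" 
        using \<open>0 < e\<close> by (intro order_tendstoD) auto
      then obtain i where "(\<integral>x. \<bar>s i x - f x\<bar> \<partial>lborel) < e" by (auto simp: eventually_sequentially)
      then show "\<exists>k. integrable lborel k \<and>
        (\<lambda>n. \<integral>x. \<bar>k (x - d n) - k x\<bar> \<partial>lborel) \<longlonglongrightarrow> 0 \<and> (\<integral>x. \<bar>k x - f x\<bar> \<partial>lborel) < e"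
        using lim.hyps(1) lim.IH by blast
    qed
  }
qed

lemma translation_L1_small:
  fixes g :: "real \<Rightarrow> real"
  assumes "integrable lborel g" "0 < \<epsilon>"
  shows "\<exists>\<delta>>0. \<forall>d. \<bar>d\<bar> \<le> \<delta> \<longrightarrow> (\<integral>x. \<bar>g (x - d) - g x\<bar> \<partial>lborel) \<le> \<epsilon>"
proof (rule ccontr)
  assume "\<not> ?thesis"
  then have "\<forall>\<delta>>0. \<exists>d. \<bar>d\<bar> \<le> \<delta> \<and> (\<integral>x. \<bar>g (x - d) - g x\<bar> \<partial>lborel) > \<epsilon>"
    by (simp add: not_le)
  then have "\<forall>n. \<exists>d. \<bar>d\<bar> \<le> inverse (real (Suc n)) \<and> (\<integral>x. \<bar>g (x - d) - g x\<bar> \<partial>lborel) > \<epsilon>"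
    by simp
  then obtain d where d: "\<And>n. \<bar>d n\<bar> \<le> inverse (real (Suc n))"
      "\<And>n. (\<integral>x. \<bar>g (x - d n) - g x\<bar> \<partial>lborel) > \<epsilon>"
    by metis
  have "d \<longlonglongrightarrow> 0"
    by (rule Lim_null_comparison[OF _ LIMSEQ_inverse_real_of_nat]) (use d(1) in simp)
  from tendsto_translation_L1[OF assms(1) this] have "\<forall>\<^sub>F n in sequentially. (\<integral>x. \<bar>g (x - d n) - g x\<bar> \<partial>lborel) < \<epsilon>"
    using assms(2) by (rule order_tendstoD)
  then show False using d(2) by (auto simp: eventually_sequentially dest: order_less_asym)
qed

section \<open>The flow of the drift\<close>

lemma set_integral_Icc_split:
  fixes f :: "real \<Rightarrow> real"
  assumes "set_integrable lborel {a..c} f" "a \<le> b" "b \<le> c"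
  shows "(LINT r:{a..c}|lborel. f r) = (LINT r:{a..b}|lborel. f r) + (LINT r:{b..c}|lborel. f r)"
proof -
  have "(LINT r:{a..b} \<union> {b..c}|lborel. f r) = (LINT r:{a..b}|lborel. f r) + (LINT r:{b..c}|lborel. f r)"
  proof (rule set_integral_Un_AE)
    show "AE r in lborel. \<not> (r \<in> {a..b} \<and> r \<in> {b..c})"
      using AE_lborel_singleton[of b] by eventually_elim auto
    show "set_integrable lborel {a..b} f" "set_integrable lborel {b..c} f"
      using assms(2,3) by (auto intro: set_integrable_subset[OF assms(1)])
  qed auto
  moreover have "{a..b} \<union> {b..c} = {a..c}" using assms by auto
  ultimately show ?thesis by simp
qed

lemma continuous_on_set_integral:
  fixes f :: "real \<Rightarrow> real"
  assumes "set_integrable lborel {a..b} f"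
  shows "continuous_on {a..b} (\<lambda>x. LINT r:{a..x}|lborel. f r)"
proof (rule continuous_on_eq)
  show "continuous_on {a..b} (\<lambda>x. integral {a..x} f)"
    using set_borel_integral_eq_integral(1)[OF assms] by (rule indefinite_integral_continuous_1)
  fix x assume "x \<in> {a..b}"
  then have "set_integrable lborel {a..x} f" by (intro set_integrable_subset[OF assms]) auto
  then show "integral {a..x} f = (LINT r:{a..x}|lborel. f r)"
    by (rule set_borel_integral_eq_integral(2)[symmetric])
qed

text \<open>A change of variables without derivatives: the Jacobian is replaced by the hypothesis
  \<open>mass\<close> on final segments. It makes the image of \<open>m\<close> under
  \<open>u\<close> agree with \<open>\<rho>\<close> on half-lines, which generate the Borel
  sets.\<close>

lemma nn_integral_decreasing_substitution:
  fixes u :: "real \<Rightarrow> real" and m \<rho> :: "real measure" and f :: "real \<Rightarrow> ennreal"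
  assumes sets_m: "sets m = sets borel" and sets_r: "sets \<rho> = sets borel"
    and "a \<le> b" and cont: "continuous_on {a..b} u"
    and strict: "\<And>r s. a \<le> r \<Longrightarrow> r < s \<Longrightarrow> s \<le> b \<Longrightarrow> u s < u r"
    and mass: "\<And>s. a \<le> s \<Longrightarrow> s \<le> b \<Longrightarrow> emeasure m {s..b} = emeasure \<rho> {u b..u s}"
    and fin: "emeasure m {a..b} < \<infinity>"
    and f: "f \<in> borel_measurable borel"
  shows "(\<integral>\<^sup>+s. f (u s) * indicator {a..b} s \<partial>m) = (\<integral>\<^sup>+y. f y * indicator {u b..u a} y \<partial>\<rho>)"
proof -
  \<comment> \<open>Clamping the argument extends \<open>u\<close> to a continuous, hence Borel
    measurable, function on the whole line.\<close>
  define v where "v s = u (max a (min b s))" for s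
  have v_u: "v s = u s" if "s \<in> {a..b}" for s using that by (simp add: v_def)
  have "continuous_on UNIV v" unfolding v_def
    by (rule continuous_on_compose2[OF cont]) (use \<open>a \<le> b\<close> in \<open>auto intro!: continuous_intros\<close>)
  then have v[measurable]: "v \<in> borel_measurable borel" by (rule borel_measurable_continuous_onI)
  note [measurable_cong] = sets_m sets_r
  note [measurable] = f
  define N1 where "N1 = distr (density m (indicator {a..b})) borel v"
  define N2 where "N2 = density \<rho> (indicator {u b..u a})"
  have em1: "emeasure N1 A = emeasure m {s\<in>{a..b}. u s \<in> A}" if [measurable]: "A \<in> sets borel" for A
  proof -
    have [measurable]: "{s\<in>{a..b}. v s \<in> A} \<in> sets m"
    proof -
      have "{s\<in>space borel. s \<in> {a..b} \<and> v s \<in> A} \<in> sets borel" by measurable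
      then show ?thesis unfolding sets_m by simp
    qed
    have "emeasure N1 A = emeasure (density m (indicator {a..b})) (v -` A \<inter> space (density m (indicator {a..b})))"
      unfolding N1_def by (rule emeasure_distr) measurable
    also have "\<dots> = (\<integral>\<^sup>+s. indicator {a..b} s * indicator (v -` A \<inter> space m) s \<partial>m)"
      by (subst emeasure_density) (auto intro!: measurable_sets[OF v, simplified] simp: sets_m sets_eq_imp_space_eq[OF sets_m])
    also have "\<dots> = (\<integral>\<^sup>+s. indicator {s\<in>{a..b}. v s \<in> A} s \<partial>m)"
      by (intro nn_integral_cong) (auto split: split_indicator)
    also have "\<dots> = emeasure m {s\<in>{a..b}. v s \<in> A}" by simp
    also have "{s\<in>{a..b}. v s \<in> A} = {s\<in>{a..b}. u s \<in> A}" using v_u by auto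
    finally show ?thesis .
  qed
  have em2: "emeasure N2 A = emeasure \<rho> ({u b..u a} \<inter> A)" if [measurable]: "A \<in> sets borel" for A
    unfolding N2_def using emeasure_restricted[of "{u b..u a}" \<rho> A] by (simp add: sets_r)
  have anti: "u s \<le> u r" if "a \<le> r" "r \<le> s" "s \<le> b" for r s
    using strict[of r s] that by (cases "r = s") auto
  have eq: "N1 = N2"
  proof (rule measure_eqI_generator_eq[where E="range (\<lambda>x::real. {..x})" and \<Omega>=UNIV and A="\<lambda>n. {..real n}"])
    show "Int_stable (range (\<lambda>x::real. {..x}))" by (auto simp: Int_stable_def)
    show "sets N1 = sigma_sets UNIV (range (\<lambda>x::real. {..x}))"
      by (simp add: N1_def borel_eq_atMost)
    show "sets N2 = sigma_sets UNIV (range (\<lambda>x::real. {..x}))"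
      using sets_r by (simp add: N2_def borel_eq_atMost)
    show "(\<Union>i. {..real i}) = UNIV" using real_arch_simple by auto
    show "emeasure N1 {..real i} \<noteq> \<infinity>" for i
    proof -
      have "emeasure N1 {..real i} \<le> emeasure m {a..b}"
        by (subst em1) (auto intro!: emeasure_mono simp: sets_m)
      then show ?thesis using fin by (auto simp: top_unique)
    qed
    fix X assume "X \<in> range (\<lambda>x::real. {..x})"
    then obtain x where X: "X = {..x}" by auto
    have Xm: "X \<in> sets borel" by (simp add: X)
    consider "x < u b" | "u a < x" | "u b \<le> x" "x \<le> u a" by linarith
    then show "emeasure N1 X = emeasure N2 X"
    proof cases
      case 1
      then have "{s\<in>{a..b}. u s \<in> X} = {}" using anti[of _ b] by (force simp: X)
      moreover have "{u b..u a} \<inter> X = {}" using 1 by (auto simp: X)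
      ultimately show ?thesis by (simp only: em1[OF Xm] em2[OF Xm] emeasure_empty)
    next
      case 2
      then have "{s\<in>{a..b}. u s \<in> X} = {a..b}" using anti[of a] by (force simp: X)
      moreover have "{u b..u a} \<inter> X = {u b..u a}" using 2 by (auto simp: X)
      ultimately show ?thesis using mass[of a] \<open>a \<le> b\<close> by (simp only: em1[OF Xm] em2[OF Xm] order_refl)
    next
      case 3
      \<comment> \<open>Monotonicity turns the sublevel set of \<open>u\<close> into a final segment
        \<open>{s..b}\<close>, the kind of set on which \<open>mass\<close> gives
        information.\<close>
      then obtain s where s: "a \<le> s" "s \<le> b" "u s = x"
        using IVT2'[of u b x a] \<open>a \<le> b\<close> cont by auto
      have "{r\<in>{a..b}. u r \<in> X} = {s..b}"
      proof safe
        fix r assume "r \<in> {a..b}" "u r \<in> X"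
        then show "r \<in> {s..b}" using strict[of r s] s by (cases "r < s") (auto simp: X)
      next
        fix r assume "r \<in> {s..b}"
        then show "r \<in> {a..b}" "u r \<in> X" using s anti[of s r] by (auto simp: X)
      qed
      moreover have "{u b..u a} \<inter> X = {u b..u s}" using s anti[of a s] by (auto simp: X)
      ultimately show ?thesis using mass[OF s(1,2)] by (simp only: em1[OF Xm] em2[OF Xm])
    qed
  qed auto
  have "(\<integral>\<^sup>+s. f (u s) * indicator {a..b} s \<partial>m) = (\<integral>\<^sup>+s. indicator {a..b} s * f (v s) \<partial>m)"
    using v_u by (intro nn_integral_cong) (auto split: split_indicator)
  also have "\<dots> = (\<integral>\<^sup>+s. f (v s) \<partial>density m (indicator {a..b}))"
    by (subst nn_integral_density) (auto simp: mult.commute)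
  also have "\<dots> = (\<integral>\<^sup>+y. f y \<partial>N1)"
    unfolding N1_def by (subst nn_integral_distr) auto
  also have "\<dots> = (\<integral>\<^sup>+y. indicator {u b..u a} y * f y \<partial>\<rho>)"
    unfolding eq N2_def by (subst nn_integral_density) auto
  finally show ?thesis by (simp add: mult.commute)
qed

text \<open>\<open>h\<close> is the reciprocal of the downward speed, so its integral over
  \<open>{a..b}\<close> is the travel time from b down to a. \<open>h_zero\<close> says that this
  time is unbounded as a decreases to 0; it keeps the flow positive at all times.\<close>

locale travel_density =
  fixes h :: "real \<Rightarrow> real"
  assumes h_meas[measurable]: "h \<in> borel_measurable borel"
    and h_pos: "0 < x \<Longrightarrow> 0 < h x"
    and h_int: "0 < a \<Longrightarrow> set_integrable lborel {a..b} h"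
    and h_zero: "0 < b \<Longrightarrow> \<exists>a>0. a \<le> b \<and> t \<le> (LINT y:{a..b}|lborel. h y)"
begin

text \<open>Signed travel time from x to 1, an antiderivative of \<open>h\<close> normalised at 1.
  Of the two intervals one is empty, or both are the singleton 1.\<close>

definition G :: "real \<Rightarrow> real" where
  "G x = (LINT y:{1..x}|lborel. h y) - (LINT y:{x..1}|lborel. h y)"

lemma integral_h_add:
  assumes "0 < a" "a \<le> b" "b \<le> c"
  shows "(LINT y:{a..c}|lborel. h y) = (LINT y:{a..b}|lborel. h y) + (LINT y:{b..c}|lborel. h y)"
  by (rule set_integral_Icc_split[OF h_int]) fact+

lemma G_diff:
  assumes "0 < a" "a \<le> b"
  shows "G b - G a = (LINT y:{a..b}|lborel. h y)"
proof -
  have sing: "(LINT y:{c..d}|lborel. h y) = 0" if "d \<le> c" for c d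
  proof -
    have "AE y in lborel. y \<notin> {c..d}" using AE_lborel_singleton[of c] by eventually_elim (use that in auto)
    then have "(\<integral>y. indicator {c..d} y *\<^sub>R h y \<partial>lborel) = (\<integral>y. 0 \<partial>(lborel :: real measure))"
      by (intro integral_cong_AE) auto
    then show ?thesis by (simp add: set_lebesgue_integral_def)
  qed
  consider "b \<le> 1" | "1 \<le> a" | "a \<le> 1" "1 \<le> b" by linarith
  then show ?thesis
  proof cases
    case 1
    then show ?thesis using assms integral_h_add[of a b 1] sing[of b 1] sing[of a 1] by (simp add: G_def)
  next
    case 2
    then show ?thesis using assms integral_h_add[of 1 a b] sing[of 1 a] sing[of 1 b] by (simp add: G_def)
  next
    case 3
    then show ?thesis using assms integral_h_add[of a 1 b] sing[of 1 b] sing[of a 1] by (simp add: G_def)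
  qed
qed

lemma nn_integral_h:
  assumes "0 < a" "a \<le> b"
  shows "(\<integral>\<^sup>+y. ennreal (h y) * indicator {a..b} y \<partial>lborel) = ennreal (G b - G a)"
proof -
  have "(\<integral>\<^sup>+y. ennreal (h y) * indicator {a..b} y \<partial>lborel) = (\<integral>\<^sup>+y. ennreal (indicator {a..b} y * h y) \<partial>lborel)"
    by (intro nn_integral_cong) (auto split: split_indicator)
  also have "\<dots> = ennreal (\<integral>y. indicator {a..b} y * h y \<partial>lborel)"
    using h_int[OF assms(1), of b] h_pos assms(1)
    by (intro nn_integral_eq_integral) (auto simp: set_integrable_def less_imp_le split: split_indicator)
  finally show ?thesis using G_diff[OF assms] by (simp add: set_lebesgue_integral_def)
qed

lemma G_strict_mono:
  assumes "0 < a" "a < b"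
  shows "G a < G b"
proof -
  have "0 \<le> G b - G a"
    using G_diff[of a b] assms h_pos
    by (auto simp: set_lebesgue_integral_def less_imp_le intro!: integral_nonneg_AE AE_I2 split: split_indicator)
  moreover have "G b - G a \<noteq> 0"
  proof
    assume "G b - G a = 0"
    then have "(\<integral>\<^sup>+y. ennreal (h y) * indicator {a..b} y \<partial>lborel) = 0"
      using nn_integral_h[of a b] assms by simp
    then have "AE y in lborel. ennreal (h y) * indicator {a..b} y = 0"
      by (subst (asm) nn_integral_0_iff_AE) auto
    then have "AE y in lborel. y \<notin> {a..b}"
    proof eventually_elim
      case (elim y)
      show ?case
      proof
        assume "y \<in> {a..b}"
        then have "0 < h y" "ennreal (h y) = 0" using elim h_pos[of y] assms by auto
        then show False by simp
      qed
    qed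
    then have "{a..b} \<in> null_sets lborel" by (subst AE_iff_null_sets) auto
    then show False using assms by (simp add: null_sets_def)
  qed
  ultimately show ?thesis by simp
qed

lemma G_mono: "0 < a \<Longrightarrow> a \<le> b \<Longrightarrow> G a \<le> G b"
  using G_strict_mono[of a b] by (cases "a = b") auto

lemma G_less_iff: "0 < a \<Longrightarrow> 0 < b \<Longrightarrow> G a < G b \<longleftrightarrow> a < b"
  using G_strict_mono[of a b] G_mono[of b a] by (cases "a < b") auto

lemma G_le_iff: "0 < a \<Longrightarrow> 0 < b \<Longrightarrow> G a \<le> G b \<longleftrightarrow> a \<le> b"
  using G_less_iff[of b a] by (simp add: not_less[symmetric])

lemma G_eq_iff: "0 < a \<Longrightarrow> 0 < b \<Longrightarrow> G a = G b \<longleftrightarrow> a = b"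
  using G_le_iff[of a b] G_le_iff[of b a] by auto

lemma G_continuous_on_Icc:
  assumes "0 < a"
  shows "continuous_on {a..b} G"
proof -
  have "continuous_on {a..b} (\<lambda>x. G a + (LINT y:{a..x}|lborel. h y))"
    by (intro continuous_intros continuous_on_set_integral h_int assms)
  moreover have "G a + (LINT y:{a..x}|lborel. h y) = G x" if "x \<in> {a..b}" for x
    using G_diff[of a x] that assms by simp
  ultimately show ?thesis by (rule continuous_on_eq)
qed

lemma isCont_G:
  assumes "0 < x"
  shows "isCont G x"
proof -
  have "continuous_on {x/2..2*x} G" using assms by (intro G_continuous_on_Icc) simp
  then have "continuous_on {x/2<..<2*x} G" by (rule continuous_on_subset) auto
  then show ?thesis using assms by (subst (asm) continuous_on_eq_continuous_at) auto
qed

text \<open>In the coordinate \<open>G\<close> the motion has unit speed downwards. This describes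
  the flow without solving a differential equation; uniqueness of the point comes from injectivity
  of \<open>G\<close> and existence, for \<open>0 \<le> t\<close>, from
  \<open>h_zero\<close>.\<close>

definition flow :: "real \<Rightarrow> real \<Rightarrow> real" where
  "flow t x = (THE y. 0 < y \<and> G y = G x - t)"

lemma flow_eqI: "0 < y \<Longrightarrow> G y = G x - t \<Longrightarrow> flow t x = y"
  unfolding flow_def by (rule the_equality) (auto simp: G_eq_iff[symmetric])

lemma flow_ex:
  assumes "0 < x" "0 \<le> t"
  shows "\<exists>y. 0 < y \<and> y \<le> x \<and> G y = G x - t"
proof -
  obtain a where a: "0 < a" "a \<le> x" "t \<le> (LINT y:{a..x}|lborel. h y)"
    using h_zero[OF assms(1)] by blast
  then have "G a \<le> G x - t" using G_diff[of a x] by simp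
  then obtain y where "a \<le> y" "y \<le> x" "G y = G x - t"
    using IVT'[of G a "G x - t" x] a assms G_continuous_on_Icc by auto
  then show ?thesis using a by (intro exI[of _ y]) auto
qed

lemma
  assumes "0 < x" "0 \<le> t"
  shows flow_pos: "0 < flow t x" and flow_le: "flow t x \<le> x" and G_flow: "G (flow t x) = G x - t"
  using flow_ex[OF assms] flow_eqI by blast+

lemma flow_0: "0 < x \<Longrightarrow> flow 0 x = x"
  by (rule flow_eqI) auto

lemma flow_mono: "0 < x \<Longrightarrow> x \<le> y \<Longrightarrow> 0 \<le> t \<Longrightarrow> flow t x \<le> flow t y"
  using G_flow[of x t] G_flow[of y t] flow_pos[of x t] flow_pos[of y t] G_mono[of x y]
  by (subst G_le_iff[symmetric]) auto

lemma flow_small: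
  assumes "0 < \<epsilon>" "0 < x"
  shows "\<exists>t\<ge>0. \<forall>s\<ge>t. flow s x \<le> \<epsilon>"
proof (intro exI conjI allI impI)
  show "0 \<le> max 0 (G x - G \<epsilon>)" by simp
  fix s assume "s \<ge> max 0 (G x - G \<epsilon>)"
  then show "flow s x \<le> \<epsilon>"
    using assms flow_pos[of x s] G_flow[of x s] by (subst G_le_iff[symmetric]) auto
qed

definition Ginv :: "real \<Rightarrow> real" where "Ginv g = (THE y. 0 < y \<and> G y = g)"

lemma flow_Ginv: "flow t x = Ginv (G x - t)" by (simp add: flow_def Ginv_def)

lemma Ginv_G: "0 < y \<Longrightarrow> Ginv (G y) = y"
  unfolding Ginv_def by (rule the_equality) (auto simp: G_eq_iff)

lemma isCont_Ginv:
  assumes "0 < y"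
  shows "isCont Ginv (G y)"
proof (rule isCont_inverse_function[where f=G and g=Ginv and x=y and d="y/2"])
  show "0 < y / 2" using assms by simp
  fix z assume "\<bar>z - y\<bar> \<le> y / 2"
  then have "0 < z" using assms unfolding abs_le_iff by linarith
  then show "Ginv (G z) = z" "isCont G z" by (simp_all add: Ginv_G isCont_G)
qed

text \<open>Time and starting point enter only through \<open>G x - t\<close>, so joint continuity
  reduces to continuity of \<open>G\<close> and of its inverse in one variable.\<close>

lemma flow_continuous:
  assumes "continuous_on S f" "continuous_on S g" "\<And>p. p \<in> S \<Longrightarrow> 0 \<le> f p \<and> 0 < g p"
  shows "continuous_on S (\<lambda>p. flow (f p) (g p))"
proof -
  have 1: "continuous_on (G ` {0<..}) Ginv"
    by (intro continuous_at_imp_continuous_on) (auto intro: isCont_Ginv)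
  have "continuous_on {0<..} G"
    by (intro continuous_at_imp_continuous_on) (auto intro: isCont_G)
  then have "continuous_on S (\<lambda>p. G (g p))"
    by (rule continuous_on_compose2) (use assms in auto)
  then have "continuous_on S (\<lambda>p. G (g p) - f p)" using assms by (intro continuous_intros)
  moreover have "(\<lambda>p. G (g p) - f p) ` S \<subseteq> G ` {0<..}"
  proof safe
    fix p assume "p \<in> S"
    then show "G (g p) - f p \<in> G ` {0<..}"
      using G_flow[of "g p" "f p"] flow_pos[of "g p" "f p"] assms(3)[of p] by (intro image_eqI[of _ _ "flow (f p) (g p)"]) auto
  qed
  ultimately show ?thesis unfolding flow_Ginv by (rule continuous_on_compose2[OF 1])
qed

text \<open>Occupation formula: a point moving down with speed \<open>1 / h\<close> spends time with
  density \<open>h\<close> along its way. It later shows that sweeping across a set of positive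
  Lebesgue measure takes positive time.\<close>

lemma nn_integral_flow:
  fixes f :: "real \<Rightarrow> ennreal"
  assumes "0 < y" "a \<le> b" "0 \<le> a" and [measurable]: "f \<in> borel_measurable borel"
  shows "(\<integral>\<^sup>+s. f (flow s y) * indicator {a..b} s \<partial>lborel)
    = (\<integral>\<^sup>+x. h x * f x * indicator {flow b y..flow a y} x \<partial>lborel)"
proof -
  have b: "0 \<le> b" using assms by simp
  have dens: "emeasure (density lborel h) {c..d} = ennreal (G d - G c)" if "0 < c" "c \<le> d" for c d
    using that by (subst emeasure_density) (auto simp: nn_integral_h)
  have "(\<integral>\<^sup>+s. f (flow s y) * indicator {a..b} s \<partial>lborel)
    = (\<integral>\<^sup>+x. f x * indicator {flow b y..flow a y} x \<partial>density lborel h)"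
  proof (rule nn_integral_decreasing_substitution[where u="\<lambda>s. flow s y"])
    show "continuous_on {a..b} (\<lambda>s. flow s y)"
      using assms by (intro flow_continuous continuous_intros) auto
    show less: "flow s y < flow r y" if "a \<le> r" "r < s" "s \<le> b" for r s
      using that assms by (subst G_less_iff[symmetric]) (auto simp: flow_pos G_flow)
    fix s assume s: "a \<le> s" "s \<le> b"
    then have "flow b y \<le> flow s y" using less[of s b] by (cases "s = b") auto
    then show "emeasure lborel {s..b} = emeasure (density lborel h) {flow b y..flow s y}"
      using s assms by (subst dens) (auto simp: flow_pos G_flow)
  qed (use assms in \<open>auto simp: ennreal_less_top\<close>)
  also have "\<dots> = (\<integral>\<^sup>+x. h x * (f x * indicator {flow b y..flow a y} x) \<partial>lborel)"
    by (subst nn_integral_density) auto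
  finally show ?thesis by (simp add: mult.assoc)
qed

text \<open>An integral curve of the vector field \<open>-1/h\<close> follows the flow. As \<open>h\<close> is only measurable,
  this is read off from the image under the curve of the measure with density \<open>-u'\<close>, which
  is Lebesgue measure.\<close>

lemma integral_curve_flow:
  assumes "a \<le> b" and pos: "\<And>s. a \<le> s \<Longrightarrow> s \<le> b \<Longrightarrow> 0 < u s"
    and int: "set_integrable lborel {a..b} w"
    and u: "\<And>s. a \<le> s \<Longrightarrow> s \<le> b \<Longrightarrow> u s = u a - (LINT r:{a..s}|lborel. w r)"
    and w: "AE r in lborel. r \<in> {a..b} \<longrightarrow> w r = 1 / h (u r)"
  shows "u b = flow (b - a) (u a)"
proof -
  define k where "k r = indicator {a..b} r * w r" for r
  have k_int: "integrable lborel k" using int by (simp add: set_integrable_def k_def[abs_def])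
  then have k_meas[measurable]: "k \<in> borel_measurable borel" by auto
  have k_nonneg: "AE r in lborel. 0 \<le> k r"
    using w by eventually_elim (use pos h_pos in \<open>auto simp: k_def less_imp_le split: split_indicator\<close>)
  have int': "set_integrable lborel {r..s} w" if "a \<le> r" "s \<le> b" for r s
    using that by (intro set_integrable_subset[OF int]) auto
  have diff: "u r - u s = (LINT t:{r..s}|lborel. w t)" if "a \<le> r" "r \<le> s" "s \<le> b" for r s
    using u[of r] u[of s] set_integral_Icc_split[OF int'[of a s], of r] that by simp
  have nn: "(\<integral>\<^sup>+t. ennreal (k t) * indicator {s..b} t \<partial>lborel) = ennreal (u s - u b)" if "a \<le> s" "s \<le> b" for s
  proof -
    have "(\<integral>\<^sup>+t. ennreal (k t) * indicator {s..b} t \<partial>lborel) = (\<integral>\<^sup>+t. ennreal (indicator {s..b} t * w t) \<partial>lborel)"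
      using that by (intro nn_integral_cong) (auto simp: k_def split: split_indicator)
    also have "\<dots> = ennreal (\<integral>t. indicator {s..b} t * w t \<partial>lborel)"
    proof (rule nn_integral_eq_integral)
      show "integrable lborel (\<lambda>t. indicator {s..b} t * w t)" 
        using int'[of s b] that by (simp add: set_integrable_def)
      show "AE t in lborel. 0 \<le> indicator {s..b} t * w t"
        using k_nonneg by eventually_elim (use that in \<open>auto simp: k_def split: split_indicator_asm split_indicator\<close>)
    qed
    finally show ?thesis using diff[of s b] that by (simp add: set_lebesgue_integral_def)
  qed
  have le: "u s \<le> u r" if "a \<le> r" "r \<le> s" "s \<le> b" for r s
  proof -
    have "0 \<le> (LINT t:{r..s}|lborel. w t)" unfolding set_lebesgue_integral_def
    proof (rule integral_nonneg_AE)
      show "AE t in lborel. 0 \<le> indicator {r..s} t *\<^sub>R w t"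
        using k_nonneg by eventually_elim (use that in \<open>auto simp: k_def split: split_indicator_asm split_indicator\<close>)
    qed
    then show ?thesis using diff[OF that] by simp
  qed
  \<comment> \<open>If \<open>u\<close> took the same value at r and s, the nonnegative
    \<open>w\<close> would vanish almost everywhere on \<open>{r..s}\<close>, although it equals
    \<open>1 / h (u r)\<close> and is positive almost everywhere.\<close>
  have less: "u s < u r" if "a \<le> r" "r < s" "s \<le> b" for r s
  proof (rule ccontr)
    assume "\<not> u s < u r"
    then have "u s = u r" using le[of r s] that by simp
    then have "ennreal (u r - u b) = ennreal (u s - u b)" by simp
    then have 0: "(LINT t:{r..s}|lborel. w t) = 0" using diff[of r s] \<open>u s = u r\<close> that by simp
    have "AE t in lborel. indicator {r..s} t * w t = 0"
    proof (rule integral_nonneg_eq_0_iff_AE[THEN iffD1])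
      show "integrable lborel (\<lambda>t. indicator {r..s} t * w t)" 
        using int'[of r s] that by (simp add: set_integrable_def)
      show "AE t in lborel. 0 \<le> indicator {r..s} t * w t"
        using k_nonneg by eventually_elim (use that in \<open>auto simp: k_def split: split_indicator_asm split_indicator\<close>)
      show "(\<integral>t. indicator {r..s} t * w t \<partial>lborel) = 0" using 0 by (simp add: set_lebesgue_integral_def)
    qed
    then have "AE t in lborel. t \<notin> {r..s}"
      using w
    proof eventually_elim
      case (elim t)
      show ?case
      proof
        assume t: "t \<in> {r..s}"
        then have "w t = 0" using elim(1) by simp
        moreover have "w t = 1 / h (u t)" using elim(2) t that by auto
        moreover have "0 < h (u t)" using pos[of t] t that by (intro h_pos) auto
        ultimately show False by simp
      qed
    qed
    then have "{r..s} \<in> null_sets lborel" by (subst AE_iff_null_sets) auto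
    then show False using that by (simp add: null_sets_def)
  qed
  have cont: "continuous_on {a..b} u"
  proof -
    have "continuous_on {a..b} (\<lambda>x. u a - (LINT r:{a..x}|lborel. w r))"
      by (intro continuous_intros continuous_on_set_integral int)
    then show ?thesis by (rule continuous_on_eq) (simp add: u[symmetric])
  qed
  have [measurable]: "(\<lambda>r. ennreal (k r)) \<in> borel_measurable lborel" by measurable
  \<comment> \<open>Integrate \<open>h\<close> in two ways: along the curve, \<open>k\<close>
    cancels \<open>h (u s)\<close> and leaves the elapsed time \<open>b - a\<close>; in space, the
    integral is the travel time \<open>G (u a) - G (u b)\<close>.\<close>
  have "(\<integral>\<^sup>+s. ennreal (h (u s)) * indicator {a..b} s \<partial>density lborel k)
      = (\<integral>\<^sup>+y. ennreal (h y) * indicator {u b..u a} y \<partial>lborel)"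
  proof (rule nn_integral_decreasing_substitution)
    fix s assume s: "a \<le> s" "s \<le> b"
    show "emeasure (density lborel k) {s..b} = emeasure lborel {u b..u s}"
      using nn[OF s] le[of s b] s by (subst emeasure_density) auto
  next
    show "emeasure (density lborel k) {a..b} < \<infinity>"
      using nn[of a] \<open>a \<le> b\<close> by (subst emeasure_density) auto
  qed (use \<open>a \<le> b\<close> cont less in auto)
  also have "\<dots> = ennreal (G (u a) - G (u b))"
    using pos le[of a b] \<open>a \<le> b\<close> by (intro nn_integral_h) auto
  also have "(\<integral>\<^sup>+s. ennreal (h (u s)) * indicator {a..b} s \<partial>density lborel k) = ennreal (b - a)"
  proof -
    define v where "v s = u (max a (min b s))" for s
    have "continuous_on UNIV v" unfolding v_def
      by (rule continuous_on_compose2[OF cont]) (use \<open>a \<le> b\<close> in \<open>auto intro!: continuous_intros\<close>)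
    then have v[measurable]: "v \<in> borel_measurable borel" by (rule borel_measurable_continuous_onI)
    have "(\<integral>\<^sup>+s. ennreal (h (u s)) * indicator {a..b} s \<partial>density lborel k)
      = (\<integral>\<^sup>+s. ennreal (h (v s)) * indicator {a..b} s \<partial>density lborel k)"
      by (intro nn_integral_cong) (auto simp: v_def split: split_indicator)
    also have "\<dots> = (\<integral>\<^sup>+s. k s * (ennreal (h (v s)) * indicator {a..b} s) \<partial>lborel)"
      by (subst nn_integral_density) auto
    also have "\<dots> = (\<integral>\<^sup>+s. indicator {a..b} s \<partial>lborel)"
    proof (rule nn_integral_cong_AE)
      show "AE s in lborel. k s * (ennreal (h (v s)) * indicator {a..b} s) = indicator {a..b} s"
        using w
      proof eventually_elim
        case (elim s)
        show ?case
        proof (cases "s \<in> {a..b}")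
          case True
          then have "0 < h (u s)" using pos[of s] by (intro h_pos) auto
          then show ?thesis using True elim by (simp add: k_def v_def ennreal_mult'[symmetric])
        qed simp
      qed
    qed
    finally show ?thesis using \<open>a \<le> b\<close> by simp
  qed
  finally have "ennreal (b - a) = ennreal (G (u a) - G (u b))" .
  moreover have "G (u b) \<le> G (u a)" using pos le[of a b] \<open>a \<le> b\<close> by (intro G_mono) auto
  ultimately have "b - a = G (u a) - G (u b)" using \<open>a \<le> b\<close> by (subst (asm) ennreal_inj) auto
  then show ?thesis using pos[of b] \<open>a \<le> b\<close> by (intro flow_eqI[symmetric]) auto
qed

end

section \<open>Paths between and across jumps\<close>

text \<open>The infimum runs over countably many times so that it is measurable as a function of the
  path in the product space; rational times at which no jump has occurred yet contribute the neutral
  value 1.\<close>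

definition first_jump :: "(real \<Rightarrow> nat) \<Rightarrow> real" where
  "first_jump p = (INF q\<in>\<rat> \<inter> {0..1}. if 1 \<le> p q then q else 1)"

lemma first_jump_bounds: "0 \<le> first_jump p" "first_jump p \<le> 1"
proof -
  have ne: "\<rat> \<inter> {0..1::real} \<noteq> {}" by (auto intro!: exI[of _ 0])
  show "0 \<le> first_jump p" unfolding first_jump_def by (rule cINF_greatest[OF ne]) auto
  show "first_jump p \<le> 1" unfolding first_jump_def
    by (rule cINF_lower2[where x=0]) (auto intro!: bdd_belowI[of _ 0])
qed

text \<open>Right-continuity shows that the infimum is itself a time at which the jump has occurred.
  The case \<open>T = 1\<close> is separate because no later time in \<open>{0..1}\<close> is left
  to approach it from; there \<open>N1\<close> gives the value directly.\<close>

lemma first_jump_le_iff: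
  assumes mono: "mono_on {0..} N" and right_cont: "\<And>t. 0 \<le> t \<Longrightarrow> continuous (at_right t) N"
    and N1: "N 1 = 1" and "0 \<le> s" "s \<le> 1"
  shows "first_jump N \<le> s \<longleftrightarrow> 1 \<le> N s"
proof -
  define T where "T = first_jump N"
  let ?f = "\<lambda>q. if 1 \<le> N q then q else 1"
  have ne: "\<rat> \<inter> {0..1::real} \<noteq> {}" by (auto intro!: exI[of _ 0])
  have bdd: "bdd_below (?f ` (\<rat> \<inter> {0..1}))" by (intro bdd_belowI[of _ 0]) auto
  have T_def': "T = (INF q\<in>\<rat> \<inter> {0..1}. ?f q)" by (simp add: T_def first_jump_def)
  have T01: "0 \<le> T" "T \<le> 1" using first_jump_bounds[of N] by (auto simp: T_def)
  have le: "N r \<le> N t" if "0 \<le> r" "r \<le> t" for r t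
    using mono that by (auto simp: mono_on_def)
  have before: "N r = 0" if r: "0 \<le> r" "r < T" for r
  proof (rule ccontr)
    assume "N r \<noteq> 0"
    obtain q where q: "q \<in> \<rat>" "r < q" "q < T" using Rats_dense_in_real[OF r(2)] by blast
    then have "1 \<le> N q" using le[of r q] r \<open>N r \<noteq> 0\<close> by simp
    then have "T \<le> q" unfolding T_def' using q r T01 by (intro cINF_lower2[OF bdd, of q]) auto
    then show False using q by simp
  qed
  have after: "1 \<le> N r" if r: "T < r" "r \<le> 1" for r
  proof -
    obtain q where q: "q \<in> \<rat> \<inter> {0..1}" "?f q < r"
      using r(1) unfolding T_def' by (subst (asm) cINF_less_iff[OF ne bdd]) blast
    then have "1 \<le> N q" "q < r" using r by (auto split: if_splits)
    then show ?thesis using le[of q r] q by auto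
  qed
  have at: "1 \<le> N T"
  proof (cases "T = 1")
    case False
    then have "T < 1" using T01 by simp
    have "(N \<longlongrightarrow> N T) (at_right T)" using right_cont[OF T01(1)] by (simp add: continuous_within)
    then have "\<forall>\<^sub>F r in at_right T. N r = N T" by (simp add: tendsto_discrete)
    moreover have "\<forall>\<^sub>F r in at_right T. r \<in> {T<..<1}"
      by (rule eventually_at_right_real[OF \<open>T < 1\<close>])
    ultimately have "\<forall>\<^sub>F r in at_right T. 1 \<le> N T"
    proof eventually_elim
      case (elim r)
      then show ?case using after[of r] by simp
    qed
    then show ?thesis by simp
  qed (simp add: N1)
  show ?thesis
    using before[of s] at le[of T s] assms(4) T01 unfolding T_def[symmetric] by (cases "T \<le> s") auto
qed

text \<open>One trajectory with everything that holds almost surely fixed for it. All path arguments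
  below are therefore deterministic.\<close>

locale jump_path = travel_density +
  fixes \<phi> :: "real \<Rightarrow> real" and N :: "real \<Rightarrow> nat" and \<xi> :: "nat \<Rightarrow> real"
    and X :: "real \<Rightarrow> real" and x :: real
  assumes phi: "0 < y \<Longrightarrow> \<phi> y = - 1 / h y"
    and N_0: "N 0 = 0" and N_mono: "mono_on {0..} N"
    and N_right_cont: "0 \<le> t \<Longrightarrow> continuous (at_right t) N"
    and xi_nonneg: "0 \<le> \<xi> i"
    and X_pos: "0 \<le> t \<Longrightarrow> 0 < X t"
    and X_int: "0 \<le> t \<Longrightarrow> set_integrable lborel {0..t} (\<lambda>s. \<phi> (X s))"
    and X_eq: "0 \<le> t \<Longrightarrow> X t = x + (LINT s:{0..t}|lborel. \<phi> (X s)) + (\<Sum>i<N t. \<xi> i)"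
begin

lemma N_le: "0 \<le> s \<Longrightarrow> s \<le> t \<Longrightarrow> N s \<le> N t"
  using N_mono by (auto simp: mono_on_def)

lemma X_0: "X 0 = x"
proof -
  have "(LINT s:{0..0}|lborel. \<phi> (X s)) = (\<integral>s. 0 \<partial>(lborel :: real measure))"
    unfolding set_lebesgue_integral_def using AE_lborel_singleton[of 0] X_int[of 0]
    by (intro integral_cong_AE) (auto simp: set_integrable_def elim!: eventually_mono)
  then show ?thesis using X_eq[of 0] N_0 by simp
qed

lemma x_pos: "0 < x" using X_pos[of 0] X_0 by simp

lemma X_int': "0 \<le> s \<Longrightarrow> set_integrable lborel {s..t} (\<lambda>s. \<phi> (X s))"
  by (cases "0 \<le> t") (auto intro: set_integrable_subset[OF X_int[of t]])

lemma integral_split: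
  assumes "0 \<le> s" "s \<le> t"
  shows "(LINT r:{0..t}|lborel. \<phi> (X r)) = (LINT r:{0..s}|lborel. \<phi> (X r)) + (LINT r:{s..t}|lborel. \<phi> (X r))"
  using assms X_int[of t] by (intro set_integral_Icc_split) auto

lemma X_diff:
  assumes "0 \<le> s" "s \<le> t"
  shows "X t = X s + (LINT r:{s..t}|lborel. \<phi> (X r)) + ((\<Sum>i<N t. \<xi> i) - (\<Sum>i<N s. \<xi> i))"
  using X_eq[of s] X_eq[of t] integral_split[OF assms] assms by simp

lemma phi_neg: "0 < y \<Longrightarrow> \<phi> y < 0"
  using phi h_pos by simp

lemma X_increment_le:
  assumes "0 \<le> s" "s \<le> t" and c: "\<And>r. s \<le> r \<Longrightarrow> r \<le> t \<Longrightarrow> \<phi> (X r) \<le> - c"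
  shows "X t \<le> X s - c * (t - s) + ((\<Sum>i<N t. \<xi> i) - (\<Sum>i<N s. \<xi> i))"
proof -
  have "(LINT r:{s..t}|lborel. \<phi> (X r)) \<le> (LINT r:{s..t}|lborel. - c)"
  proof (rule set_integral_mono)
    show "set_integrable lborel {s..t} (\<lambda>_. - c)" 
      by (rule borel_integrable_atLeastAtMost'[OF continuous_on_const])
  qed (use X_int' assms in auto)
  also have "\<dots> = - c * (t - s)" using assms(2) by (simp add: set_lebesgue_integral_def)
  finally show ?thesis using X_diff[OF assms(1,2)] by simp
qed

lemma X_le: "0 \<le> s \<Longrightarrow> s \<le> t \<Longrightarrow> X t \<le> X s + ((\<Sum>i<N t. \<xi> i) - (\<Sum>i<N s. \<xi> i))"
  using X_increment_le[of s t 0] X_pos phi_neg by (simp add: less_imp_le)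

lemma jumps_mono: "0 \<le> s \<Longrightarrow> s \<le> t \<Longrightarrow> (\<Sum>i<N s. \<xi> i) \<le> (\<Sum>i<N t. \<xi> i)"
  using N_le xi_nonneg by (intro sum_mono2) auto

text \<open>Either the path stays at or above \<open>K\<close> during the unit interval and the
  drift lowers it by at least c, or it is below \<open>K\<close> at some moment and afterwards can
  rise only by jumps. Both cases are covered by one step of the Lindley recursion.\<close>

lemma X_1_le:
  assumes K: "\<And>y. K \<le> y \<Longrightarrow> \<phi> y \<le> - c"
  shows "X 1 \<le> max (x - c) K + (\<Sum>i<N 1. \<xi> i)"
proof (cases "\<forall>s\<in>{0..1}. K \<le> X s")
  case True
  then have "X 1 \<le> X 0 - c * (1 - 0) + ((\<Sum>i<N 1. \<xi> i) - (\<Sum>i<N 0. \<xi> i))"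
    by (intro X_increment_le K) auto
  then show ?thesis using N_0 X_0 by simp
next
  case False
  then obtain s where s: "0 \<le> s" "s \<le> 1" "X s < K" by (auto simp: not_le)
  have "0 \<le> (\<Sum>i<N s. \<xi> i)" using xi_nonneg by (intro sum_nonneg) auto
  then show ?thesis using X_le[OF s(1,2)] s(3) by simp
qed

lemma X_le_jumps:
  assumes "0 \<le> t" "t \<le> 1"
  shows "X t \<le> x + (\<Sum>i<N 1. \<xi> i)"
  using X_le[of 0 t] jumps_mono[of t 1] N_0 X_0 assms by simp

lemma flow_between_jumps:
  assumes "0 \<le> a" "a \<le> b" "\<And>s. a \<le> s \<Longrightarrow> s \<le> b \<Longrightarrow> N s = N a"
  shows "X b = flow (b - a) (X a)"
proof (rule integral_curve_flow[where w="\<lambda>r. - \<phi> (X r)"])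
  show "set_integrable lborel {a..b} (\<lambda>r. - \<phi> (X r))" using X_int'[OF assms(1)] 
    by (simp add: set_integrable_def)
  show "X s = X a - (LINT r:{a..s}|lborel. - \<phi> (X r))" if "a \<le> s" "s \<le> b" for s
    using X_diff[of a s] assms(1) assms(3)[OF that] that by (simp add: set_lebesgue_integral_def)
  have "- \<phi> (X r) = 1 / h (X r)" if "a \<le> r" for r
    using phi[OF X_pos, of r] assms(1) that by simp
  then show "AE r in lborel. r \<in> {a..b} \<longrightarrow> - \<phi> (X r) = 1 / h (X r)" by simp
qed (use assms(1,2) X_pos in auto)

lemma flow_if_no_jump:
  assumes "0 \<le> t" "N t = 0"
  shows "X t = flow t x"
proof -
  have "N s = 0" if "0 \<le> s" "s \<le> t" for s using N_le[OF that] assms by simp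
  then have "X t = flow (t - 0) (X 0)" using assms N_0 by (intro flow_between_jumps) auto
  then show ?thesis by (simp add: X_0)
qed

lemma flow_if_one_jump:
  assumes N1: "N 1 = 1"
  defines "T \<equiv> first_jump N"
  shows "X 1 = flow (1 - T) (flow T x + \<xi> 0)"
proof -
  have T0: "0 \<le> T" and T1: "T \<le> 1" using first_jump_bounds[of N] by (auto simp: T_def)
  have iff: "T \<le> s \<longleftrightarrow> 1 \<le> N s" if "0 \<le> s" "s \<le> 1" for s
    unfolding T_def by (rule first_jump_le_iff) (use N_mono N_right_cont N1 that in auto)
  have before: "N s = 0" if "0 \<le> s" "s < T" for s
    using iff[of s] that T1 by (simp add: not_le)
  have from_T: "N s = 1" if "T \<le> s" "s \<le> 1" for s
  proof -
    have "1 \<le> N s" using iff[of s] that T0 by simp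
    moreover have "N s \<le> 1" using N_le[of s 1] N1 that T0 by simp
    ultimately show ?thesis by simp
  qed
  \<comment> \<open>\<open>u\<close> is the path without its jumps. Unlike \<open>X\<close> it is
    continuous at \<open>T\<close>, so its agreement with the flow before \<open>T\<close> extends
    to \<open>T\<close> and gives the position just before the jump.\<close>
  define u where "u s = x + (LINT r:{0..s}|lborel. \<phi> (X r))" for s
  have X_u: "X s = flow s x" "u s = flow s x" if "0 \<le> s" "s < T" for s
    using flow_if_no_jump[of s] X_eq[of s] before[of s] that by (auto simp: u_def)
  have u_cont: "continuous_on {0..1} u"
    unfolding u_def[abs_def]
    using X_int[of 1] by (intro continuous_intros continuous_on_set_integral) auto
  have uT: "u T = flow T x"
  proof (cases "T = 0")
    case True
    then show ?thesis using X_eq[of 0] N_0 X_0 flow_0[OF x_pos] by (simp add: u_def)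
  next
    case False
    then have cl: "closure {0..<T} = {0..T}" using T0 by simp
    have "u T - flow T x = 0"
    proof (rule continuous_constant_on_closure[of "{0..<T}" "\<lambda>s. u s - flow s x"])
      show "continuous_on (closure {0..<T}) (\<lambda>s. u s - flow s x)" unfolding cl
        using u_cont T1 x_pos
        by (intro continuous_on_diff flow_continuous continuous_intros) (auto intro: continuous_on_subset)
    qed (use X_u cl T0 in auto)
    then show ?thesis by simp
  qed
  have "X T = flow T x + \<xi> 0"
    using X_eq[OF T0] from_T[of T] T1 uT by (simp add: u_def)
  moreover have "X 1 = flow (1 - T) (X T)"
    using T0 T1 from_T by (intro flow_between_jumps) auto
  ultimately show ?thesis by simp
qed

end

section \<open>Compound Poisson processes\<close>

lemma (in prob_space) distr_Pair_indep_rv: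
  assumes "indep_rv M S X T Y"
  shows "distr M (S \<Otimes>\<^sub>M T) (\<lambda>\<omega>. (X \<omega>, Y \<omega>)) = distr M S X \<Otimes>\<^sub>M distr M T Y"
proof -
  have X[measurable]: "X \<in> M \<rightarrow>\<^sub>M S" and Y[measurable]: "Y \<in> M \<rightarrow>\<^sub>M T"
    and ind: "indep_set {X -` A \<inter> space M |A. A \<in> sets S} {Y -` B \<inter> space M |B. B \<in> sets T}"
    using assms by (auto simp: indep_rv_def)
  have "distr M S X \<Otimes>\<^sub>M distr M T Y = distr M (S \<Otimes>\<^sub>M T) (\<lambda>\<omega>. (X \<omega>, Y \<omega>))"
  proof (rule pair_measure_eqI)
    show "sigma_finite_measure (distr M S X)" "sigma_finite_measure (distr M T Y)"
      by (simp_all add: prob_space_distr prob_space_imp_sigma_finite)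
    show "sets (distr M S X \<Otimes>\<^sub>M distr M T Y) = sets (distr M (S \<Otimes>\<^sub>M T) (\<lambda>\<omega>. (X \<omega>, Y \<omega>)))"
      by (simp cong: sets_pair_measure_cong)
    fix A B assume "A \<in> sets (distr M S X)" "B \<in> sets (distr M T Y)"
    then have [measurable]: "A \<in> sets S" "B \<in> sets T" by simp_all
    have "prob ((X -` A \<inter> space M) \<inter> (Y -` B \<inter> space M)) = prob (X -` A \<inter> space M) * prob (Y -` B \<inter> space M)"
      by (rule indep_setD[OF ind]) auto
    moreover have "(\<lambda>\<omega>. (X \<omega>, Y \<omega>)) -` (A \<times> B) \<inter> space M = (X -` A \<inter> space M) \<inter> (Y -` B \<inter> space M)"
      by auto
    ultimately show "emeasure (distr M S X) A * emeasure (distr M T Y) B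
      = emeasure (distr M (S \<Otimes>\<^sub>M T) (\<lambda>\<omega>. (X \<omega>, Y \<omega>))) (A \<times> B)"
      by (simp add: emeasure_distr emeasure_eq_measure ennreal_mult')
  qed
  then show ?thesis by simp
qed

lemma (in prob_space) indep_rv_compose:
  assumes "indep_rv M S X T Y" and f: "f \<in> S \<rightarrow>\<^sub>M S'" and g: "g \<in> T \<rightarrow>\<^sub>M T'"
  shows "indep_rv M S' (\<lambda>\<omega>. f (X \<omega>)) T' (\<lambda>\<omega>. g (Y \<omega>))"
proof -
  have X[measurable]: "X \<in> M \<rightarrow>\<^sub>M S" and Y[measurable]: "Y \<in> M \<rightarrow>\<^sub>M T"
    and ind: "indep_set {X -` A \<inter> space M |A. A \<in> sets S} {Y -` B \<inter> space M |B. B \<in> sets T}"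
    using assms by (auto simp: indep_rv_def)
  note [measurable] = f g
  have fX: "(\<lambda>\<omega>. f (X \<omega>)) -` A \<inter> space M = X -` (f -` A \<inter> space S) \<inter> space M" for A
    using measurable_space[OF X] by auto
  have gY: "(\<lambda>\<omega>. g (Y \<omega>)) -` B \<inter> space M = Y -` (g -` B \<inter> space T) \<inter> space M" for B
    using measurable_space[OF Y] by auto
  show ?thesis unfolding indep_rv_def
  proof (intro conjI indep_setI)
    show "{(\<lambda>\<omega>. f (X \<omega>)) -` A \<inter> space M |A. A \<in> sets S'} \<subseteq> events"
      "{(\<lambda>\<omega>. g (Y \<omega>)) -` B \<inter> space M |B. B \<in> sets T'} \<subseteq> events"
      by auto
    fix a b assume "a \<in> {(\<lambda>\<omega>. f (X \<omega>)) -` A \<inter> space M |A. A \<in> sets S'}"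
      "b \<in> {(\<lambda>\<omega>. g (Y \<omega>)) -` B \<inter> space M |B. B \<in> sets T'}"
    then obtain A B where AB: "A \<in> sets S'" "B \<in> sets T'" "a = (\<lambda>\<omega>. f (X \<omega>)) -` A \<inter> space M"
      "b = (\<lambda>\<omega>. g (Y \<omega>)) -` B \<inter> space M" by auto
    show "prob (a \<inter> b) = prob a * prob b"
      unfolding AB(3,4) fX gY
      using measurable_sets[OF f AB(1)] measurable_sets[OF g AB(2)]
      by (intro indep_setD[OF ind]; blast)
  qed auto
qed

definition jump_law :: "real measure \<Rightarrow> real measure" where
  "jump_law \<mu> = scale_measure (inverse (emeasure \<mu> UNIV)) \<mu>"

text \<open>The law of the jump sum up to time 1, written without reference to a process. It is the
  same under every \<open>P x\<close> and serves as increment law of the dominating walk.\<close>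

definition compound_poisson_law :: "real measure \<Rightarrow> real measure" where
  "compound_poisson_law \<mu> = distr (measure_pmf (poisson_pmf (measure \<mu> UNIV)) \<Otimes>\<^sub>M PiM UNIV (\<lambda>_::nat. jump_law \<mu>))
     borel (\<lambda>(n, v). \<Sum>i<n. v i)"

lemma nn_integral_poisson:
  assumes r: "0 < r"
  shows "(\<integral>\<^sup>+n. of_nat n \<partial>measure_pmf (poisson_pmf r)) = ennreal r"
proof -
  have exp: "(\<lambda>n. r ^ n / fact n) sums exp r" using exp_converges[of r] by (simp add: divide_inverse mult.commute)
  have eq: "r ^ Suc n / fact (Suc n) * exp (- r) * real (Suc n) = r * exp (- r) * (r ^ n / fact n)" for n
    by (simp add: field_simps del: of_nat_Suc)
  have "(\<lambda>n. r * exp (- r) * (r ^ n / fact n)) sums (r * exp (- r) * exp r)"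
    by (rule sums_mult[OF exp])
  moreover have "r * exp (- r) * exp r = r" by (simp add: exp_minus)
  ultimately have "(\<lambda>n. r ^ Suc n / fact (Suc n) * exp (- r) * real (Suc n)) sums r"
    unfolding eq by (simp only:)
  then have sums: "(\<lambda>n. r ^ n / fact n * exp (- r) * real n) sums r"
    by (subst (asm) sums_Suc_iff) simp
  have "(\<integral>\<^sup>+n. of_nat n \<partial>measure_pmf (poisson_pmf r))
      = (\<integral>\<^sup>+n. ennreal (r ^ n / fact n * exp (- r) * real n) \<partial>count_space UNIV)"
    using r by (subst nn_integral_measure_pmf)
      (auto simp: ennreal_of_nat_eq_real_of_nat mult_ac simp flip: ennreal_mult intro!: nn_integral_cong)
  also have "\<dots> = (\<Sum>n. ennreal (r ^ n / fact n * exp (- r) * real n))"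
    by (rule nn_integral_count_space_nat)
  also have "\<dots> = ennreal r"
    using r sums by (subst suminf_ennreal2) (auto simp: sums_iff)
  finally show ?thesis .
qed

section \<open>The law of the jump sum up to time 1\<close>

locale finite_jump_measure =
  fixes \<mu> :: "real measure"
  assumes sets_mu: "sets \<mu> = sets borel" and finite_mu: "finite_measure \<mu>"
    and mu_pos: "0 < measure \<mu> UNIV"
begin

abbreviation "q \<equiv> jump_law \<mu>"

lemma space_mu: "space \<mu> = UNIV" using sets_eq_imp_space_eq[OF sets_mu] by simp

lemma emeasure_mu: "emeasure \<mu> A = ennreal (measure \<mu> A)"
  by (rule finite_measure.emeasure_eq_measure[OF finite_mu])

lemma sets_q[simp, measurable_cong]: "sets q = sets borel" by (simp add: jump_law_def sets_mu)
lemma space_q[simp]: "space q = UNIV" using sets_eq_imp_space_eq[OF sets_q] by simp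

lemma emeasure_q: "emeasure q A = ennreal (1 / measure \<mu> UNIV) * emeasure \<mu> A"
  using mu_pos by (simp add: jump_law_def emeasure_mu[of UNIV] inverse_ennreal inverse_eq_divide)

lemma prob_space_q: "prob_space q"
  by (rule prob_spaceI) (use mu_pos in \<open>simp add: emeasure_q emeasure_mu ennreal_mult'[symmetric]\<close>)

lemma nn_integral_q:
  assumes [measurable]: "f \<in> borel_measurable borel"
  shows "(\<integral>\<^sup>+z. f z \<partial>q) = ennreal (1 / measure \<mu> UNIV) * (\<integral>\<^sup>+z. f z \<partial>\<mu>)"
proof -
  note [measurable_cong] = sets_mu
  have "f \<in> borel_measurable \<mu>" by measurable
  then show ?thesis using mu_pos
    by (simp add: jump_law_def nn_integral_scale_measure emeasure_mu[of UNIV] inverse_ennreal inverse_eq_divide)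
qed

sublocale q: sequence_space q
  by (intro sequence_space.intro product_prob_spaceI prob_space_q)

abbreviation "Q \<equiv> PiM UNIV (\<lambda>_::nat. q)"

lemma sum_measurable:
  "(\<lambda>(n, v). \<Sum>i<n. v i) \<in> borel_measurable (count_space UNIV \<Otimes>\<^sub>M Q)"
proof -
  have "(\<lambda>x. \<Sum>i<fst x. snd x i) \<in> borel_measurable (count_space (UNIV :: nat set) \<Otimes>\<^sub>M Q)"
    by (rule measurable_compose_countable[where f="\<lambda>n x. \<Sum>i<n. snd x i" and g=fst]) measurable
  then show ?thesis by (simp add: case_prod_beta)
qed

lemma sum_measurable':
  "(\<lambda>(n, v). \<Sum>i<n. v i) \<in> borel_measurable (measure_pmf (poisson_pmf (measure \<mu> UNIV)) \<Otimes>\<^sub>M Q)"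
  using sum_measurable measurable_cong_sets[OF sets_pair_measure_cong[OF sets_measure_pmf_count_space refl] refl]
  by blast

lemma real_sequence_space_law: "real_sequence_space (compound_poisson_law \<mu>)"
proof -
  interpret pq: pair_prob_space "measure_pmf (poisson_pmf (measure \<mu> UNIV))" Q ..
  have "prob_space (compound_poisson_law \<mu>)"
    unfolding compound_poisson_law_def by (rule pq.prob_space_distr[OF sum_measurable'])
  then interpret l: prob_space "compound_poisson_law \<mu>" .
  show ?thesis
    by unfold_locales (auto simp: compound_poisson_law_def l.emeasure_space_1)
qed

text \<open>Wald's computation with absolute values: the mean number of jumps,
  \<open>measure \<mu> UNIV\<close>, cancels the normalisation of the jump law and leaves the first
  absolute moment of \<open>\<mu>\<close>.\<close>

lemma law_mean:
  assumes m: "(\<integral>\<^sup>+z. ennreal \<bar>z\<bar> \<partial>\<mu>) \<le> ennreal m" and "0 \<le> m"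
  shows "integrable (compound_poisson_law \<mu>) (\<lambda>z. z)" "(\<integral>z. z \<partial>compound_poisson_law \<mu>) \<le> m"
proof -
  let ?p = "measure_pmf (poisson_pmf (measure \<mu> UNIV))"
  interpret pq: pair_prob_space ?p Q ..
  note meas = sum_measurable'
  define E where "E = (\<integral>\<^sup>+z. ennreal \<bar>z\<bar> \<partial>q)"
  have c: "(\<lambda>v. v i) \<in> Q \<rightarrow>\<^sub>M q" for i by (rule measurable_component_singleton) simp
  have a: "(\<lambda>z. ennreal \<bar>z\<bar>) \<in> borel_measurable q" by measurable
  have comp: "(\<integral>\<^sup>+v. ennreal \<bar>v i\<bar> \<partial>Q) = E" for i
  proof -
    have d: "distr Q q (\<lambda>v. v i) = q"
      using distr_PiM_component[of UNIV "\<lambda>_. q" i] prob_space_q by simp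
    have "E = (\<integral>\<^sup>+z. ennreal \<bar>z\<bar> \<partial>distr Q q (\<lambda>v. v i))" unfolding E_def d ..
    also have "\<dots> = (\<integral>\<^sup>+v. ennreal \<bar>v i\<bar> \<partial>Q)" by (rule nn_integral_distr[OF c]) simp
    finally show ?thesis by simp
  qed
  have "(\<integral>\<^sup>+z. ennreal \<bar>z\<bar> \<partial>compound_poisson_law \<mu>) = (\<integral>\<^sup>+x. ennreal \<bar>case x of (n, v) \<Rightarrow> \<Sum>i<n. v i\<bar> \<partial>(?p \<Otimes>\<^sub>M Q))"
    unfolding compound_poisson_law_def by (rule nn_integral_distr[OF meas]) simp
  also have "\<dots> = (\<integral>\<^sup>+n. \<integral>\<^sup>+v. ennreal \<bar>\<Sum>i<n. v i\<bar> \<partial>Q \<partial>?p)"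
  proof -
    have "(\<lambda>x. ennreal \<bar>case x of (n, v) \<Rightarrow> \<Sum>i<n. v i\<bar>) \<in> borel_measurable (?p \<Otimes>\<^sub>M Q)"
      by (rule measurable_compose[OF meas]) simp
    from q.P.nn_integral_fst[OF this] show ?thesis by simp
  qed
  also have "\<dots> \<le> (\<integral>\<^sup>+n. of_nat n * E \<partial>?p)"
  proof (rule nn_integral_mono)
    fix n
    have "(\<integral>\<^sup>+v. ennreal \<bar>\<Sum>i<n. v i\<bar> \<partial>Q) \<le> (\<integral>\<^sup>+v. (\<Sum>i<n. ennreal \<bar>v i\<bar>) \<partial>Q)"
    proof (rule nn_integral_mono)
      fix v :: "nat \<Rightarrow> real"
      have "ennreal \<bar>\<Sum>i<n. v i\<bar> \<le> ennreal (\<Sum>i<n. \<bar>v i\<bar>)" by (rule ennreal_leI[OF sum_abs])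
      also have "\<dots> = (\<Sum>i<n. ennreal \<bar>v i\<bar>)" by (rule sum_ennreal[symmetric]) simp
      finally show "ennreal \<bar>\<Sum>i<n. v i\<bar> \<le> (\<Sum>i<n. ennreal \<bar>v i\<bar>)" .
    qed
    also have "\<dots> = (\<Sum>i<n. \<integral>\<^sup>+v. ennreal \<bar>v i\<bar> \<partial>Q)"
      by (rule nn_integral_sum) (rule measurable_compose[OF c a])
    also have "\<dots> = of_nat n * E" by (simp add: comp)
    finally show "(\<integral>\<^sup>+v. ennreal \<bar>\<Sum>i<n. v i\<bar> \<partial>Q) \<le> of_nat n * E" .
  qed
  also have "\<dots> = ennreal (measure \<mu> UNIV) * E"
  proof -
    have "(\<integral>\<^sup>+n. of_nat n * E \<partial>?p) = (\<integral>\<^sup>+n. of_nat n \<partial>?p) * E" by (rule nn_integral_multc) simp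
    then show ?thesis by (simp only: nn_integral_poisson[OF mu_pos])
  qed
  also have "\<dots> = (\<integral>\<^sup>+z. ennreal \<bar>z\<bar> \<partial>\<mu>)"
  proof -
    have "E = ennreal (1 / measure \<mu> UNIV) * (\<integral>\<^sup>+z. ennreal \<bar>z\<bar> \<partial>\<mu>)"
      unfolding E_def by (rule nn_integral_q) simp
    moreover have "ennreal (measure \<mu> UNIV) * ennreal (1 / measure \<mu> UNIV) = 1"
      using mu_pos by (simp flip: ennreal_mult)
    ultimately show ?thesis by (metis mult.assoc mult_1)
  qed
  also have "\<dots> \<le> ennreal m" by fact
  finally have le: "(\<integral>\<^sup>+z. ennreal \<bar>z\<bar> \<partial>compound_poisson_law \<mu>) \<le> ennreal m" .
  have sets_l[measurable_cong]: "sets (compound_poisson_law \<mu>) = sets borel" by (simp add: compound_poisson_law_def)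
  show int: "integrable (compound_poisson_law \<mu>) (\<lambda>z. z)"
  proof (rule integrableI_bounded)
    show "(\<integral>\<^sup>+z. ennreal (norm z) \<partial>compound_poisson_law \<mu>) < \<infinity>"
      using le_less_trans[OF le ennreal_less_top] by simp
  qed measurable
  have int': "integrable (compound_poisson_law \<mu>) (\<lambda>z. \<bar>z\<bar>)" using int by (rule integrable_abs)
  have "(\<integral>z. z \<partial>compound_poisson_law \<mu>) \<le> (\<integral>z. \<bar>z\<bar> \<partial>compound_poisson_law \<mu>)"
    by (rule integral_mono[OF int int']) simp
  also have "(\<integral>z. \<bar>z\<bar> \<partial>compound_poisson_law \<mu>) \<le> m"
    using le nn_integral_eq_integral[OF int'] \<open>0 \<le> m\<close> by simp
  finally show "(\<integral>z. z \<partial>compound_poisson_law \<mu>) \<le> m" .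
qed

end

section \<open>Jump times and jump sizes of the process on the unit interval\<close>

locale compound_poisson = prob_space M + finite_jump_measure \<mu>
  for M :: "'a measure" and \<mu> :: "real measure" and N :: "real \<Rightarrow> 'a \<Rightarrow> nat" and \<xi> :: "nat \<Rightarrow> 'a \<Rightarrow> real" +
  assumes poisson: "poisson_process M (measure \<mu> UNIV) N"
    and xi_indep: "indep_vars (\<lambda>_. borel) \<xi> (UNIV :: nat set)"
    and xi_law: "distr M borel (\<xi> i) = jump_law \<mu>"
    and N_xi_indep: "indep_rv M (PiM {0..} (\<lambda>_. count_space UNIV)) (\<lambda>\<omega>. \<lambda>t\<in>{0..}. N t \<omega>)
          (PiM UNIV (\<lambda>_. borel)) (\<lambda>\<omega> i. \<xi> i \<omega>)"
begin

abbreviation "r \<equiv> measure \<mu> UNIV"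

lemma N_measurable: "0 \<le> t \<Longrightarrow> N t \<in> M \<rightarrow>\<^sub>M count_space UNIV"
  and AE_N_0: "AE \<omega> in M. N 0 \<omega> = 0"
  and AE_N_path: "AE \<omega> in M. mono_on {0..} (\<lambda>t. N t \<omega>) \<and> (\<forall>t\<ge>0. continuous (at_right t) (\<lambda>s. N s \<omega>))"
  using poisson by (auto simp: poisson_process_def)

lemma xi_measurable[measurable]: "\<xi> i \<in> borel_measurable M"
  using xi_indep by (auto simp: indep_vars_def)

lemma N_law:
  assumes "0 < t"
  shows "distr M (count_space UNIV) (N t) = measure_pmf (poisson_pmf (r * t))"
proof -
  have [measurable]: "N t \<in> M \<rightarrow>\<^sub>M count_space UNIV" "N 0 \<in> M \<rightarrow>\<^sub>M count_space UNIV"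
    using N_measurable assms by auto
  have "distr M (count_space UNIV) (N t) = distr M (count_space UNIV) (\<lambda>\<omega>. N t \<omega> - N 0 \<omega>)"
    by (rule distr_cong_AE) (use AE_N_0 in \<open>auto elim!: eventually_mono\<close>)
  also have "\<dots> = measure_pmf (poisson_pmf (r * (t - 0)))"
    using poisson assms unfolding poisson_process_def by blast
  finally show ?thesis by simp
qed

lemma prob_increment:
  assumes "0 \<le> s" "s < t"
  shows "prob {\<omega>\<in>space M. N t \<omega> - N s \<omega> = k} = (r * (t - s)) ^ k / fact k * exp (- (r * (t - s)))"
proof -
  have [measurable]: "N t \<in> M \<rightarrow>\<^sub>M count_space UNIV" "N s \<in> M \<rightarrow>\<^sub>M count_space UNIV"
    using N_measurable assms by auto
  have "prob {\<omega>\<in>space M. N t \<omega> - N s \<omega> = k} = measure (distr M (count_space UNIV) (\<lambda>\<omega>. N t \<omega> - N s \<omega>)) {k}"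
    by (subst measure_distr) (auto intro!: arg_cong[where f=prob])
  also have "distr M (count_space UNIV) (\<lambda>\<omega>. N t \<omega> - N s \<omega>) = measure_pmf (poisson_pmf (r * (t - s)))"
    using poisson assms unfolding poisson_process_def by blast
  finally show ?thesis using mu_pos assms by (simp add: measure_pmf_single)
qed

lemma prob_N:
  assumes "0 < t"
  shows "prob {\<omega>\<in>space M. N t \<omega> = k} = (r * t) ^ k / fact k * exp (- (r * t))"
proof -
  have [measurable]: "N t \<in> M \<rightarrow>\<^sub>M count_space UNIV" using N_measurable assms by auto
  have "prob {\<omega>\<in>space M. N t \<omega> = k} = measure (distr M (count_space UNIV) (N t)) {k}"
    by (subst measure_distr) (auto intro!: arg_cong[where f=prob])
  then show ?thesis using mu_pos assms by (simp add: N_law measure_pmf_single)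
qed

lemma xi_joint_law: "distr M (PiM UNIV (\<lambda>_. borel)) (\<lambda>\<omega> i. \<xi> i \<omega>) = Q"
  using indep_vars_iff_distr_eq_PiM[where I=UNIV and M'="\<lambda>_. borel" and X=\<xi>] xi_indep xi_law by (simp add: restrict_UNIV)

lemma distr_jump_sum: "distr M borel (\<lambda>\<omega>. \<Sum>i<N 1 \<omega>. \<xi> i \<omega>) = compound_poisson_law \<mu>"
proof -
  have "indep_rv M (count_space UNIV) (\<lambda>\<omega>. (\<lambda>t\<in>{0..}. N t \<omega>) 1) (PiM UNIV (\<lambda>_. borel)) (\<lambda>\<omega> i. \<xi> i \<omega>)"
    using indep_rv_compose[OF N_xi_indep, of "\<lambda>p. p 1" "count_space UNIV" "\<lambda>v. v" "PiM UNIV (\<lambda>_. borel)"]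
    by simp
  then have *: "distr M (count_space UNIV \<Otimes>\<^sub>M PiM UNIV (\<lambda>_. borel)) (\<lambda>\<omega>. (N 1 \<omega>, \<lambda>i. \<xi> i \<omega>))
      = distr M (count_space UNIV) (N 1) \<Otimes>\<^sub>M Q"
    using distr_Pair_indep_rv xi_joint_law by fastforce
  have sets_Q: "sets Q = sets (PiM UNIV (\<lambda>_. borel))" by (rule sets_PiM_cong) auto
  have [measurable]: "N 1 \<in> M \<rightarrow>\<^sub>M count_space UNIV" using N_measurable by simp
  have sum': "(\<lambda>(n, v). \<Sum>i<n. v i) \<in> borel_measurable (count_space (UNIV::nat set) \<Otimes>\<^sub>M PiM (UNIV::nat set) (\<lambda>_. borel :: real measure))"
    using sum_measurable measurable_cong_sets[OF sets_pair_measure_cong[OF refl sets_Q] refl] by blast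
  have "distr M borel (\<lambda>\<omega>. \<Sum>i<N 1 \<omega>. \<xi> i \<omega>)
     = distr (distr M (count_space UNIV \<Otimes>\<^sub>M PiM UNIV (\<lambda>_. borel)) (\<lambda>\<omega>. (N 1 \<omega>, \<lambda>i. \<xi> i \<omega>))) borel (\<lambda>(n, v). \<Sum>i<n. v i)"
    by (subst distr_distr[OF sum']) (auto simp: comp_def intro!: measurable_Pair measurable_PiM_single')
  also have "\<dots> = compound_poisson_law \<mu>"
    unfolding * compound_poisson_law_def using N_law[of 1] by simp
  finally show ?thesis .
qed

lemma AE_xi_nonneg:
  assumes "emeasure \<mu> {..<0} = 0"
  shows "AE \<omega> in M. \<forall>i. 0 \<le> \<xi> i \<omega>"
proof -
  have "AE \<omega> in M. 0 \<le> \<xi> i \<omega>" for i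
  proof -
    have "emeasure q {..<0} = 0" using assms by (simp add: emeasure_q)
    then have "{..<0} \<in> null_sets q" by (simp add: null_sets_def)
    then have "AE z in q. z \<notin> {..<0}" by (rule AE_not_in)
    then have "AE z in distr M borel (\<xi> i). 0 \<le> z" unfolding xi_law by (auto elim!: eventually_mono)
    then show ?thesis by (subst (asm) AE_distr_iff) auto
  qed
  then show ?thesis by (simp add: AE_all_countable)
qed

lemma first_jump_measurable[measurable]:
  "first_jump \<in> borel_measurable (PiM {0..} (\<lambda>_. count_space UNIV))"
  unfolding first_jump_def
proof (rule borel_measurable_cINF)
  show "countable (\<rat> \<inter> {0..1::real})" using countable_rat by blast
  show "bdd_below ((\<lambda>q. if 1 \<le> p q then q else 1) ` (\<rat> \<inter> {0..1}))" for p :: "real \<Rightarrow> nat"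
    by (intro bdd_belowI[of _ 0]) auto
  fix q :: real assume "q \<in> \<rat> \<inter> {0..1}"
  then have [measurable]: "(\<lambda>p. p q) \<in> PiM {0..} (\<lambda>_. count_space UNIV) \<rightarrow>\<^sub>M count_space (UNIV :: nat set)"
    by (intro measurable_component_singleton) auto
  show "(\<lambda>p. if 1 \<le> p q then q else 1) \<in> borel_measurable (PiM {0..} (\<lambda>_. count_space (UNIV :: nat set)))"
    by measurable
qed

text \<open>The value 2 encodes the event that the number of jumps up to time 1 is not exactly one.\<close>

definition jump_time :: "'a \<Rightarrow> real" where
  "jump_time \<omega> = (if N 1 \<omega> = 1 then first_jump (\<lambda>t. N t \<omega>) else 2)"

lemma first_jump_restrict: "first_jump (\<lambda>t\<in>{0..}. N t \<omega>) = first_jump (\<lambda>t. N t \<omega>)"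
  unfolding first_jump_def by (intro INF_cong) auto

lemma N_path_measurable: "(\<lambda>\<omega>. \<lambda>t\<in>{0..}. N t \<omega>) \<in> M \<rightarrow>\<^sub>M PiM {0..} (\<lambda>_. count_space UNIV)"
  using N_xi_indep by (simp add: indep_rv_def)

lemma jump_time_measurable[measurable]: "jump_time \<in> borel_measurable M"
proof -
  have [measurable]: "N 1 \<in> M \<rightarrow>\<^sub>M count_space UNIV" using N_measurable by simp
  have [measurable]: "(\<lambda>\<omega>. first_jump (\<lambda>t. N t \<omega>)) \<in> borel_measurable M"
    using measurable_compose[OF N_path_measurable first_jump_measurable] by (simp add: first_jump_restrict)
  show ?thesis unfolding jump_time_def[abs_def] by measurable
qed

lemma jump_time_le_1_iff: "jump_time \<omega> \<le> 1 \<longleftrightarrow> N 1 \<omega> = 1"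
  using first_jump_bounds by (auto simp: jump_time_def)

lemma jump_time_nonneg: "0 \<le> jump_time \<omega>"
  using first_jump_bounds by (auto simp: jump_time_def)

text \<open>The event means one jump up to time s and none between s and 1; independence of the two
  increments gives the product of \<open>r * s * exp (- (r * s))\<close> and
  \<open>exp (- (r * (1 - s)))\<close>. The endpoints are treated separately because the increment
  laws are given for intervals of positive length.\<close>

lemma prob_jump_time_le:
  assumes s: "0 \<le> s" "s \<le> 1"
  shows "prob {\<omega>\<in>space M. jump_time \<omega> \<le> s} = r * exp (- r) * s"
proof -
  have [measurable]: "N 1 \<in> M \<rightarrow>\<^sub>M count_space UNIV" "N s \<in> M \<rightarrow>\<^sub>M count_space UNIV" "N 0 \<in> M \<rightarrow>\<^sub>M count_space UNIV"
    using N_measurable s by auto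
  have AE: "AE \<omega> in M. jump_time \<omega> \<le> s \<longleftrightarrow> N 1 \<omega> = 1 \<and> 1 \<le> N s \<omega>"
    using AE_N_path
  proof eventually_elim
    case (elim \<omega>)
    show ?case
    proof (cases "N 1 \<omega> = 1")
      case True
      then show ?thesis using first_jump_le_iff[of "\<lambda>t. N t \<omega>" s] elim s by (simp add: jump_time_def)
    qed (use s in \<open>simp add: jump_time_def\<close>)
  qed
  consider "s = 0" | "s = 1" | "0 < s" "s < 1" using s by linarith
  then show ?thesis
  proof cases
    case 1
    have "prob {\<omega>\<in>space M. jump_time \<omega> \<le> s} = prob {}"
      by (rule finite_measure_eq_AE) (use AE AE_N_0 1 in \<open>auto elim!: eventually_elim2\<close>)
    then show ?thesis using 1 by simp
  next
    case 2
    have "prob {\<omega>\<in>space M. jump_time \<omega> \<le> s} = prob {\<omega>\<in>space M. N 1 \<omega> = 1}"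
      by (simp add: 2 jump_time_le_1_iff)
    then show ?thesis using 2 by (simp add: prob_N)
  next
    case 3
    define t :: "nat \<Rightarrow> real" where "t i = (if i = 0 then 0 else if i = 1 then s else 1)" for i
    have "mono t \<and> 0 \<le> t 0" using 3 by (auto simp: t_def mono_def)
    then have ind: "indep_vars (\<lambda>_. count_space UNIV) (\<lambda>i \<omega>. N (t (Suc i)) \<omega> - N (t i) \<omega>) {..<2}"
      using poisson unfolding poisson_process_def by blast
    define A :: "nat \<Rightarrow> nat set" where "A i = (if i = 0 then {1} else {0})" for i
    have two: "{..<2::nat} = {0, 1}" by auto
    have "prob (\<Inter>i\<in>{..<2}. (\<lambda>\<omega>. N (t (Suc i)) \<omega> - N (t i) \<omega>) -` A i \<inter> space M)
      = (\<Prod>i\<in>{..<2}. prob ((\<lambda>\<omega>. N (t (Suc i)) \<omega> - N (t i) \<omega>) -` A i \<inter> space M))"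
      by (rule indep_varsD[OF ind]) (auto simp: two)
    moreover have "(\<Inter>i\<in>{..<2}. (\<lambda>\<omega>. N (t (Suc i)) \<omega> - N (t i) \<omega>) -` A i \<inter> space M)
      = {\<omega>\<in>space M. N s \<omega> - N 0 \<omega> = 1 \<and> N 1 \<omega> - N s \<omega> = 0}"
      unfolding two by (auto simp: t_def A_def)
    moreover have "(\<Prod>i\<in>{..<2}. prob ((\<lambda>\<omega>. N (t (Suc i)) \<omega> - N (t i) \<omega>) -` A i \<inter> space M))
      = prob {\<omega>\<in>space M. N s \<omega> - N 0 \<omega> = 1} * prob {\<omega>\<in>space M. N 1 \<omega> - N s \<omega> = 0}"
      unfolding two by (auto simp: t_def A_def intro!: arg_cong2[where f="(*)"] arg_cong[where f=prob])
    ultimately have "prob {\<omega>\<in>space M. N s \<omega> - N 0 \<omega> = 1 \<and> N 1 \<omega> - N s \<omega> = 0}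
      = (r * s * exp (- (r * s))) * exp (- (r * (1 - s)))"
      using prob_increment[of 0 s 1] prob_increment[of s 1 0] 3 by simp
    also have "\<dots> = r * exp (- r) * s"
      by (simp add: mult_exp_exp algebra_simps)
    finally have "prob {\<omega>\<in>space M. N s \<omega> - N 0 \<omega> = 1 \<and> N 1 \<omega> - N s \<omega> = 0} = r * exp (- r) * s" .
    moreover have "prob {\<omega>\<in>space M. jump_time \<omega> \<le> s} = prob {\<omega>\<in>space M. N s \<omega> - N 0 \<omega> = 1 \<and> N 1 \<omega> - N s \<omega> = 0}"
    proof (rule finite_measure_eq_AE)
      show "AE \<omega> in M. (\<omega> \<in> {\<omega>\<in>space M. jump_time \<omega> \<le> s}) = (\<omega> \<in> {\<omega>\<in>space M. N s \<omega> - N 0 \<omega> = 1 \<and> N 1 \<omega> - N s \<omega> = 0})"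
        using AE AE_N_0 AE_N_path
      proof eventually_elim
        case (elim \<omega>)
        have "N s \<omega> \<le> N 1 \<omega>" using elim(3) s by (auto simp: mono_on_def)
        then show ?case using elim(1,2) by auto
      qed
    qed measurable
    ultimately show ?thesis by simp
  qed
qed

lemma nn_integral_jump_time:
  fixes f :: "real \<Rightarrow> ennreal"
  assumes f[measurable]: "f \<in> borel_measurable borel"
  shows "(\<integral>\<^sup>+\<omega>. f (jump_time \<omega>) * indicator {0..1} (jump_time \<omega>) \<partial>M)
    = ennreal (r * exp (- r)) * (\<integral>\<^sup>+s. f s * indicator {0..1} s \<partial>lborel)"
proof -
  let ?c = "ennreal (r * exp (- r))"
  \<comment> \<open>Reflecting time turns the known events
    \<open>jump_time \<omega> \<le> 1 - s\<close> into the final segments \<open>{s..1}\<close> on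
    which the substitution rule is based. The code value 2 is sent to -1, outside
    \<open>{0..1}\<close>.\<close>
  let ?m = "distr M borel (\<lambda>\<omega>. 1 - jump_time \<omega>)"
  have c: "emeasure (density lborel (\<lambda>_. ?c)) {0..s} = ennreal (r * exp (- r) * s)" if "0 \<le> s" for s
    using that mu_pos by (subst emeasure_density) (auto simp: nn_integral_cmult ennreal_mult' mult_nonneg_nonneg)
  have m: "emeasure ?m {s..1} = ennreal (r * exp (- r) * (1 - s))" if "0 \<le> s" "s \<le> 1" for s
  proof -
    have "(\<lambda>\<omega>. 1 - jump_time \<omega>) -` {s..1} \<inter> space M = {\<omega>\<in>space M. jump_time \<omega> \<le> 1 - s}"
      using jump_time_nonneg by auto
    then show ?thesis
      using prob_jump_time_le[of "1 - s"] that by (subst emeasure_distr) (auto simp: emeasure_eq_measure)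
  qed
  have "(\<integral>\<^sup>+\<omega>. f (jump_time \<omega>) * indicator {0..1} (jump_time \<omega>) \<partial>M)
    = (\<integral>\<^sup>+s. f (1 - s) * indicator {0..1} s \<partial>?m)"
    by (subst nn_integral_distr) (auto intro!: nn_integral_cong simp: indicator_def)
  also have "\<dots> = (\<integral>\<^sup>+y. f y * indicator {1 - 1..1 - 0} y \<partial>density lborel (\<lambda>_. ?c))"
  proof (rule nn_integral_decreasing_substitution[where u="\<lambda>s. 1 - s"])
    show "emeasure ?m {0..1} < \<infinity>" by (simp add: m)
    show "emeasure ?m {s..1} = emeasure (density lborel (\<lambda>_. ?c)) {1 - 1..1 - s}" if "0 \<le> s" "s \<le> 1" for s
      using m[OF that] c[of "1 - s"] that by simp
    show "continuous_on {0..1} (\<lambda>s::real. 1 - s)" by (intro continuous_intros)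
  qed simp_all
  also have "\<dots> = ?c * (\<integral>\<^sup>+s. f s * indicator {0..1} s \<partial>lborel)"
    using mu_pos by (subst nn_integral_density) (auto simp: nn_integral_cmult mult.assoc)
  finally show ?thesis .
qed

text \<open>\<open>jump_time\<close> is a functional of the counting path, hence independent of the
  size of the first jump, so the joint law is a product; the jump time has constant density
  \<open>r * exp (- r)\<close> on \<open>{0..1}\<close>.\<close>

lemma emeasure_one_jump:
  assumes E[measurable]: "E \<in> sets (borel \<Otimes>\<^sub>M borel)" and sub: "E \<subseteq> {0..1} \<times> UNIV"
  shows "emeasure M {\<omega>\<in>space M. (jump_time \<omega>, \<xi> 0 \<omega>) \<in> E}
    = ennreal (r * exp (- r)) * (\<integral>\<^sup>+s. emeasure q (Pair s -` E) * indicator {0..1} s \<partial>lborel)"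
proof -
  have 1: "(\<lambda>p :: real \<Rightarrow> nat. p 1) \<in> PiM {0..} (\<lambda>_. count_space UNIV) \<rightarrow>\<^sub>M count_space (UNIV :: nat set)"
    by (intro measurable_component_singleton) auto
  note [measurable] = 1
  have "(\<lambda>p. if p 1 = 1 then first_jump p else 2) \<in> borel_measurable (PiM {0..} (\<lambda>_. count_space (UNIV :: nat set)))"
    by measurable
  from indep_rv_compose[OF N_xi_indep this, of "\<lambda>v. v 0" borel]
  have "indep_rv M borel jump_time borel (\<xi> 0)"
    unfolding first_jump_restrict by (simp add: jump_time_def[abs_def])
  then have *: "distr M (borel \<Otimes>\<^sub>M borel) (\<lambda>\<omega>. (jump_time \<omega>, \<xi> 0 \<omega>)) = distr M borel jump_time \<Otimes>\<^sub>M q"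
    using distr_Pair_indep_rv xi_law by fastforce
  have [measurable]: "(\<lambda>s. emeasure q (Pair s -` E)) \<in> borel_measurable borel"
    by (rule q.M.measurable_emeasure_Pair) (simp cong: sets_pair_measure_cong)
  have E': "E \<in> sets (distr M borel jump_time \<Otimes>\<^sub>M q)" by (simp cong: sets_pair_measure_cong)
  have "emeasure M {\<omega>\<in>space M. (jump_time \<omega>, \<xi> 0 \<omega>) \<in> E}
    = emeasure (distr M (borel \<Otimes>\<^sub>M borel) (\<lambda>\<omega>. (jump_time \<omega>, \<xi> 0 \<omega>))) E"
    by (subst emeasure_distr) (auto intro!: arg_cong[where f="emeasure M"])
  also have "\<dots> = (\<integral>\<^sup>+s. emeasure q (Pair s -` E) \<partial>distr M borel jump_time)"
    unfolding * by (rule q.M.emeasure_pair_measure_alt[OF E'])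
  also have "\<dots> = (\<integral>\<^sup>+s. emeasure q (Pair s -` E) * indicator {0..1} s \<partial>distr M borel jump_time)"
  proof (rule nn_integral_cong)
    fix s
    have "Pair s -` E = {}" if "s \<notin> {0..1}" using sub that by auto
    then show "emeasure q (Pair s -` E) = emeasure q (Pair s -` E) * indicator {0..1} s"
      by (auto split: split_indicator)
  qed
  also have "\<dots> = (\<integral>\<^sup>+\<omega>. emeasure q (Pair (jump_time \<omega>) -` E) * indicator {0..1} (jump_time \<omega>) \<partial>M)"
    by (rule nn_integral_distr) measurable
  also have "\<dots> = ennreal (r * exp (- r)) * (\<integral>\<^sup>+s. emeasure q (Pair s -` E) * indicator {0..1} s \<partial>lborel)"
    by (rule nn_integral_jump_time) measurable
  finally show ?thesis .
qed

end

section \<open>The drift coefficient\<close>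

text \<open>Outside the support every point has an open null neighbourhood; by the Lindelof property
  countably many such null sets cover \<open>U\<close>.\<close>

lemma null_set_outside_support:
  assumes sets: "sets \<mu> = sets borel" and "open U" "U \<inter> measure_support \<mu> = {}"
  shows "emeasure \<mu> U = 0"
proof -
  define \<F> where "\<F> = {V. open V \<and> emeasure \<mu> V = 0}"
  obtain \<G> where \<G>: "\<G> \<subseteq> \<F>" "countable \<G>" "\<Union>\<G> = \<Union>\<F>"
    using Lindelof[of \<F>] by (auto simp: \<F>_def)
  have "\<Union>\<G> \<in> null_sets \<mu>"
  proof (rule null_sets_UN'[where N="\<lambda>V. V" and I=\<G>, simplified])
    show "countable \<G>" by fact
    fix V assume "V \<in> \<G>"
    then show "V \<in> null_sets \<mu>" using \<G>(1) by (auto simp: \<F>_def null_sets_def sets)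
  qed
  moreover have "U \<subseteq> \<Union>\<G>"
  proof
    fix x assume "x \<in> U"
    then have "x \<notin> measure_support \<mu>" using assms by auto
    then obtain V where "open V" "x \<in> V" "emeasure \<mu> V = 0"
      by (auto simp: measure_support_def not_less)
    then show "x \<in> \<Union>\<G>" unfolding \<G>(3) by (auto simp: \<F>_def)
  qed
  ultimately have "emeasure \<mu> U \<le> 0"
    using emeasure_mono[of U "\<Union>\<G>" \<mu>] by (simp add: null_sets_def)
  then show ?thesis by simp
qed

lemma layer_cake_tail:
  assumes sets: "sets \<mu> = sets (borel :: real measure)" and "finite_measure \<mu>"
  shows "(\<integral>\<^sup>+z. ennreal z \<partial>\<mu>) = (\<integral>\<^sup>+u. emeasure \<mu> {u<..} * indicator {0..} u \<partial>lborel)"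
proof -
  interpret finite_measure \<mu> by fact
  interpret pair_sigma_finite \<mu> lborel ..
  note [measurable_cong] = sets
  have "(\<integral>\<^sup>+z. ennreal z \<partial>\<mu>) = (\<integral>\<^sup>+z. (\<integral>\<^sup>+u. indicator {(z, u). 0 \<le> u \<and> u < z} (z, u) \<partial>lborel) \<partial>\<mu>)"
  proof (rule nn_integral_cong)
    fix z :: real
    have "(\<integral>\<^sup>+u. indicator {(z, u). 0 \<le> u \<and> u < z} (z, u) \<partial>lborel) = (\<integral>\<^sup>+u. indicator {0..<z} u \<partial>lborel)"
      by (intro nn_integral_cong) (auto split: split_indicator)
    then show "ennreal z = (\<integral>\<^sup>+u. indicator {(z, u). 0 \<le> u \<and> u < z} (z, u) \<partial>lborel)"
      by (cases "0 \<le> z") (auto simp: ennreal_neg)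
  qed
  also have "\<dots> = (\<integral>\<^sup>+u. (\<integral>\<^sup>+z. indicator {(z, u). 0 \<le> u \<and> u < z} (z, u) \<partial>\<mu>) \<partial>lborel)"
  proof (rule Fubini'[symmetric])
    have "{w\<in>space (\<mu> \<Otimes>\<^sub>M lborel). 0 \<le> snd w \<and> snd w < fst w} \<in> sets (\<mu> \<Otimes>\<^sub>M lborel)" by measurable
    moreover have "{w\<in>space (\<mu> \<Otimes>\<^sub>M lborel). 0 \<le> snd w \<and> snd w < fst w} = {(z, u). 0 \<le> u \<and> u < z}"
      using sets_eq_imp_space_eq[OF sets] by (auto simp: space_pair_measure)
    ultimately show "(\<lambda>(z, u). indicator {(z, u). 0 \<le> u \<and> u < z} (z, u)) \<in> borel_measurable (\<mu> \<Otimes>\<^sub>M lborel)"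
      by simp
  qed
  also have "\<dots> = (\<integral>\<^sup>+u. emeasure \<mu> {u<..} * indicator {0..} u \<partial>lborel)"
  proof (rule nn_integral_cong)
    fix u :: real
    have "(\<integral>\<^sup>+z. indicator {(z, u). 0 \<le> u \<and> u < z} (z, u) \<partial>\<mu>) = (\<integral>\<^sup>+z. indicator {u<..} z * indicator {0..} u \<partial>\<mu>)"
      by (intro nn_integral_cong) (auto split: split_indicator)
    then show "(\<integral>\<^sup>+z. indicator {(z, u). 0 \<le> u \<and> u < z} (z, u) \<partial>\<mu>) = emeasure \<mu> {u<..} * indicator {0..} u"
      by (simp add: nn_integral_multc sets)
  qed
  finally show ?thesis .
qed

locale drift_setting = finite_jump_measure \<mu> for \<mu> :: "real measure" +
  fixes \<pi> :: "real \<Rightarrow> real" and C C' \<alpha> :: real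
  assumes pi_prob: "prob_space (density (restrict_space lborel {0<..}) (\<lambda>x. ennreal (\<pi> x)))"
    and pi_pos: "0 < x \<Longrightarrow> 0 < \<pi> x"
    and pi_loc: "L1_loc {0<..} \<pi>"
    and consts_pos: "0 < C" "0 < C'" "0 < \<alpha>"
    and pi_tail: "((\<lambda>x. \<pi> x * exp (\<alpha> * x)) \<longlongrightarrow> C) at_top"
    and pi_zero: "\<forall>\<^sub>F x in at_right 0. (LINT z:{0<..<x}|lborel. \<pi> z) \<le> C' * \<pi> x * x"
    and mu_neg: "emeasure \<mu> {..<0} = 0"
    and tail_pos: "0 < measure \<mu> {b<..}"
    and moment: "(\<integral>\<^sup>+z. ennreal z \<partial>\<mu>) < \<infinity>"
begin

section \<open>Bounds for the convolution and for the speed of the drift\<close>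

abbreviation "pi0 \<equiv> zero_ext \<pi>"
abbreviation "cv \<equiv> fun_convolution (signed_tail \<mu>) pi0"
abbreviation "lam \<equiv> measure \<mu> UNIV"

interpretation mu: finite_measure \<mu> by (rule finite_mu)

text \<open>Measurability is extracted from local integrability: \<open>pi0\<close> is the pointwise
  limit of the truncations of \<open>\<pi>\<close> to compact intervals exhausting the open
  half-line.\<close>

lemma pi0_measurable[measurable]: "pi0 \<in> borel_measurable borel"
proof (rule borel_measurable_LIMSEQ_real)
  let ?K = "\<lambda>n::nat. {1 / real (Suc n)..real (Suc n)}"
  show "(\<lambda>x. indicator (?K n) x *\<^sub>R \<pi> x) \<in> borel_measurable borel" for n
  proof -
    have "compact (?K n)" "?K n \<subseteq> {0<..}" by (auto intro: less_le_trans[rotated])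
    then have "set_integrable lborel (?K n) \<pi>" using pi_loc by (auto simp: L1_loc_def)
    then show ?thesis by (auto simp: set_integrable_def)
  qed
  show "(\<lambda>n. indicator (?K n) x *\<^sub>R \<pi> x) \<longlonglongrightarrow> pi0 x" for x
  proof (cases "0 < x")
    case True
    obtain n where n: "max x (1 / x) \<le> real n" using real_arch_simple by blast
    have "indicator (?K m) x *\<^sub>R \<pi> x = pi0 x" if "m \<ge> n" for m
    proof -
      have "1 / x \<le> real (Suc m)" "x \<le> real (Suc m)" using n that by auto
      then have "1 / real (Suc m) \<le> x" using True by (simp add: field_simps)
      then show ?thesis using True \<open>x \<le> real (Suc m)\<close> by (simp add: zero_ext_def)
    qed
    then show ?thesis by (intro tendsto_eventually eventually_sequentiallyI[of n])
  next
    case False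
    have "x \<notin> ?K n" for n
    proof -
      have "0 < 1 / real (Suc n)" by simp
      then show ?thesis using False unfolding atLeastAtMost_iff by linarith
    qed
    then show ?thesis using False by (simp add: zero_ext_def)
  qed
qed

lemma pi0_nonneg: "0 \<le> pi0 x"
  using pi_pos by (simp add: zero_ext_def less_imp_le)

lemma pi0_integrable: "integrable lborel pi0"
proof (rule integrableI_nonneg)
  have eq: "(\<lambda>x. ennreal (\<pi> x)) \<in> borel_measurable (restrict_space lborel {0<..})"
  proof -
    have "(\<lambda>x. ennreal (pi0 x)) \<in> borel_measurable (restrict_space lborel {0<..})"
      by (rule measurable_restrict_space1) measurable
    then show ?thesis
      by (rule measurable_cong[THEN iffD1, rotated]) (simp add: zero_ext_def space_restrict_space)
  qed
  have "(\<integral>\<^sup>+x. ennreal (pi0 x) \<partial>lborel) = (\<integral>\<^sup>+x. ennreal (\<pi> x) * indicator {0<..} x \<partial>lborel)"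
    by (intro nn_integral_cong) (auto simp: zero_ext_def)
  also have "\<dots> = (\<integral>\<^sup>+x. ennreal (\<pi> x) \<partial>restrict_space lborel {0<..})"
    by (subst nn_integral_restrict_space) auto
  also have "\<dots> = emeasure (density (restrict_space lborel {0<..}) (\<lambda>x. ennreal (\<pi> x))) (space (density (restrict_space lborel {0<..}) (\<lambda>x. ennreal (\<pi> x))))"
    unfolding space_density emeasure_density[OF eq sets.top] by (intro nn_integral_cong) simp
  also have "\<dots> = 1" by (rule prob_space.emeasure_space_1[OF pi_prob])
  finally show "(\<integral>\<^sup>+x. ennreal (pi0 x) \<partial>lborel) < \<infinity>" by simp
qed (auto simp: pi0_nonneg)

lemma tail_anti: "a \<le> b \<Longrightarrow> measure \<mu> {b<..} \<le> measure \<mu> {a<..}"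
  by (rule mu.finite_measure_mono) (auto simp: sets_mu)

lemma signed_tail_measurable[measurable]: "signed_tail \<mu> \<in> borel_measurable borel"
proof -
  have "mono (\<lambda>x. - measure \<mu> {x<..})" by (auto simp: mono_def tail_anti)
  then have "(\<lambda>x. - measure \<mu> {x<..}) \<in> borel_measurable borel" by (rule borel_measurable_mono)
  then have [measurable]: "(\<lambda>x. measure \<mu> {x<..}) \<in> borel_measurable borel"
    by (subst (asm) borel_measurable_uminus_eq)
  show ?thesis unfolding signed_tail_def[abs_def] by measurable
qed

lemma signed_tail_bounds: "0 \<le> signed_tail \<mu> x" "signed_tail \<mu> x \<le> lam"
  using mu.bounded_measure[of "{x<..}"] space_mu by (auto simp: signed_tail_def)

lemma cv_integrable: "integrable lborel (\<lambda>z. signed_tail \<mu> (x - z) * pi0 z)"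
proof (rule Bochner_Integration.integrable_bound)
  show "integrable lborel (\<lambda>z. lam * pi0 z)" using pi0_integrable by simp
  show "AE z in lborel. norm (signed_tail \<mu> (x - z) * pi0 z) \<le> norm (lam * pi0 z)"
    using signed_tail_bounds pi0_nonneg by (auto simp: abs_mult intro!: mult_right_mono)
qed measurable

lemma cv_measurable[measurable]: "cv \<in> borel_measurable borel"
proof -
  have "(\<lambda>x. \<integral>z. signed_tail \<mu> (x - z) * pi0 z \<partial>lborel) \<in> borel_measurable borel"
    by (rule lborel.borel_measurable_lebesgue_integral) measurable
  then show ?thesis by (simp add: fun_convolution_def[abs_def])
qed

lemma integral_pi_pos:
  assumes "0 < a"
  shows "0 < (LINT z:{0<..<a}|lborel. \<pi> z)"
proof -
  have eq: "indicator {0<..<a} z *\<^sub>R \<pi> z = indicator {0<..<a} z * pi0 z" for z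
    by (auto simp: zero_ext_def indicator_def)
  have i: "integrable lborel (\<lambda>z. indicator {0<..<a} z * pi0 z)"
    using integrable_mult_indicator[OF _ pi0_integrable, of "{0<..<a}"] by simp
  have "0 \<le> (\<integral>z. indicator {0<..<a} z * pi0 z \<partial>lborel)"
    by (intro integral_nonneg_AE AE_I2) (simp add: pi0_nonneg)
  moreover have "(\<integral>z. indicator {0<..<a} z * pi0 z \<partial>lborel) \<noteq> 0"
  proof
    assume "(\<integral>z. indicator {0<..<a} z * pi0 z \<partial>lborel) = 0"
    then have "AE z in lborel. indicator {0<..<a} z * pi0 z = 0"
      using i by (subst (asm) integral_nonneg_eq_0_iff_AE) (auto simp: pi0_nonneg)
    then have "AE z in lborel. z \<notin> {0<..<a}"
    proof eventually_elim
      case (elim z)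
      show ?case
      proof
        assume "z \<in> {0<..<a}"
        then show False using elim pi_pos[of z] by (simp add: zero_ext_def)
      qed
    qed
    then have "{0<..<a} \<in> null_sets lborel" by (subst AE_iff_null_sets) auto
    then show False using assms by (simp add: null_sets_def)
  qed
  ultimately show ?thesis unfolding set_lebesgue_integral_def eq by simp
qed

text \<open>Only the mass of \<open>\<pi>\<close> below \<open>a\<close> is kept; from there a jump
  longer than \<open>b\<close> certainly passes x. The bound is uniform for x in
  \<open>{a..b}\<close> and makes the reciprocal speed integrable on compact intervals away from
  0.\<close>

lemma cv_ge:
  assumes "0 < a" "a \<le> x" "x \<le> b"
  shows "measure \<mu> {b<..} * (LINT z:{0<..<a}|lborel. \<pi> z) \<le> cv x"
proof -
  have "measure \<mu> {b<..} * (LINT z:{0<..<a}|lborel. \<pi> z) = (\<integral>z. measure \<mu> {b<..} * (indicator {0<..<a} z * pi0 z) \<partial>lborel)"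
    unfolding set_lebesgue_integral_def by (subst integral_mult_right_zero[symmetric])
      (auto intro!: Bochner_Integration.integral_cong simp: zero_ext_def indicator_def)
  also have "\<dots> \<le> cv x" unfolding fun_convolution_def
  proof (rule integral_mono)
    show "integrable lborel (\<lambda>z. measure \<mu> {b<..} * (indicator {0<..<a} z * pi0 z))"
      using integrable_mult_indicator[OF _ pi0_integrable, of "{0<..<a}"] by simp
    fix z :: real
    show "measure \<mu> {b<..} * (indicator {0<..<a} z * pi0 z) \<le> signed_tail \<mu> (x - z) * pi0 z"
    proof (cases "z \<in> {0<..<a}")
      case True
      then have "measure \<mu> {b<..} \<le> signed_tail \<mu> (x - z)"
        using assms by (auto simp: signed_tail_def intro: tail_anti)
      then show ?thesis using True pi0_nonneg by (simp add: mult_right_mono)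
    qed (simp add: signed_tail_bounds pi0_nonneg)
  qed (rule cv_integrable)
  finally show ?thesis .
qed

lemma cv_pos: "0 < x \<Longrightarrow> 0 < cv x"
  using cv_ge[of x x x] mult_pos_pos[OF tail_pos integral_pi_pos, of x x] by simp

lemma cv_le: "cv x \<le> lam * (LINT z:{0<..<x}|lborel. \<pi> z)"
proof -
  have i: "integrable lborel (\<lambda>z. lam * (indicator {0<..<x} z * pi0 z))"
    using integrable_mult_indicator[OF _ pi0_integrable, of "{0<..<x}"] by simp
  have "cv x \<le> (\<integral>z. lam * (indicator {0<..<x} z * pi0 z) \<partial>lborel)"
    unfolding fun_convolution_def
  proof (rule integral_mono[OF cv_integrable i])
    fix z :: real
    show "signed_tail \<mu> (x - z) * pi0 z \<le> lam * (indicator {0<..<x} z * pi0 z)"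
      using signed_tail_bounds(2)[of "x - z"] pi0_nonneg[of z]
      by (auto simp: signed_tail_def zero_ext_def indicator_def intro!: mult_right_mono)
  qed
  also have "\<dots> = lam * (LINT z:{0<..<x}|lborel. \<pi> z)"
    unfolding set_lebesgue_integral_def by (subst integral_mult_right_zero)
      (auto intro!: Bochner_Integration.integral_cong simp: zero_ext_def indicator_def)
  finally show ?thesis .
qed

text \<open>Reciprocal of the downward speed; the value 1 off the state space keeps it positive
  everywhere.\<close>

definition slowness :: "real \<Rightarrow> real" where "slowness x = (if 0 < x then pi0 x / cv x else 1)"

lemma drift_slowness: "0 < y \<Longrightarrow> drift \<mu> \<pi> y = - 1 / slowness y"
  by (simp add: drift_def slowness_def zero_ext_def)

lemma slowness_measurable[measurable]: "slowness \<in> borel_measurable borel"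
  unfolding slowness_def[abs_def] by measurable

lemma slowness_pos: "0 < slowness x"
  using cv_pos pi_pos by (simp add: slowness_def zero_ext_def)

lemma slowness_int:
  assumes "0 < a"
  shows "set_integrable lborel {a..b} slowness"
proof (cases "a \<le> b")
  case True
  define k where "k = measure \<mu> {b<..} * (LINT z:{0<..<a}|lborel. \<pi> z)"
  have k: "0 < k" unfolding k_def by (rule mult_pos_pos[OF tail_pos integral_pi_pos[OF assms]])
  show ?thesis unfolding set_integrable_def
  proof (rule Bochner_Integration.integrable_bound)
    show "integrable lborel (\<lambda>x. pi0 x / k)" using pi0_integrable by simp
    have "\<bar>indicator {a..b} x * slowness x\<bar> \<le> \<bar>pi0 x / k\<bar>" for x
    proof (cases "x \<in> {a..b}")
      case True
      then have "k \<le> cv x" unfolding k_def by (intro cv_ge) (use assms in auto)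
      then have "pi0 x / cv x \<le> pi0 x / k" using k pi0_nonneg by (intro divide_left_mono) (auto intro: mult_pos_pos)
      then show ?thesis using True assms pi0_nonneg[of x] k cv_pos[of x] by (simp add: slowness_def)
    qed simp
    then show "AE x in lborel. norm (indicator {a..b} x *\<^sub>R slowness x) \<le> norm (pi0 x / k)" by simp
  qed measurable
qed (simp add: set_integrable_def)

text \<open>This is the use of the condition on \<open>\<pi>\<close> near 0: it bounds
  \<open>cv x\<close> by \<open>lam * C' * \<pi> x * x\<close>, so the slowness is at least
  \<open>1 / (k * x)\<close> there, and the logarithmic divergence of that integral makes the travel
  time to 0 infinite.\<close>

lemma slowness_zero:
  assumes b: "0 < b"
  shows "\<exists>a>0. a \<le> b \<and> t \<le> (LINT y:{a..b}|lborel. slowness y)"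
proof -
  obtain x0 where x0: "x0 > 0" "\<And>x. 0 < x \<Longrightarrow> x < x0 \<Longrightarrow> (LINT z:{0<..<x}|lborel. \<pi> z) \<le> C' * \<pi> x * x"
    using pi_zero unfolding eventually_at_right_field by auto
  define k where "k = lam * C'"
  have k: "0 < k" using mu_pos consts_pos by (simp add: k_def)
  have slowness_ge: "1 / (k * x) \<le> slowness x" if "0 < x" "x < x0" for x
  proof -
    have "cv x \<le> lam * (C' * \<pi> x * x)"
      using cv_le[of x] x0(2)[OF that] mu_pos by (meson mult_left_mono less_imp_le order_trans)
    then have "\<pi> x / (lam * (C' * \<pi> x * x)) \<le> \<pi> x / cv x"
      using cv_pos[OF that(1)] pi_pos[OF that(1)] by (intro divide_left_mono) (auto intro!: mult_pos_pos simp: mu_pos consts_pos that)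
    moreover have "\<pi> x / (lam * (C' * \<pi> x * x)) = 1 / (k * x)"
      using pi_pos[OF that(1)] by (simp add: k_def)
    ultimately show ?thesis using that by (simp add: slowness_def zero_ext_def)
  qed
  define b' where "b' = min b (x0 / 2)"
  have b': "0 < b'" "b' \<le> b" "b' < x0" using b x0(1) by (auto simp: b'_def)
  \<comment> \<open>Chosen so that the integral of \<open>1 / (k * x)\<close> over
    \<open>{a..b'}\<close>, which is \<open>(ln b' - ln a) / k\<close>, equals
    \<open>\<bar>t\<bar>\<close>.\<close>
  define a where "a = b' * exp (- (k * \<bar>t\<bar>))"
  have a: "0 < a" "a \<le> b'" using b' k by (auto simp: a_def mult_le_cancel_left1)
  have deriv: "((\<lambda>x. ln x / k) has_real_derivative 1 / (k * x)) (at x)" if "0 < x" for x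
    using that k by (auto intro!: derivative_eq_intros)
  have cont: "continuous_on {a..b'} (\<lambda>x. 1 / (k * x))"
    using a k by (intro continuous_intros) auto
  have "(\<integral>x. indicator {a..b'} x *\<^sub>R (1 / (k * x)) \<partial>lborel) = ln b' / k - ln a / k"
  proof (rule integral_FTC_Icc)
    show "((\<lambda>x. ln x / k) has_vector_derivative 1 / (k * x)) (at x within {a..b'})" if "a \<le> x" "x \<le> b'" for x
      using deriv[of x] that a by (auto simp: has_real_derivative_iff_has_vector_derivative intro: has_vector_derivative_at_within)
  qed (use a cont in auto)
  also have "ln a = ln b' - k * \<bar>t\<bar>" using b' by (simp add: a_def ln_mult)
  finally have "\<bar>t\<bar> = (LINT x:{a..b'}|lborel. 1 / (k * x))"
    using k by (simp add: set_lebesgue_integral_def field_simps)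
  also have "\<dots> \<le> (LINT x:{a..b'}|lborel. slowness x)"
  proof (rule set_integral_mono)
    show "set_integrable lborel {a..b'} (\<lambda>x. 1 / (k * x))" by (rule borel_integrable_atLeastAtMost'[OF cont])
    show "set_integrable lborel {a..b'} slowness" by (rule slowness_int[OF a(1)])
  qed (use slowness_ge a b' in auto)
  also have "\<dots> \<le> (LINT x:{a..b}|lborel. slowness x)"
    unfolding set_lebesgue_integral_def
  proof (rule integral_mono)
    show "integrable lborel (\<lambda>x. indicator {a..b'} x *\<^sub>R slowness x)" "integrable lborel (\<lambda>x. indicator {a..b} x *\<^sub>R slowness x)"
      using slowness_int[OF a(1)] by (auto simp: set_integrable_def)
    show "indicator {a..b'} x *\<^sub>R slowness x \<le> indicator {a..b} x *\<^sub>R slowness x" for x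
      using slowness_pos[of x] b' by (auto simp: indicator_def)
  qed
  finally show ?thesis using a b' by (intro exI[of _ a]) auto
qed

sublocale travel_density slowness
  by unfold_locales (use slowness_measurable slowness_pos slowness_int slowness_zero in auto)

definition mean :: real where "mean = enn2real (\<integral>\<^sup>+z. ennreal z \<partial>\<mu>)"

lemma ennreal_mean: "ennreal mean = (\<integral>\<^sup>+z. ennreal z \<partial>\<mu>)"
  using moment by (simp add: mean_def)

lemma mean_nonneg: "0 \<le> mean" by (simp add: mean_def)

lemma abs_mean: "(\<integral>\<^sup>+z. ennreal \<bar>z\<bar> \<partial>\<mu>) = ennreal mean"
proof -
  have "{..<0} \<in> null_sets \<mu>" using mu_neg by (simp add: null_sets_def sets_mu)
  then have "AE z in \<mu>. z \<notin> {..<0}" by (rule AE_not_in)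
  then have "(\<integral>\<^sup>+z. ennreal \<bar>z\<bar> \<partial>\<mu>) = (\<integral>\<^sup>+z. ennreal z \<partial>\<mu>)"
    by (intro nn_integral_cong_AE) (auto elim!: eventually_mono)
  then show ?thesis by (simp add: ennreal_mean)
qed

text \<open>Since \<open>\<pi>\<close> decays like \<open>e\<^bsup>-\<alpha>x\<^esup>\<close>, for large \<open>x\<close> the speed of the downward drift
  exceeds every number below the integral of \<open>\<mu>((u,\<infinity>)) e\<^bsup>\<alpha>u\<^esup>\<close>, which is larger than the
  mean jump rate, the integral of \<open>\<mu>((u,\<infinity>))\<close>.\<close>

lemma exponential_tail_exceeds_mean:
  "\<exists>R::nat. ennreal mean < (\<integral>\<^sup>+u. ennreal (signed_tail \<mu> u * exp (\<alpha> * u)) * indicator {0..real R} u \<partial>lborel)"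
proof -
  let ?f = "\<lambda>u. ennreal (signed_tail \<mu> u * exp (\<alpha> * u))"
  have mean_eq: "ennreal mean = (\<integral>\<^sup>+u. ennreal (signed_tail \<mu> u) \<partial>lborel)"
  proof -
    have "ennreal mean = (\<integral>\<^sup>+u. emeasure \<mu> {u<..} * indicator {0..} u \<partial>lborel)"
      unfolding ennreal_mean by (rule layer_cake_tail[OF sets_mu finite_mu])
    also have "\<dots> = (\<integral>\<^sup>+u. ennreal (signed_tail \<mu> u) \<partial>lborel)"
      using AE_lborel_singleton[of 0]
      by (intro nn_integral_cong_AE) (auto simp: signed_tail_def emeasure_mu indicator_def elim!: eventually_mono)
    finally show ?thesis .
  qed
  \<comment> \<open>A strict gain is needed, and the interval from 1/2 to 1 provides it: there the
    tail is at least \<open>measure \<mu> {1<..}\<close> and the exponential is at least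
    \<open>exp (\<alpha> / 2)\<close>. Its length 1/2 produces the surplus
    \<open>k / 2\<close>.\<close>
  define k where "k = measure \<mu> {1<..} * (exp (\<alpha> / 2) - 1)"
  have k: "0 < k" unfolding k_def using consts_pos by (intro mult_pos_pos tail_pos) simp
  have "ennreal mean < ennreal mean + ennreal (k / 2)"
    using k mean_nonneg by (simp flip: ennreal_plus add: ennreal_lessI)
  also have "\<dots> = (\<integral>\<^sup>+u. ennreal (signed_tail \<mu> u) + ennreal k * indicator {1/2..1} u \<partial>lborel)"
  proof -
    have "(\<integral>\<^sup>+u. ennreal k * indicator {1/2..1::real} u \<partial>lborel) = ennreal k * emeasure lborel {1/2..1::real}"
      by (rule nn_integral_cmult_indicator) simp
    also have "\<dots> = ennreal k * ennreal (1 - 1 / 2)" by (subst emeasure_lborel_Icc) simp_all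
    also have "\<dots> = ennreal (k * (1 - 1 / 2))" using k by (intro ennreal_mult'[symmetric]) simp
    also have "k * (1 - 1 / 2) = k / 2" by simp
    finally show ?thesis unfolding mean_eq by (subst nn_integral_add) auto
  qed
  also have "\<dots> \<le> (\<integral>\<^sup>+u. ?f u \<partial>lborel)"
  proof (rule nn_integral_mono)
    fix u :: real
    show "ennreal (signed_tail \<mu> u) + ennreal k * indicator {1/2..1} u \<le> ?f u"
    proof (cases "u \<in> {1/2..1}")
      case True
      have "exp (\<alpha> / 2) \<le> exp (\<alpha> * u)" using True consts_pos by simp
      moreover have "measure \<mu> {1<..} \<le> signed_tail \<mu> u"
        using True by (auto simp: signed_tail_def intro: tail_anti)
      ultimately have "k \<le> signed_tail \<mu> u * (exp (\<alpha> * u) - 1)"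
        unfolding k_def using consts_pos signed_tail_bounds by (intro mult_mono) auto
      then have "signed_tail \<mu> u + k \<le> signed_tail \<mu> u * exp (\<alpha> * u)" by (simp add: algebra_simps)
      then show ?thesis using True k signed_tail_bounds by (simp flip: ennreal_plus add: ennreal_leI)
    next
      case False
      show ?thesis
      proof (cases "0 < u")
        case True
        then have "1 \<le> exp (\<alpha> * u)" using consts_pos by simp
        then have "signed_tail \<mu> u \<le> signed_tail \<mu> u * exp (\<alpha> * u)"
          using signed_tail_bounds(1)[of u] by (simp add: mult_le_cancel_left1)
        then show ?thesis using \<open>u \<notin> {1/2..1}\<close> by (simp add: ennreal_leI)
      qed (use False in \<open>simp add: signed_tail_def\<close>)
    qed
  qed
  \<comment> \<open>The strict inequality survives truncation at a finite \<open>R\<close> by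
    monotone convergence. The asymptotics of \<open>\<pi>\<close> can then be used uniformly over a
    bounded range of u.\<close>
  also have "\<dots> = (\<integral>\<^sup>+u. (SUP R::nat. ?f u * indicator {0..real R} u) \<partial>lborel)"
  proof (rule nn_integral_cong)
    fix u :: real
    show "?f u = (SUP R::nat. ?f u * indicator {0..real R} u)"
    proof (rule antisym)
      obtain R where "u \<le> real R" using real_arch_simple by blast
      then have "?f u \<le> ?f u * indicator {0..real R} u"
        by (cases "0 \<le> u") (auto simp: signed_tail_def)
      then show "?f u \<le> (SUP R::nat. ?f u * indicator {0..real R} u)" by (rule SUP_upper2[OF UNIV_I])
      show "(SUP R::nat. ?f u * indicator {0..real R} u) \<le> ?f u"
        by (rule SUP_least) (simp split: split_indicator)
    qed
  qed
  also have "\<dots> = (SUP R::nat. \<integral>\<^sup>+u. ?f u * indicator {0..real R} u \<partial>lborel)"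
    by (rule nn_integral_monotone_convergence_SUP)
       (auto simp: incseq_def le_fun_def split: split_indicator)
  finally show ?thesis by (simp add: less_SUP_iff)
qed

text \<open>For large y and u in \<open>{0..real R}\<close> the quotient
  \<open>\<pi> (y - u) / \<pi> y\<close> is nearly \<open>exp (\<alpha> * u)\<close>. Integrated
  against the tail of \<open>\<mu>\<close> this gives a speed close to the truncated integral
  \<open>J\<close>, or larger, and \<open>J\<close> exceeds the mean.\<close>

lemma drift_exceeds_mean:
  "\<exists>K c \<delta>. 0 < \<delta> \<and> mean < c - \<delta> \<and> 0 < K + c \<and> (\<forall>y\<ge>K. drift \<mu> \<pi> y \<le> - c)"
proof -
  obtain R :: nat where R: "ennreal mean < (\<integral>\<^sup>+u. ennreal (signed_tail \<mu> u * exp (\<alpha> * u)) * indicator {0..real R} u \<partial>lborel)"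
    using exponential_tail_exceeds_mean by blast
  define f where "f u = indicator {0..real R} u * (signed_tail \<mu> u * exp (\<alpha> * u))" for u
  have [measurable]: "f \<in> borel_measurable borel" unfolding f_def[abs_def] by measurable
  have f_nonneg: "0 \<le> f u" for u using signed_tail_bounds by (simp add: f_def)
  have f_int: "integrable lborel f"
  proof (rule Bochner_Integration.integrable_bound)
    show "integrable lborel (\<lambda>u. indicator {0..real R} u * (lam * exp (\<alpha> * real R)))" by simp
    have "\<bar>f u\<bar> \<le> \<bar>indicator {0..real R} u * (lam * exp (\<alpha> * real R))\<bar>" for u
    proof (cases "u \<in> {0..real R}")
      case True
      then have "exp (\<alpha> * u) \<le> exp (\<alpha> * real R)" using consts_pos by simp
      then have "signed_tail \<mu> u * exp (\<alpha> * u) \<le> lam * exp (\<alpha> * real R)"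
        using signed_tail_bounds mu_pos by (intro mult_mono) auto
      then show ?thesis using True signed_tail_bounds[of u] mu_pos by (simp add: f_def)
    qed (simp add: f_def)
    then show "AE u in lborel. norm (f u) \<le> norm (indicator {0..real R} u * (lam * exp (\<alpha> * real R)))" by simp
  qed measurable
  define J where "J = (\<integral>u. f u \<partial>lborel)"
  have J_eq: "ennreal J = (\<integral>\<^sup>+u. ennreal (signed_tail \<mu> u * exp (\<alpha> * u)) * indicator {0..real R} u \<partial>lborel)"
    unfolding J_def using f_int f_nonneg
    by (subst nn_integral_eq_integral[symmetric]) (auto simp: f_def intro!: nn_integral_cong split: split_indicator)
  have J_nonneg: "0 \<le> J" unfolding J_def using f_nonneg by (intro integral_nonneg_AE AE_I2) auto
  have mJ: "mean < J" using R unfolding J_eq[symmetric] using mean_nonneg by (simp add: ennreal_less_iff)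
  \<comment> \<open>The midpoint leaves room on both sides: \<open>c < J\<close> allows an error in
    the asymptotics of \<open>\<pi>\<close>, and \<open>mean < c\<close> leaves the slack
    \<open>\<delta>\<close>, taken below as a quarter of \<open>J - mean\<close>.\<close>
  define c where "c = (mean + J) / 2"
  have c: "mean < c" "c < J" "0 < c" using mJ mean_nonneg by (auto simp: c_def)
  \<comment> \<open>The solution of \<open>(1 - \<zeta>) / (1 + \<zeta>) = c / J\<close>: a relative
    error \<open>\<zeta>\<close> in both values of \<open>\<pi>\<close> lowers the quotient by at
    most the factor \<open>c / J\<close>.\<close>
  define \<zeta> where "\<zeta> = (J - c) / (J + c)"
  have \<zeta>: "0 < \<zeta>" "\<zeta> < 1" using c by (auto simp: \<zeta>_def field_simps)
  have "1 - \<zeta> = 2 * c / (J + c)" "1 + \<zeta> = 2 * J / (J + c)" using c by (auto simp: \<zeta>_def field_simps)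
  then have ratio: "(1 - \<zeta>) / (1 + \<zeta>) = c / J" using c by simp
  have "\<forall>\<^sub>F x in at_top. dist (\<pi> x * exp (\<alpha> * x)) C < C * \<zeta>"
    using tendstoD[OF pi_tail, of "C * \<zeta>"] consts_pos \<zeta> by simp
  then obtain K1 where K1: "\<And>x. K1 \<le> x \<Longrightarrow> \<bar>\<pi> x * exp (\<alpha> * x) - C\<bar> < C * \<zeta>"
    by (auto simp: eventually_at_top_linorder dist_real_def)
  \<comment> \<open>Adding \<open>real R\<close> keeps \<open>y - u\<close> positive and beyond
    \<open>K1\<close> for every u in the truncated range.\<close>
  define K where "K = max K1 0 + real R + 1"
  have main: "drift \<mu> \<pi> y \<le> - c" if y: "K \<le> y" for y
  proof -
    have ypos: "0 < y" and yK: "K1 \<le> y" using y by (auto simp: K_def)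
    have quot: "c / J * exp (\<alpha> * u) * \<pi> y \<le> pi0 (y - u)" if u: "u \<in> {0..real R}" for u
    proof -
      have pos: "0 < y - u" and "K1 \<le> y - u" using y u by (auto simp: K_def)
      have lower: "C * (1 - \<zeta>) \<le> \<pi> (y - u) * exp (\<alpha> * (y - u))"
        using K1[OF \<open>K1 \<le> y - u\<close>] unfolding abs_less_iff by (simp add: algebra_simps)
      have upper: "\<pi> y * exp (\<alpha> * y) \<le> C * (1 + \<zeta>)"
        using K1[OF yK] unfolding abs_less_iff by (simp add: algebra_simps)
      have "\<pi> y * exp (\<alpha> * y) * ((1 - \<zeta>) / (1 + \<zeta>)) \<le> C * (1 + \<zeta>) * ((1 - \<zeta>) / (1 + \<zeta>))"
        using upper \<zeta> by (intro mult_right_mono) auto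
      also have "\<dots> = C * (1 - \<zeta>)" using \<zeta> by simp
      also note lower
      finally have "\<pi> y * exp (\<alpha> * y) * (c / J) \<le> \<pi> (y - u) * exp (\<alpha> * (y - u))"
        unfolding ratio .
      then have "\<pi> y * exp (\<alpha> * y) * (c / J) * exp (- (\<alpha> * (y - u))) \<le> \<pi> (y - u) * exp (\<alpha> * (y - u)) * exp (- (\<alpha> * (y - u)))"
        by (intro mult_right_mono) auto
      moreover have "\<pi> (y - u) * exp (\<alpha> * (y - u)) * exp (- (\<alpha> * (y - u))) = \<pi> (y - u)"
        by (simp add: mult.assoc mult_exp_exp)
      moreover have "\<pi> y * exp (\<alpha> * y) * (c / J) * exp (- (\<alpha> * (y - u))) = c / J * exp (\<alpha> * u) * \<pi> y"
      proof -
        have "exp (\<alpha> * y) * exp (- (\<alpha> * (y - u))) = exp (\<alpha> * u)"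
          by (simp add: mult_exp_exp algebra_simps)
        then show ?thesis by (metis (no_types, lifting) mult.assoc mult.commute)
      qed
      ultimately have "c / J * exp (\<alpha> * u) * \<pi> y \<le> \<pi> (y - u)" by (simp only:)
      then show ?thesis using pos by (simp add: zero_ext_def)
    qed
    have "c * \<pi> y = (\<integral>u. c / J * \<pi> y * f u \<partial>lborel)"
      using c by (simp add: J_def[symmetric])
    also have "\<dots> \<le> (\<integral>u. signed_tail \<mu> u * pi0 (y - u) \<partial>lborel)"
    proof (rule integral_mono)
      show "integrable lborel (\<lambda>u. c / J * \<pi> y * f u)" using f_int by simp
      show "integrable lborel (\<lambda>u. signed_tail \<mu> u * pi0 (y - u))"
        using lborel_integrable_real_affine[OF cv_integrable[of y], of "-1" y] by simp
      fix u
      show "c / J * \<pi> y * f u \<le> signed_tail \<mu> u * pi0 (y - u)"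
      proof (cases "u \<in> {0..real R}")
        case True
        have "c / J * \<pi> y * f u = signed_tail \<mu> u * (c / J * exp (\<alpha> * u) * \<pi> y)"
          using True by (simp add: f_def)
        also have "\<dots> \<le> signed_tail \<mu> u * pi0 (y - u)"
          by (intro mult_left_mono quot True signed_tail_bounds)
        finally show ?thesis .
      next
        case False
        then show ?thesis using signed_tail_bounds pi0_nonneg by (simp add: f_def)
      qed
    qed
    also have "\<dots> = cv y"
      unfolding fun_convolution_def
      using lborel_integral_real_affine[of "-1" "\<lambda>z. signed_tail \<mu> (y - z) * pi0 z" y] by simp
    finally have "c \<le> cv y / \<pi> y" using pi_pos[OF ypos] by (simp add: field_simps)
    then show ?thesis using ypos by (simp add: drift_def)
  qed
  show ?thesis
  proof (intro exI conjI allI impI)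
    show "0 < (J - mean) / 4" "mean < c - (J - mean) / 4" using mJ by (auto simp: c_def field_simps)
    show "0 < K + c" using c by (simp add: K_def)
  qed (rule main)
qed

end

section \<open>Irreducibility and ergodicity\<close>

locale generalized_ou =
  fixes \<pi> :: "real \<Rightarrow> real" and \<mu> \<mu>1 \<mu>2 :: "real measure"
    and C C' \<alpha> :: real
    and P F :: "real \<Rightarrow> 'a measure" and L X :: "real \<Rightarrow> 'a \<Rightarrow> real"
  assumes pi_prob: "prob_space (density (restrict_space lborel {0<..}) (\<lambda>x. ennreal (\<pi> x)))"
    and pi_pos: "\<forall>x>0. 0 < \<pi> x"
    and pi_loc: "L1_loc {0<..} \<pi>"
    and consts_pos: "0 < C" "0 < C'" "0 < \<alpha>"
    and pi_tail: "((\<lambda>x. \<pi> x * exp (\<alpha> * x)) \<longlongrightarrow> C) at_top"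
    and pi_zero: "\<forall>\<^sub>F x in at_right 0. (LINT z:{0<..<x}|lborel. \<pi> z) \<le> C' * \<pi> x * x"
    and mu_sets: "sets \<mu> = sets borel"
    and mu_supp: "measure_support \<mu> \<subseteq> {0..}"
    and mu_moment: "(\<integral>\<^sup>+z\<in>{0<..}. ennreal (max 1 z) \<partial>\<mu>) < \<infinity>"
    and L_cpp: "\<forall>x>0. compound_poisson_process (P x) \<mu> L"
    and X_markov: "markov_process P F X"
    and X_sol: "\<forall>x>0. sde_solution (drift \<mu> \<pi>) (P x) F L X"
    and mu2_sets: "sets \<mu>2 = sets borel"
    and mu_sum: "\<forall>A\<in>sets borel. emeasure \<mu> A = emeasure \<mu>1 A + emeasure \<mu>2 A"
    and mu2_ac: "absolutely_continuous lborel \<mu>2"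
    and mu2_pos: "\<forall>I. open I \<and> is_interval I \<and> I \<noteq> {} \<and> I \<subseteq> {0<..} \<longrightarrow> 0 < emeasure \<mu>2 I"
begin

lemma mu2_interval_pos: "0 \<le> a \<Longrightarrow> a < b \<Longrightarrow> 0 < emeasure \<mu>2 {a<..<b}"
  by (rule mu2_pos[rule_format]) (auto simp: is_interval_1)

lemma mu2_le: "A \<in> sets borel \<Longrightarrow> emeasure \<mu>2 A \<le> emeasure \<mu> A"
  using mu_sum by (simp add: add_increasing)

lemma drift_setting: "drift_setting \<mu> \<pi> C C' \<alpha>"
proof -
  have fin: "finite_measure \<mu>" using L_cpp zero_less_one unfolding compound_poisson_process_def by blast
  have pos: "0 < measure \<mu> UNIV"
    using L_cpp zero_less_one unfolding compound_poisson_process_def poisson_process_def by blast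
  have neg: "emeasure \<mu> {..<0} = 0"
    using mu_supp by (intro null_set_outside_support[OF mu_sets]) auto
  have tail: "0 < measure \<mu> {b<..}" for b
  proof -
    have "0 < emeasure \<mu>2 {max b 0<..<max b 0 + 1}" by (intro mu2_interval_pos) auto
    also have "\<dots> \<le> emeasure \<mu> {max b 0<..<max b 0 + 1}" by (rule mu2_le) simp
    also have "\<dots> \<le> emeasure \<mu> {b<..}" by (intro emeasure_mono) (auto simp: mu_sets)
    finally show ?thesis using fin by (simp add: finite_measure.emeasure_eq_measure)
  qed
  have moment: "(\<integral>\<^sup>+z. ennreal z \<partial>\<mu>) < \<infinity>"
  proof -
    have "(\<integral>\<^sup>+z. ennreal z \<partial>\<mu>) \<le> (\<integral>\<^sup>+z\<in>{0<..}. ennreal (max 1 z) \<partial>\<mu>)"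
      by (intro nn_integral_mono) (auto simp: ennreal_neg intro!: ennreal_leI split: split_indicator)
    then show ?thesis using mu_moment by simp
  qed
  have "0 < \<pi> x" if "0 < x" for x using pi_pos that by blast
  with mu_sets fin pos pi_prob pi_loc consts_pos pi_tail pi_zero neg tail moment show ?thesis
    by (intro drift_setting.intro finite_jump_measure.intro drift_setting_axioms.intro)
qed

sublocale drift_setting \<mu> \<pi> C C' \<alpha> by (rule drift_setting)

interpretation mu: finite_measure \<mu> by (rule finite_mu)

lemma finite_mu2: "finite_measure \<mu>2"
proof
  have "emeasure \<mu>2 UNIV \<le> emeasure \<mu> UNIV" by (rule mu2_le) simp
  then show "emeasure \<mu>2 (space \<mu>2) \<noteq> \<infinity>"
    using mu.emeasure_finite[of UNIV] sets_eq_imp_space_eq[OF mu2_sets] by (auto simp: top_unique)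
qed

interpretation mu2: finite_measure \<mu>2 by (rule finite_mu2)

abbreviation "\<kappa> \<equiv> transition P X"

section \<open>The transition kernel of the solution and its paths\<close>

lemma prob_space_P: "0 < x \<Longrightarrow> prob_space (P x)"
  using X_markov by (auto simp: markov_process_def)

lemma X_measurable:
  assumes "0 < x" "0 \<le> t"
  shows "X t \<in> P x \<rightarrow>\<^sub>M state_space"
proof -
  have "subalgebra (P x) (F t)" "X t \<in> F t \<rightarrow>\<^sub>M state_space"
    using X_markov assms by (auto simp: markov_process_def)
  then show ?thesis using measurable_from_subalg by blast
qed

lemma X_positive: "0 < x \<Longrightarrow> 0 \<le> t \<Longrightarrow> \<omega> \<in> space (P x) \<Longrightarrow> 0 < X t \<omega>"
  using measurable_space[OF X_measurable] by (fastforce simp: space_restrict_space)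

lemma emeasure_kernel:
  assumes "0 < x" "0 \<le> t" "A \<in> sets state_space"
  shows "emeasure (\<kappa> t x) A = emeasure (P x) {\<omega>\<in>space (P x). X t \<omega> \<in> A}"
  unfolding transition_def using assms
  by (subst emeasure_distr[OF X_measurable]) (auto intro!: arg_cong[where f="emeasure _"])

lemma event_X_sets:
  assumes "0 < x" "0 \<le> t" "A \<in> sets state_space"
  shows "{\<omega>\<in>space (P x). X t \<omega> \<in> A} \<in> sets (P x)"
  using measurable_sets[OF X_measurable[OF assms(1,2)] assms(3)] by (simp add: vimage_def Int_def conj_commute)

lemma AE_X_0: "0 < x \<Longrightarrow> AE \<omega> in P x. X 0 \<omega> = x"
  using X_markov by (auto simp: markov_process_def)

text \<open>Integrating the Markov property over the past gives the Chapman-Kolmogorov equation;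
  conditional expectations do not occur afterwards.\<close>

sublocale k: markov_kernel \<kappa>
proof
  show "\<kappa> t \<in> state_space \<rightarrow>\<^sub>M prob_algebra state_space" if "0 \<le> t" for t
    using X_markov that by (auto simp: markov_process_def)
  fix x :: real and B :: "real set" assume x: "0 < x" and B: "B \<in> sets state_space"
  interpret prob_space "P x" by (rule prob_space_P[OF x])
  have "emeasure (P x) {\<omega>\<in>space (P x). X 0 \<omega> \<in> B} = emeasure (P x) {\<omega>\<in>space (P x). x \<in> B}"
    using AE_X_0[OF x] event_X_sets[OF x order_refl B]
    by (intro emeasure_eq_AE) (auto elim!: eventually_mono)
  also have "\<dots> = indicator B x" using emeasure_space_1 by (cases "x \<in> B") auto
  finally show "emeasure (\<kappa> 0 x) B = indicator B x" by (simp add: emeasure_kernel x B)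
next
  fix s t x :: real and B :: "real set"
  assume st: "0 \<le> s" "0 \<le> t" and x: "0 < x" and B: "B \<in> sets state_space"
  have "prob_space (P x)" and sub: "subalgebra (P x) (F s)"
    and ce: "AE \<omega> in P x. real_cond_exp (P x) (F s) (\<lambda>\<omega>. indicator B (X (s + t) \<omega>)) \<omega> = measure (\<kappa> t (X s \<omega>)) B"
    and kt: "\<kappa> t \<in> state_space \<rightarrow>\<^sub>M prob_algebra state_space"
    using X_markov st x B by (auto simp: markov_process_def)
  interpret prob_space "P x" by fact
  interpret finite_measure_subalgebra "P x" "F s" by unfold_locales (rule sub)
  note [measurable] = X_measurable[OF x st(1)] B
  have Xst[measurable]: "X (s + t) \<in> P x \<rightarrow>\<^sub>M state_space" using st x by (intro X_measurable) auto
  have m: "(\<lambda>y. measure (\<kappa> t y) B) \<in> borel_measurable state_space"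
    using measurable_compose[OF measurable_prob_algebraD[OF kt] measurable_measure_subprob_algebra[OF B]] by simp
  have int: "integrable (P x) (\<lambda>\<omega>. indicat_real B (X (s + t) \<omega>))"
    by (rule integrable_const_bound[where B=1]) auto
  have "measure (\<kappa> (s + t) x) B = prob {\<omega>\<in>space (P x). X (s + t) \<omega> \<in> B}"
    using emeasure_kernel[OF x _ B, of "s + t"] st by (simp add: measure_def)
  also have "\<dots> = (\<integral>\<omega>. indicator {\<omega>\<in>space (P x). X (s + t) \<omega> \<in> B} \<omega> \<partial>P x)" by simp
  also have "\<dots> = (\<integral>\<omega>. indicator B (X (s + t) \<omega>) \<partial>P x)"
    by (intro Bochner_Integration.integral_cong) (auto split: split_indicator)
  also have "\<dots> = (\<integral>\<omega>. real_cond_exp (P x) (F s) (\<lambda>\<omega>. indicator B (X (s + t) \<omega>)) \<omega> \<partial>P x)"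
    by (rule real_cond_exp_int(2)[OF int, symmetric])
  also have "\<dots> = (\<integral>\<omega>. measure (\<kappa> t (X s \<omega>)) B \<partial>P x)"
    using ce by (intro integral_cong_AE) (auto intro!: measurable_compose[OF X_measurable[OF x st(1)] m])
  also have "\<dots> = (\<integral>y. measure (\<kappa> t y) B \<partial>\<kappa> s x)"
    unfolding transition_def[of P X s] by (rule integral_distr[symmetric]) (use m in measurable)
  finally show "measure (\<kappa> (s + t) x) B = (\<integral>y. measure (\<kappa> t y) B \<partial>\<kappa> s x)" .
qed

text \<open>The Poisson process and the jump sizes are obtained separately under each
  \<open>P x\<close>. Intersecting all almost sure statements once reduces later comparisons of
  events to statements about a single \<open>jump_path\<close>.\<close>

lemma jump_representation:
  assumes x: "0 < x"
  obtains N \<xi> where "compound_poisson (P x) \<mu> N \<xi>"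
    "AE \<omega> in P x. jump_path slowness (drift \<mu> \<pi>) (\<lambda>t. N t \<omega>) (\<lambda>i. \<xi> i \<omega>) (\<lambda>t. X t \<omega>) x"
proof -
  obtain N \<xi> where N: "poisson_process (P x) (measure \<mu> UNIV) N"
    "prob_space.indep_vars (P x) (\<lambda>_. borel) \<xi> (UNIV :: nat set)"
    "\<forall>i. distr (P x) borel (\<xi> i) = scale_measure (inverse (emeasure \<mu> UNIV)) \<mu>"
    "indep_rv (P x) (PiM {0..} (\<lambda>_. count_space UNIV)) (\<lambda>\<omega>. \<lambda>t\<in>{0..}. N t \<omega>)
          (PiM UNIV (\<lambda>_. borel)) (\<lambda>\<omega> i. \<xi> i \<omega>)"
    and L: "AE \<omega> in P x. \<forall>t\<ge>0. L t \<omega> = (\<Sum>i<N t \<omega>. \<xi> i \<omega>)"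
    using L_cpp x unfolding compound_poisson_process_def by blast
  interpret prob_space "P x" by (rule prob_space_P[OF x])
  interpret compound_poisson "P x" \<mu> N \<xi>
    by unfold_locales (use N in \<open>auto simp: jump_law_def\<close>)
  have sol: "AE \<omega> in P x. \<forall>t\<ge>0. set_integrable lborel {0..t} (\<lambda>s. drift \<mu> \<pi> (X s \<omega>)) \<and>
        X t \<omega> = X 0 \<omega> + (LINT s:{0..t}|lborel. drift \<mu> \<pi> (X s \<omega>)) + L t \<omega>"
    using X_sol x unfolding sde_solution_def by blast
  have "AE \<omega> in P x. jump_path slowness (drift \<mu> \<pi>) (\<lambda>t. N t \<omega>) (\<lambda>i. \<xi> i \<omega>) (\<lambda>t. X t \<omega>) x"
    using L sol AE_N_0 AE_N_path AE_xi_nonneg[OF mu_neg] AE_X_0[OF x] AE_space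
  proof eventually_elim
    case (elim \<omega>)
    show ?case
    proof (intro jump_path.intro[OF travel_density_axioms] jump_path_axioms.intro)
      show "drift \<mu> \<pi> y = - 1 / slowness y" if "0 < y" for y by (rule drift_slowness[OF that])
      show "0 < X t \<omega>" if "0 \<le> t" for t by (rule X_positive[OF x that elim(7)])
      show "set_integrable lborel {0..t} (\<lambda>s. drift \<mu> \<pi> (X s \<omega>))" if "0 \<le> t" for t
        using elim(2) that by blast
      show "X t \<omega> = x + (LINT s:{0..t}|lborel. drift \<mu> \<pi> (X s \<omega>)) + (\<Sum>i<N t \<omega>. \<xi> i \<omega>)" if "0 \<le> t" for t
        using elim(1,2,6) that by metis
      show "N 0 \<omega> = 0" by (rule elim(3))
      show "mono_on {0..} (\<lambda>t. N t \<omega>)" using elim(4) by blast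
      show "continuous (at_right t) (\<lambda>t. N t \<omega>)" if "0 \<le> t" for t using elim(4) that by blast
      show "0 \<le> \<xi> i \<omega>" for i using elim(5) by blast
    qed
  qed
  then show thesis using that compound_poisson_axioms by blast
qed

abbreviation "\<rho> \<equiv> compound_poisson_law \<mu>"

section \<open>Comparison of the kernel with the law of the jump sum\<close>

lemma jump_sum_measurable:
  assumes "compound_poisson M \<mu> N \<xi>"
  shows "(\<lambda>\<omega>. \<Sum>i<N 1 \<omega>. \<xi> i \<omega>) \<in> borel_measurable M"
proof -
  interpret compound_poisson M \<mu> N \<xi> by fact
  show ?thesis
    by (rule measurable_compose_countable[where f="\<lambda>n \<omega>. \<Sum>i<n. \<xi> i \<omega>" and g="N 1"])
       (use N_measurable[of 1] in measurable)
qed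

lemma ray_sets: "{max r 0<..} \<in> sets state_space" for r :: real
  by (auto simp: sets_restrict_space intro!: image_eqI[of _ _ "{max r 0<..}"])

text \<open>Turns a deterministic bound on paths into domination by \<open>\<rho>\<close>, which is
  the same for all starting points. Monotonicity of \<open>b\<close> supplies its
  measurability.\<close>

lemma tail_le_jump_sum:
  assumes x: "0 < x" and t: "0 \<le> t" and b: "mono b"
    and le: "\<And>N \<xi> Y. jump_path slowness (drift \<mu> \<pi>) N \<xi> Y x \<Longrightarrow> Y t \<le> b (\<Sum>i<N 1. \<xi> i)"
  shows "emeasure (\<kappa> t x) {max r 0<..} \<le> emeasure \<rho> {z. r < b z}"
proof -
  obtain N \<xi> where cp: "compound_poisson (P x) \<mu> N \<xi>"
    and path: "AE \<omega> in P x. jump_path slowness (drift \<mu> \<pi>) (\<lambda>t. N t \<omega>) (\<lambda>i. \<xi> i \<omega>) (\<lambda>t. X t \<omega>) x"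
    using jump_representation[OF x] .
  interpret compound_poisson "P x" \<mu> N \<xi> by (rule cp)
  note [measurable] = jump_sum_measurable[OF cp] borel_measurable_mono[OF b]
  have "emeasure (\<kappa> t x) {max r 0<..} = emeasure (P x) {\<omega>\<in>space (P x). X t \<omega> \<in> {max r 0<..}}"
    by (rule emeasure_kernel[OF x t ray_sets])
  also have "\<dots> \<le> emeasure (P x) {\<omega>\<in>space (P x). r < b (\<Sum>i<N 1 \<omega>. \<xi> i \<omega>)}"
  proof (rule emeasure_mono_AE)
    show "AE \<omega> in P x. \<omega> \<in> {\<omega>\<in>space (P x). X t \<omega> \<in> {max r 0<..}} \<longrightarrow>
        \<omega> \<in> {\<omega>\<in>space (P x). r < b (\<Sum>i<N 1 \<omega>. \<xi> i \<omega>)}"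
      using path
    proof eventually_elim
      case (elim \<omega>)
      from le[OF elim] show ?case by auto
    qed
  qed measurable
  also have "\<dots> = emeasure (distr (P x) borel (\<lambda>\<omega>. \<Sum>i<N 1 \<omega>. \<xi> i \<omega>)) {z. r < b z}"
  proof -
    have "{z\<in>space borel. r < b z} \<in> sets borel" by measurable
    then show ?thesis by (subst emeasure_distr) (auto intro!: arg_cong[where f="emeasure _"])
  qed
  finally show ?thesis by (simp add: distr_jump_sum)
qed

lemma one_step_tail:
  assumes "\<And>y. K \<le> y \<Longrightarrow> drift \<mu> \<pi> y \<le> - c" "0 < x"
  shows "emeasure (\<kappa> 1 x) {max r 0<..} \<le> emeasure \<rho> {z. r < max (x - c) K + z}"
proof (rule tail_le_jump_sum)
  show "Y 1 \<le> max (x - c) K + (\<Sum>i<N 1. \<xi> i)"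
    if "jump_path slowness (drift \<mu> \<pi>) N \<xi> Y x" for N \<xi> Y
    by (rule jump_path.X_1_le[OF that assms(1)])
qed (use assms(2) in \<open>simp_all add: mono_def\<close>)

lemma short_time_tail:
  assumes "0 < x" "0 \<le> t" "t \<le> 1"
  shows "emeasure (\<kappa> t x) {max r 0<..} \<le> emeasure \<rho> {z. r < x + z}"
proof (rule tail_le_jump_sum)
  show "Y t \<le> x + (\<Sum>i<N 1. \<xi> i)"
    if "jump_path slowness (drift \<mu> \<pi>) N \<xi> Y x" for N \<xi> Y
    by (rule jump_path.X_le_jumps[OF that assms(2,3)])
qed (use assms in \<open>simp_all add: mono_def\<close>)

section \<open>Lower bounds from paths with no jump or exactly one jump\<close>

lemma singleton_sets: "0 < y \<Longrightarrow> {y} \<in> sets state_space" for y :: real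
  by (auto simp: sets_restrict_space intro!: image_eqI[of _ _ "{y}"])

lemma prob_no_jump:
  assumes x: "0 < x" and t: "0 < t"
  shows "ennreal (exp (- (lam * t))) \<le> emeasure (\<kappa> t x) {flow t x}"
proof -
  obtain N \<xi> where cp: "compound_poisson (P x) \<mu> N \<xi>"
    and path: "AE \<omega> in P x. jump_path slowness (drift \<mu> \<pi>) (\<lambda>t. N t \<omega>) (\<lambda>i. \<xi> i \<omega>) (\<lambda>t. X t \<omega>) x"
    using jump_representation[OF x] .
  interpret compound_poisson "P x" \<mu> N \<xi> by (rule cp)
  have [measurable]: "N t \<in> P x \<rightarrow>\<^sub>M count_space UNIV" using N_measurable t by simp
  have sing: "{flow t x} \<in> sets state_space" using x t by (intro singleton_sets flow_pos) auto
  have "ennreal (exp (- (lam * t))) = emeasure (P x) {\<omega>\<in>space (P x). N t \<omega> = 0}"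
    using prob_N[OF t, of 0] by (simp add: emeasure_eq_measure)
  also have "\<dots> \<le> emeasure (P x) {\<omega>\<in>space (P x). X t \<omega> \<in> {flow t x}}"
  proof (rule emeasure_mono_AE)
    show "AE \<omega> in P x. \<omega> \<in> {\<omega>\<in>space (P x). N t \<omega> = 0} \<longrightarrow> \<omega> \<in> {\<omega>\<in>space (P x). X t \<omega> \<in> {flow t x}}"
      using path
    proof eventually_elim
      case (elim \<omega>)
      interpret jump_path slowness "drift \<mu> \<pi>" "\<lambda>t. N t \<omega>" "\<lambda>i. \<xi> i \<omega>" "\<lambda>t. X t \<omega>" x by (rule elim)
      show ?case using flow_if_no_jump[of t] t by auto
    qed
    show "{\<omega>\<in>space (P x). X t \<omega> \<in> {flow t x}} \<in> events" using event_X_sets[OF x _ sing, of t] t by simp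
  qed
  also have "\<dots> = emeasure (\<kappa> t x) {flow t x}"
    using emeasure_kernel[OF x _ sing, of t] t by simp
  finally show ?thesis .
qed

text \<open>\<open>landing d A\<close> is, up to the factor \<open>e\<^bsup>-\<mu>(\<real>)\<^esup>\<close>, the probability to be in \<open>A\<close> at
  time 1 after a single jump, with a jump size from \<open>\<mu>2\<close>, when the path before the jump is \<open>d\<close>.
  The choice \<open>d = 0\<close> is the limit of a start at the boundary point 0, which is not in the state space.\<close>

definition landing_set :: "(real \<Rightarrow> real) \<Rightarrow> real set \<Rightarrow> (real \<times> real) set" where
  "landing_set d A = {(s, z). s \<in> {0..1} \<and> 0 < z \<and> flow (1 - s) (d s + z) \<in> A}"

definition landing :: "(real \<Rightarrow> real) \<Rightarrow> real set \<Rightarrow> ennreal" where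
  "landing d A = (\<integral>\<^sup>+s. emeasure \<mu>2 (Pair s -` landing_set d A) * indicator {0..1} s \<partial>lborel)"

text \<open>The landing point is a continuous function of jump time and jump size on a Borel
  rectangle. Requiring \<open>0 < z\<close> keeps the start after the jump positive even for
  \<open>d = 0\<close>.\<close>

lemma landing_set_measurable:
  assumes d: "continuous_on {0..1} d" "\<And>s. s \<in> {0..1} \<Longrightarrow> 0 \<le> d s" and A: "A \<in> sets state_space"
  shows "landing_set d A \<in> sets (borel \<Otimes>\<^sub>M borel)"
proof -
  let ?D = "{0..1} \<times> {0<..} :: (real \<times> real) set"
  let ?f = "\<lambda>p. flow (1 - fst p) (d (fst p) + snd p)"
  have "continuous_on ?D ?f"
  proof (rule flow_continuous)
    have "continuous_on ?D (\<lambda>p. d (fst p))"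
      by (rule continuous_on_compose2[OF d(1)]) (auto intro!: continuous_intros)
    then show "continuous_on ?D (\<lambda>p. d (fst p) + snd p)" by (intro continuous_intros)
    show "continuous_on ?D (\<lambda>p. 1 - fst p)" by (intro continuous_intros)
    show "0 \<le> 1 - fst p \<and> 0 < d (fst p) + snd p" if "p \<in> ?D" for p
      using that d(2)[of "fst p"] by auto
  qed
  then have f: "?f \<in> borel_measurable (restrict_space borel ?D)"
    by (rule borel_measurable_continuous_on_restrict)
  have A': "A \<in> sets borel" using A by (auto simp: sets_restrict_space)
  have D: "?D \<in> sets (borel :: (real \<times> real) measure)"
    unfolding borel_prod[symmetric] by (rule pair_measureI) auto
  have "?f -` A \<inter> space (restrict_space borel ?D) \<in> sets (restrict_space borel ?D)"
    by (rule measurable_sets[OF f A'])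
  then have "?f -` A \<inter> ?D \<in> sets borel"
    using D by (simp add: sets_restrict_space_iff space_restrict_space)
  moreover have "?f -` A \<inter> ?D = landing_set d A" by (auto simp: landing_set_def)
  ultimately have "landing_set d A \<in> sets borel" by simp
  then show ?thesis by (simp only: borel_prod)
qed

lemma flow_path_continuous:
  assumes "0 < x"
  shows "continuous_on {0..1} (\<lambda>s. flow s x)" "\<And>s. s \<in> {0..1} \<Longrightarrow> 0 \<le> flow s x"
  using assms by (auto intro!: flow_continuous continuous_intros less_imp_le[OF flow_pos])

text \<open>The jump time has density \<open>lam * exp (- lam)\<close> and the size has law
  \<open>q\<close>. Since \<open>lam\<close> times \<open>q\<close> is \<open>\<mu>\<close>, which
  dominates \<open>\<mu>2\<close>, the factor \<open>lam\<close> is absorbed and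
  \<open>exp (- lam)\<close> remains.\<close>

lemma one_jump_lower_bound:
  assumes x: "0 < x" and A: "A \<in> sets state_space"
  shows "ennreal (exp (- lam)) * landing (\<lambda>s. flow s x) A \<le> emeasure (\<kappa> 1 x) A"
proof -
  obtain N \<xi> where cp: "compound_poisson (P x) \<mu> N \<xi>"
    and path: "AE \<omega> in P x. jump_path slowness (drift \<mu> \<pi>) (\<lambda>t. N t \<omega>) (\<lambda>i. \<xi> i \<omega>) (\<lambda>t. X t \<omega>) x"
    using jump_representation[OF x] .
  interpret compound_poisson "P x" \<mu> N \<xi> by (rule cp)
  let ?E = "landing_set (\<lambda>s. flow s x) A"
  have E: "?E \<in> sets (borel \<Otimes>\<^sub>M borel)"
    by (rule landing_set_measurable[OF flow_path_continuous[OF x] A])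
  have section_sets: "Pair s -` ?E \<in> sets borel" for s by (rule sets_Pair1[OF E])
  have "ennreal (exp (- lam)) * landing (\<lambda>s. flow s x) A
    \<le> ennreal (exp (- lam)) * (\<integral>\<^sup>+s. ennreal lam * (emeasure q (Pair s -` ?E) * indicator {0..1} s) \<partial>lborel)"
    unfolding landing_def
  proof (intro mult_left_mono nn_integral_mono)
    fix s
    have "emeasure \<mu>2 (Pair s -` ?E) \<le> emeasure \<mu> (Pair s -` ?E)" by (rule mu2_le[OF section_sets])
    also have "\<dots> = ennreal lam * emeasure q (Pair s -` ?E)"
      using mu_pos by (simp add: emeasure_q mult.assoc[symmetric] ennreal_mult'[symmetric])
    finally show "emeasure \<mu>2 (Pair s -` ?E) * indicator {0..1} s
      \<le> ennreal lam * (emeasure q (Pair s -` ?E) * indicator {0..1} s)"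
      by (simp add: mult.assoc[symmetric] mult_right_mono)
  qed simp
  also have "\<dots> = ennreal (lam * exp (- lam)) * (\<integral>\<^sup>+s. emeasure q (Pair s -` ?E) * indicator {0..1} s \<partial>lborel)"
  proof -
    have "(\<lambda>s. emeasure q (Pair s -` ?E)) \<in> borel_measurable borel"
      by (rule q.M.measurable_emeasure_Pair) (use E in \<open>simp cong: sets_pair_measure_cong\<close>)
    then show ?thesis
      by (subst nn_integral_cmult) (auto simp: ennreal_mult' mult.assoc mult.commute mult.left_commute)
  qed
  also have "\<dots> = emeasure (P x) {\<omega>\<in>space (P x). (jump_time \<omega>, \<xi> 0 \<omega>) \<in> ?E}"
    by (rule emeasure_one_jump[OF E, symmetric]) (auto simp: landing_set_def)
  also have "\<dots> \<le> emeasure (P x) {\<omega>\<in>space (P x). X 1 \<omega> \<in> A}"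
  proof (rule emeasure_mono_AE)
    show "AE \<omega> in P x. \<omega> \<in> {\<omega>\<in>space (P x). (jump_time \<omega>, \<xi> 0 \<omega>) \<in> ?E} \<longrightarrow> \<omega> \<in> {\<omega>\<in>space (P x). X 1 \<omega> \<in> A}"
      using path
    proof eventually_elim
      case (elim \<omega>)
      interpret jump_path slowness "drift \<mu> \<pi>" "\<lambda>t. N t \<omega>" "\<lambda>i. \<xi> i \<omega>" "\<lambda>t. X t \<omega>" x by (rule elim)
      show ?case
      proof
        assume \<omega>: "\<omega> \<in> {\<omega>\<in>space (P x). (jump_time \<omega>, \<xi> 0 \<omega>) \<in> ?E}"
        then have N1: "N 1 \<omega> = 1" using jump_time_le_1_iff by (auto simp: landing_set_def)
        then show "\<omega> \<in> {\<omega>\<in>space (P x). X 1 \<omega> \<in> A}"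
          using \<omega> flow_if_one_jump by (auto simp: landing_set_def jump_time_def)
      qed
    qed
    show "{\<omega>\<in>space (P x). X 1 \<omega> \<in> A} \<in> events" using event_X_sets[OF x _ A] by simp
  qed
  also have "\<dots> = emeasure (\<kappa> 1 x) A"
    using emeasure_kernel[OF x _ A, of 1] by simp
  finally show ?thesis .
qed

text \<open>A real-valued Lebesgue density of \<open>\<mu>2\<close> on the positive half-line. It
  vanishes elsewhere, so its translates by nonnegative amounts stay on positive jumps.\<close>

definition mu2_density :: "real \<Rightarrow> real" where
  "mu2_density z = indicator {0<..} z * enn2real (RN_deriv lborel \<mu>2 z)"

lemma mu2_density_measurable[measurable]: "mu2_density \<in> borel_measurable borel"
  unfolding mu2_density_def[abs_def] by measurable

lemma emeasure_mu2_density: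
  assumes [measurable]: "B \<in> sets borel" and "B \<subseteq> {0<..}"
  shows "emeasure \<mu>2 B = (\<integral>\<^sup>+z. ennreal (mu2_density z) * indicator B z \<partial>lborel)"
proof -
  have sets: "sets \<mu>2 = sets lborel" using mu2_sets by simp
  have "density lborel (RN_deriv lborel \<mu>2) = \<mu>2"
    by (rule sigma_finite_measure.density_RN_deriv[OF sigma_finite_lborel mu2_ac sets])
  then have "emeasure \<mu>2 B = (\<integral>\<^sup>+z. RN_deriv lborel \<mu>2 z * indicator B z \<partial>lborel)"
    using emeasure_density[of "RN_deriv lborel \<mu>2" lborel B] by simp
  also have "\<dots> = (\<integral>\<^sup>+z. ennreal (mu2_density z) * indicator B z \<partial>lborel)"
  proof (rule nn_integral_cong_AE)
    have "AE z in lborel. RN_deriv lborel \<mu>2 z \<noteq> \<infinity>"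
      by (rule sigma_finite_measure.RN_deriv_finite[OF sigma_finite_lborel mu2.sigma_finite_measure_axioms mu2_ac sets])
    then show "AE z in lborel. RN_deriv lborel \<mu>2 z * indicator B z = ennreal (mu2_density z) * indicator B z"
    proof eventually_elim
      case (elim z)
      then show ?case using assms(2) by (auto simp: mu2_density_def less_top split: split_indicator)
    qed
  qed
  finally show ?thesis .
qed

lemma mu2_density_integrable: "integrable lborel mu2_density"
proof (rule integrableI_nonneg)
  have "(\<integral>\<^sup>+z. ennreal (mu2_density z) \<partial>lborel) = (\<integral>\<^sup>+z. ennreal (mu2_density z) * indicator {0<..} z \<partial>lborel)"
    by (intro nn_integral_cong) (auto simp: mu2_density_def split: split_indicator)
  also have "\<dots> = emeasure \<mu>2 {0<..}" by (rule emeasure_mu2_density[symmetric]) auto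
  finally show "(\<integral>\<^sup>+z. ennreal (mu2_density z) \<partial>lborel) < \<infinity>" using mu2.emeasure_finite by (simp add: less_top[symmetric])
qed (auto simp: mu2_density_def)

text \<open>Jumping from d instead of 0 translates the density of the landing point by d. The cost
  is the L1 distance between the density and its translate, the same for all
  \<open>W\<close>.\<close>

lemma mu2_translate:
  assumes W[measurable]: "W \<in> sets borel" and "0 \<le> d"
  shows "emeasure \<mu>2 {z. 0 < z \<and> z \<in> W}
    \<le> emeasure \<mu>2 {z. 0 < z \<and> d + z \<in> W} + ennreal (\<integral>y. \<bar>mu2_density (y - d) - mu2_density y\<bar> \<partial>lborel)"
proof -
  have s1: "{z. 0 < z \<and> z \<in> W} \<in> sets borel"
  proof -
    have "{z\<in>space borel. 0 < z \<and> z \<in> W} \<in> sets borel" by measurable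
    then show ?thesis by simp
  qed
  have s2: "{z. 0 < z \<and> d + z \<in> W} \<in> sets borel"
  proof -
    have "{z\<in>space borel. 0 < z \<and> d + z \<in> W} \<in> sets borel" by measurable
    then show ?thesis by simp
  qed
  have g0: "mu2_density z = 0" if "z \<le> 0" for z using that by (simp add: mu2_density_def)
  have g_nonneg: "0 \<le> mu2_density z" for z by (simp add: mu2_density_def)
  have i: "integrable lborel (\<lambda>y. \<bar>mu2_density (y - d) - mu2_density y\<bar>)"
    using mu2_density_integrable lborel_integrable_real_affine[OF mu2_density_integrable, of 1 "- d"] by auto
  have "emeasure \<mu>2 {z. 0 < z \<and> z \<in> W} = (\<integral>\<^sup>+z. ennreal (mu2_density z) * indicator {z. 0 < z \<and> z \<in> W} z \<partial>lborel)"
    by (rule emeasure_mu2_density[OF s1]) auto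
  also have "\<dots> \<le> (\<integral>\<^sup>+z. ennreal (mu2_density (z - d)) * indicator W z + ennreal \<bar>mu2_density (z - d) - mu2_density z\<bar> \<partial>lborel)"
    using g_nonneg by (intro nn_integral_mono)
      (auto simp flip: ennreal_plus intro!: ennreal_leI split: split_indicator)
  also have "\<dots> = (\<integral>\<^sup>+z. ennreal (mu2_density (z - d)) * indicator W z \<partial>lborel) + (\<integral>\<^sup>+z. ennreal \<bar>mu2_density (z - d) - mu2_density z\<bar> \<partial>lborel)"
    by (rule nn_integral_add) auto
  also have "(\<integral>\<^sup>+z. ennreal (mu2_density (z - d)) * indicator W z \<partial>lborel)
      = (\<integral>\<^sup>+z. ennreal (mu2_density z) * indicator W (d + z) \<partial>lborel)"
    by (subst nn_integral_real_affine[where c=1 and t=d]) auto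
  also have "\<dots> = (\<integral>\<^sup>+z. ennreal (mu2_density z) * indicator {z. 0 < z \<and> d + z \<in> W} z \<partial>lborel)"
    using g0 by (intro nn_integral_cong) (auto split: split_indicator)
  also have "\<dots> = emeasure \<mu>2 {z. 0 < z \<and> d + z \<in> W}"
    by (rule emeasure_mu2_density[OF s2, symmetric]) auto
  also have "(\<integral>\<^sup>+z. ennreal \<bar>mu2_density (z - d) - mu2_density z\<bar> \<partial>lborel) = ennreal (\<integral>y. \<bar>mu2_density (y - d) - mu2_density y\<bar> \<partial>lborel)"
    by (rule nn_integral_eq_integral[OF i]) simp
  finally show ?thesis .
qed

abbreviation "landing0 \<equiv> landing (\<lambda>_. 0)"

lemma landing_section_measurable:
  assumes "continuous_on {0..1} d" "\<And>s. s \<in> {0..1} \<Longrightarrow> 0 \<le> d s" "A \<in> sets state_space"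
  shows "(\<lambda>s. emeasure \<mu>2 (Pair s -` landing_set d A)) \<in> borel_measurable borel"
  by (rule mu2.measurable_emeasure_Pair)
     (use landing_set_measurable[OF assms] in \<open>simp add: mu2_sets cong: sets_pair_measure_cong\<close>)

text \<open>The path before the jump never leaves \<open>{0<..x}\<close>. So at every jump time the
  translation is at most \<open>\<delta>\<close>, and its cost is at most \<open>\<epsilon>\<close>
  uniformly in the jump time and in \<open>A\<close>.\<close>

lemma landing_near_0:
  assumes "0 < \<epsilon>"
  shows "\<exists>\<delta>>0. \<forall>x\<in>{0<..\<delta>}. \<forall>A\<in>sets state_space. landing0 A \<le> landing (\<lambda>s. flow s x) A + ennreal \<epsilon>"
proof -
  obtain \<delta> where \<delta>: "\<delta> > 0" "\<And>d. \<bar>d\<bar> \<le> \<delta> \<Longrightarrow> (\<integral>x. \<bar>mu2_density (x - d) - mu2_density x\<bar> \<partial>lborel) \<le> \<epsilon>"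
    using translation_L1_small[OF mu2_density_integrable assms] by blast
  have "landing0 A \<le> landing (\<lambda>s. flow s x) A + ennreal \<epsilon>" if x: "x \<in> {0<..\<delta>}" and A: "A \<in> sets state_space" for x A
  proof -
    have xpos: "0 < x" using x by simp
    have "landing0 A \<le> (\<integral>\<^sup>+s. emeasure \<mu>2 (Pair s -` landing_set (\<lambda>s. flow s x) A) * indicator {0..1} s + ennreal \<epsilon> * indicator {0..1} s \<partial>lborel)"
      unfolding landing_def
    proof (rule nn_integral_mono)
      fix s
      show "emeasure \<mu>2 (Pair s -` landing_set (\<lambda>_. 0) A) * indicator {0..1} s
        \<le> emeasure \<mu>2 (Pair s -` landing_set (\<lambda>s. flow s x) A) * indicator {0..1} s + ennreal \<epsilon> * indicator {0..1} s"
      proof (cases "s \<in> {0..1}")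
        case True
        let ?W = "{w. 0 < w \<and> flow (1 - s) w \<in> A}"
        have "Pair s -` landing_set (\<lambda>_. 0) A \<in> sets borel"
          by (rule sets_Pair1[OF landing_set_measurable]) (use A in auto)
        moreover have W0: "Pair s -` landing_set (\<lambda>_. 0) A = ?W"
          using True by (auto simp: landing_set_def)
        ultimately have W: "?W \<in> sets borel" by simp
        have d: "0 \<le> flow s x" "flow s x \<le> x" using flow_pos[OF xpos, of s] flow_le[OF xpos, of s] True by auto
        have "emeasure \<mu>2 {z. 0 < z \<and> z \<in> ?W}
          \<le> emeasure \<mu>2 {z. 0 < z \<and> flow s x + z \<in> ?W} + ennreal (\<integral>y. \<bar>mu2_density (y - flow s x) - mu2_density y\<bar> \<partial>lborel)"
          by (rule mu2_translate[OF W d(1)])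
        also have "\<dots> \<le> emeasure \<mu>2 {z. 0 < z \<and> flow s x + z \<in> ?W} + ennreal \<epsilon>"
          using \<delta>(2)[of "flow s x"] d x by (intro add_left_mono ennreal_leI) auto
        also have "{z. 0 < z \<and> flow s x + z \<in> ?W} = Pair s -` landing_set (\<lambda>s. flow s x) A"
          using True d by (auto simp: landing_set_def)
        also have "{z. 0 < z \<and> z \<in> ?W} = Pair s -` landing_set (\<lambda>_. 0) A" unfolding W0 by auto
        finally show ?thesis using True by simp
      qed simp
    qed
    also have "\<dots> = landing (\<lambda>s. flow s x) A + (\<integral>\<^sup>+s. ennreal \<epsilon> * indicator {0..1::real} s \<partial>lborel)"
    proof -
      have "(\<lambda>s. emeasure \<mu>2 (Pair s -` landing_set (\<lambda>s. flow s x) A)) \<in> borel_measurable borel"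
        by (rule landing_section_measurable[OF flow_path_continuous[OF xpos] A])
      then show ?thesis unfolding landing_def by (subst nn_integral_add) auto
    qed
    finally show ?thesis by (simp add: nn_integral_cmult)
  qed
  then show ?thesis using \<delta>(1) by blast
qed

text \<open>Near some point w the set \<open>B\<close> has positive measure in every neighbourhood.
  After a jump to a height z slightly above w, the flow sweeps across w within one time unit, so by
  the occupation formula a set of positive measure of jump times s ends in \<open>B\<close> at time
  1. Such heights z form an interval, which \<open>\<mu>2\<close> charges.\<close>

lemma landing0_pos:
  assumes B: "B \<in> sets borel" "B \<subseteq> {0<..}" and pos: "0 < emeasure lborel B"
  shows "0 < landing0 B"
proof -
  note [measurable] = B(1)
  have BS: "B \<in> sets state_space" using B by (auto simp: sets_restrict_space)
  \<comment> \<open>Lebesgue measure on \<open>B\<close>; a positive point of its support serves as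
    w.\<close>
  let ?\<beta> = "density lborel (indicator B)"
  have em: "emeasure ?\<beta> U = emeasure lborel (B \<inter> U)" if "U \<in> sets borel" for U
    using emeasure_restricted[of B lborel U] that by simp
  have "measure_support ?\<beta> \<inter> {0<..} \<noteq> {}"
  proof
    assume "measure_support ?\<beta> \<inter> {0<..} = {}"
    then have "emeasure ?\<beta> {0<..} = 0" by (intro null_set_outside_support) auto
    then show False using pos B em[of "{0<..}"] by (simp add: Int_absorb2)
  qed
  then obtain w where w: "0 < w" "w \<in> measure_support ?\<beta>" by auto
  have w_pos: "0 < emeasure lborel (B \<inter> U)" if "open U" "w \<in> U" for U
    using w(2) that em[of U] by (auto simp: measure_support_def)
  have "\<forall>\<^sub>F z in at w. G z < G w + 1"
    using isCont_G[OF w(1)] by (intro order_tendstoD(2)[of G "G w"]) (auto simp: isCont_def)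
  \<comment> \<open>A height z in \<open>{w<..<w + e}\<close> is less than one unit of travel time
    above w, so the flow started there is strictly below w at time 1.\<close>
  then obtain e where e: "e > 0" "\<And>z. z \<noteq> w \<Longrightarrow> dist z w < e \<Longrightarrow> G z < G w + 1"
    by (auto simp: eventually_at)
  let ?E = "landing_set (\<lambda>_. 0) B"
  have E: "?E \<in> sets (borel \<Otimes>\<^sub>M borel)" by (rule landing_set_measurable) (use BS in auto)
  define I where "I z = (\<integral>\<^sup>+s. indicator ?E (s, z) \<partial>lborel)" for z
  have [measurable]: "?E \<in> sets (lborel \<Otimes>\<^sub>M \<mu>2)" using E by (simp add: mu2_sets cong: sets_pair_measure_cong)
  interpret pair_sigma_finite lborel \<mu>2 ..
  have "landing0 B = (\<integral>\<^sup>+s. \<integral>\<^sup>+z. indicator ?E (s, z) \<partial>\<mu>2 \<partial>lborel)"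
    unfolding landing_def
  proof (rule nn_integral_cong)
    fix s
    have "(\<integral>\<^sup>+z. indicator ?E (s, z) \<partial>\<mu>2) = (\<integral>\<^sup>+z. indicator (Pair s -` ?E) z \<partial>\<mu>2)"
      by (intro nn_integral_cong) (auto split: split_indicator)
    also have "\<dots> = emeasure \<mu>2 (Pair s -` ?E)"
      using sets_Pair1[OF E, of s] by (intro nn_integral_indicator) (simp add: mu2_sets)
    finally have *: "(\<integral>\<^sup>+z. indicator ?E (s, z) \<partial>\<mu>2) = emeasure \<mu>2 (Pair s -` ?E)" .
    have "Pair s -` ?E = {}" if "s \<notin> {0..1}" using that by (auto simp: landing_set_def)
    then show "emeasure \<mu>2 (Pair s -` ?E) * indicator {0..1} s = (\<integral>\<^sup>+z. indicator ?E (s, z) \<partial>\<mu>2)"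
      unfolding * by (auto split: split_indicator)
  qed
  also have "\<dots> = (\<integral>\<^sup>+z. I z \<partial>\<mu>2)"
    unfolding I_def by (rule Fubini'[symmetric]) measurable
  finally have landing_eq: "landing0 B = (\<integral>\<^sup>+z. I z \<partial>\<mu>2)" .
  have I_meas: "I \<in> borel_measurable \<mu>2"
    unfolding I_def[abs_def] by (rule lborel.borel_measurable_nn_integral) measurable
  have I_pos: "I z \<noteq> 0" if z: "z \<in> {w<..<w + e}" for z
  proof
    assume I0: "I z = 0"
    have zpos: "0 < z" and wz: "w < z" using z w(1) by auto
    have "G z < G w + 1" using e(2)[of z] z by (auto simp: dist_real_def)
    then have fw: "flow 1 z < w"
      using flow_pos[OF zpos, of 1] G_flow[OF zpos, of 1] w(1) by (subst G_less_iff[symmetric]) auto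
    have "I z = (\<integral>\<^sup>+s. indicator B (flow (1 - s) z) * indicator {0..1} s \<partial>lborel)"
      unfolding I_def using zpos by (intro nn_integral_cong) (auto simp: landing_set_def split: split_indicator)
    also have "\<dots> = (\<integral>\<^sup>+s. indicator B (flow s z) * indicator {0..1} s \<partial>lborel)"
    proof -
      \<comment> \<open>Writing the flow through \<open>Ginv\<close> with time clamped at 0 makes
        the integrand measurable on the whole line, as the reflection of s into \<open>1 - s\<close>
        requires.\<close>
      let ?h = "\<lambda>s. indicator B (Ginv (G z - max 0 s)) * indicator {0..1} s :: ennreal"
      have "continuous_on UNIV (\<lambda>s. flow (max 0 s) z)"
        using zpos by (intro flow_continuous continuous_intros) auto
      then have "(\<lambda>s. flow (max 0 s) z) \<in> borel_measurable borel" by (rule borel_measurable_continuous_onI)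
      then have [measurable]: "(\<lambda>s. Ginv (G z - max 0 s)) \<in> borel_measurable borel" unfolding flow_Ginv .
      have "(\<integral>\<^sup>+s. indicator B (flow s z) * indicator {0..1} s \<partial>lborel) = (\<integral>\<^sup>+s. ?h s \<partial>lborel)"
        by (intro nn_integral_cong) (auto simp: flow_Ginv split: split_indicator)
      also have "\<dots> = (\<integral>\<^sup>+s. ?h (1 + -1 * s) \<partial>lborel)"
        by (subst nn_integral_real_affine[where c="-1" and t=1]) auto
      also have "\<dots> = (\<integral>\<^sup>+s. indicator B (flow (1 - s) z) * indicator {0..1} s \<partial>lborel)"
        by (intro nn_integral_cong) (auto simp: flow_Ginv split: split_indicator)
      finally show ?thesis by simp
    qed
    also have "\<dots> = (\<integral>\<^sup>+v. ennreal (slowness v) * indicator B v * indicator {flow 1 z..flow 0 z} v \<partial>lborel)"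
      by (rule nn_integral_flow[OF zpos]) auto
    finally have "(\<integral>\<^sup>+v. ennreal (slowness v) * indicator B v * indicator {flow 1 z..z} v \<partial>lborel) = 0"
      using I0 flow_0[OF zpos] by simp
    then have "AE v in lborel. ennreal (slowness v) * indicator B v * indicator {flow 1 z..z} v = 0"
      by (subst (asm) nn_integral_0_iff_AE) auto
    then have "AE v in lborel. v \<notin> B \<inter> {flow 1 z<..<z}"
    proof eventually_elim
      case (elim v)
      show ?case
      proof
        assume "v \<in> B \<inter> {flow 1 z<..<z}"
        then show False using elim slowness_pos[of v] by simp
      qed
    qed
    then have "B \<inter> {flow 1 z<..<z} \<in> null_sets lborel" by (subst AE_iff_null_sets) auto
    then show False using w_pos[of "{flow 1 z<..<z}"] fw wz by (simp add: null_sets_def)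
  qed
  show ?thesis
  proof (rule ccontr)
    assume "\<not> 0 < landing0 B"
    then have "(\<integral>\<^sup>+z. I z \<partial>\<mu>2) = 0" by (simp add: landing_eq)
    then have "AE z in \<mu>2. I z = 0" using I_meas by (simp add: nn_integral_0_iff_AE)
    then have "AE z in \<mu>2. z \<notin> {w<..<w + e}" by eventually_elim (use I_pos in blast)
    then have "{w<..<w + e} \<in> null_sets \<mu>2" by (subst AE_iff_null_sets) (auto simp: mu2_sets)
    then show False using mu2_interval_pos[of w "w + e"] w(1) e(1) by (simp add: null_sets_def)
  qed
qed

text \<open>From 0 every positive jump followed by the flow ends in the state space, so no mass is
  lost. This lets lower bounds for a set and for its complement be added up to an overlap.\<close>

lemma landing0_add:
  assumes A: "A \<in> sets state_space"
  shows "landing0 A + landing0 ({0<..} - A) = emeasure \<mu>2 {0<..}"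
proof -
  have A': "{0<..} - A \<in> sets state_space"
    using sets.compl_sets[OF A] by (simp add: space_restrict_space)
  have "landing0 A + landing0 ({0<..} - A)
    = (\<integral>\<^sup>+s. emeasure \<mu>2 (Pair s -` landing_set (\<lambda>_. 0) A) * indicator {0..1} s
        + emeasure \<mu>2 (Pair s -` landing_set (\<lambda>_. 0) ({0<..} - A)) * indicator {0..1} s \<partial>lborel)"
    unfolding landing_def
    using landing_section_measurable[of "\<lambda>_. 0" A] landing_section_measurable[of "\<lambda>_. 0" "{0<..} - A"] A A'
    by (subst nn_integral_add) auto
  also have "\<dots> = (\<integral>\<^sup>+s. emeasure \<mu>2 {0<..} * indicator {0..1::real} s \<partial>lborel)"
  proof (rule nn_integral_cong)
    fix s
    show "emeasure \<mu>2 (Pair s -` landing_set (\<lambda>_. 0) A) * indicator {0..1} s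
        + emeasure \<mu>2 (Pair s -` landing_set (\<lambda>_. 0) ({0<..} - A)) * indicator {0..1} s
        = emeasure \<mu>2 {0<..} * indicator {0..1} s"
    proof (cases "s \<in> {0..1}")
      case True
      have m: "Pair s -` landing_set (\<lambda>_. 0) A \<in> sets \<mu>2" "Pair s -` landing_set (\<lambda>_. 0) ({0<..} - A) \<in> sets \<mu>2"
        unfolding mu2_sets by (rule sets_Pair1[OF landing_set_measurable]; use A A' in auto)+
      have "Pair s -` landing_set (\<lambda>_. 0) A \<union> Pair s -` landing_set (\<lambda>_. 0) ({0<..} - A) = {0<..}"
        using True flow_pos[of _ "1 - s"] by (auto simp: landing_set_def)
      moreover have "Pair s -` landing_set (\<lambda>_. 0) A \<inter> Pair s -` landing_set (\<lambda>_. 0) ({0<..} - A) = {}"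
        by (auto simp: landing_set_def)
      ultimately show ?thesis using plus_emeasure[OF m] True by simp
    qed simp
  qed
  also have "\<dots> = emeasure \<mu>2 {0<..}" by (simp add: nn_integral_cmult)
  finally show ?thesis .
qed

text \<open>In the Chapman-Kolmogorov integral only the atom at \<open>flow t x\<close>, reached
  without a jump, is kept.\<close>

lemma kernel_via_flow:
  assumes x: "0 < x" and t: "0 < t" and A: "A \<in> sets state_space"
  shows "ennreal (exp (- (lam * t))) * emeasure (\<kappa> 1 (flow t x)) A \<le> emeasure (\<kappa> (t + 1) x) A"
proof -
  have fp: "0 < flow t x" using x t by (intro flow_pos) auto
  have sets: "{flow t x} \<in> sets (\<kappa> t x)" using singleton_sets[OF fp] k.sets_kernel[of t x] x t by simp
  have "ennreal (exp (- (lam * t))) * emeasure (\<kappa> 1 (flow t x)) A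
    \<le> emeasure (\<kappa> t x) {flow t x} * emeasure (\<kappa> 1 (flow t x)) A"
    by (intro mult_right_mono prob_no_jump x t) simp
  also have "\<dots> = (\<integral>\<^sup>+y. emeasure (\<kappa> 1 (flow t x)) A * indicator {flow t x} y \<partial>\<kappa> t x)"
    unfolding nn_integral_cmult_indicator[OF sets] by (rule mult.commute)
  also have "\<dots> \<le> (\<integral>\<^sup>+y. emeasure (\<kappa> 1 y) A \<partial>\<kappa> t x)"
    by (intro nn_integral_mono) (auto split: split_indicator)
  also have "\<dots> = emeasure (\<kappa> (t + 1) x) A"
    using t by (intro k.emeasure_chapman_kolmogorov[symmetric] x A) auto
  finally show ?thesis .
qed

lemma near_0_lower_bound:
  assumes "0 < \<epsilon>"
  shows "\<exists>\<delta>>0. \<forall>x\<in>{0<..\<delta>}. \<forall>A\<in>sets state_space.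
    ennreal (exp (- lam)) * landing0 A \<le> emeasure (\<kappa> 1 x) A + ennreal (exp (- lam)) * ennreal \<epsilon>"
proof -
  obtain \<delta> where \<delta>: "\<delta> > 0" "\<And>x A. x\<in>{0<..\<delta>} \<Longrightarrow> A\<in>sets state_space \<Longrightarrow> landing0 A \<le> landing (\<lambda>s. flow s x) A + ennreal \<epsilon>"
    using landing_near_0[OF assms] by blast
  have "ennreal (exp (- lam)) * landing0 A \<le> emeasure (\<kappa> 1 x) A + ennreal (exp (- lam)) * ennreal \<epsilon>"
    if x: "x\<in>{0<..\<delta>}" and A: "A\<in>sets state_space" for x A
  proof -
    have "ennreal (exp (- lam)) * landing0 A \<le> ennreal (exp (- lam)) * (landing (\<lambda>s. flow s x) A + ennreal \<epsilon>)"
      by (intro mult_left_mono \<delta>(2) x A) simp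
    also have "\<dots> \<le> emeasure (\<kappa> 1 x) A + ennreal (exp (- lam)) * ennreal \<epsilon>"
      using one_jump_lower_bound[of x A] x A by (simp add: distrib_left add_right_mono)
    finally show ?thesis .
  qed
  then show ?thesis using \<delta>(1) by blast
qed

lemma ennreal_exp_mult: "ennreal (exp a * b) = ennreal (exp a) * ennreal b"
  by (rule ennreal_mult') simp

text \<open>With \<open>j\<close> the limiting mass of \<open>B\<close>, the tolerance
  \<open>j / 2\<close> is fixed first and determines how close to 0 the process has to wait. The
  one-jump law from there then still charges \<open>B\<close>.\<close>

lemma irreducible: "skeleton_irreducible P X 1"
  unfolding skeleton_irreducible_def
proof (intro ballI impI allI)
  fix B :: "real set" and x :: real
  assume B: "B \<in> sets borel" and "B \<subseteq> {0<..} \<and> 0 < emeasure lborel B" and x: "0 < x"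
  then have sub: "B \<subseteq> {0<..}" and pos: "0 < emeasure lborel B" by auto
  have BS: "B \<in> sets state_space" using B sub by (auto simp: sets_restrict_space)
  have fin: "landing0 B < \<infinity>"
  proof -
    have "landing0 B \<le> landing0 B + landing0 ({0<..} - B)" by simp
    also have "\<dots> = emeasure \<mu>2 {0<..}" by (rule landing0_add[OF BS])
    also have "\<dots> < \<infinity>" using mu2.emeasure_finite by (simp add: less_top[symmetric])
    finally show ?thesis .
  qed
  then obtain j where j: "landing0 B = ennreal j" "0 < j"
    using landing0_pos[OF B sub pos] by (cases "landing0 B") auto
  obtain \<delta> where \<delta>: "\<delta> > 0" "\<And>x A. x\<in>{0<..\<delta>} \<Longrightarrow> A\<in>sets state_space \<Longrightarrow>
      ennreal (exp (- lam)) * landing0 A \<le> emeasure (\<kappa> 1 x) A + ennreal (exp (- lam)) * ennreal (j / 2)"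
    using near_0_lower_bound[of "j / 2"] j(2) by auto
  obtain t where t: "t \<ge> 0" "\<And>s. s \<ge> t \<Longrightarrow> flow s x \<le> \<delta>" using flow_small[OF \<delta>(1) x] by blast
  obtain n where n: "t \<le> real n" using real_arch_simple by blast
  \<comment> \<open>A positive integer, so that the wait is a number of skeleton steps and the
    no-jump bound applies; \<open>B\<close> is then charged at step \<open>Suc m\<close>.\<close>
  define m where "m = Suc n"
  have m: "0 < real m" "flow (real m) x \<in> {0<..\<delta>}"
    using t(2)[of "real m"] n flow_pos[OF x, of "real m"] by (auto simp: m_def)
  have "emeasure (\<kappa> 1 (flow (real m) x)) B \<noteq> 0"
  proof
    assume "emeasure (\<kappa> 1 (flow (real m) x)) B = 0"
    then have "ennreal (exp (- lam) * j) \<le> ennreal (exp (- lam) * (j / 2))"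
      unfolding ennreal_exp_mult using \<delta>(2)[OF m(2) BS] j by simp
    then show False using j(2) by simp
  qed
  then have "0 < ennreal (exp (- (lam * real m))) * emeasure (\<kappa> 1 (flow (real m) x)) B"
    by (simp add: ennreal_zero_less_mult_iff zero_less_iff_neq_zero)
  also have "\<dots> \<le> emeasure (\<kappa> (real m + 1) x) B" by (rule kernel_via_flow[OF x m(1) BS])
  finally have "0 < emeasure (\<kappa> (real (Suc m)) x) B" by (simp add: add.commute)
  then have "0 < measure (\<kappa> (real (Suc m) * 1) x) B"
    using k.prob_space_kernel[of "real (Suc m)" x] x
    by (simp add: finite_measure.emeasure_eq_measure prob_space.finite_measure)
  then show "\<exists>n\<ge>1. 0 < measure (\<kappa> (real n * 1) x) B"
    by (intro exI[of _ "Suc m"]) simp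
qed

lemma ergodic_solution: "ergodic P X"
proof -
  interpret R: real_sequence_space \<rho> by (rule real_sequence_space_law)
  obtain K c \<delta> where kc: "0 < \<delta>" "mean < c - \<delta>" "0 < K + c" "\<And>y. K \<le> y \<Longrightarrow> drift \<mu> \<pi> y \<le> - c"
    using drift_exceeds_mean by blast
  note law = law_mean[of mean, OF _ mean_nonneg, unfolded abs_mean, OF order_refl]
  have unif: "\<exists>r>0. \<forall>n. \<forall>x>0. measure (\<kappa> (real n) x) {max (x - real n * \<delta>) (K + c) + r<..} \<le> \<epsilon>"
    if "0 < \<epsilon>" for \<epsilon>
    by (rule k.uniformly_tight[OF real_sequence_space_law one_step_tail[OF kc(4)] law(1) _ kc(1) that kc(3)])
       (use law(2) kc(2) in auto)
  have mono: "measure (\<kappa> t x) {b<..} \<le> measure (\<kappa> t x) {a<..}" if "0 \<le> t" "0 < x" "0 < a" "a \<le> b" for t x a b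
  proof -
    interpret prob_space "\<kappa> t x" using that by (intro k.prob_space_kernel)
    show ?thesis
      using that ray_sets[of a] by (intro finite_measure_mono) (auto simp: k.sets_kernel)
  qed
  \<comment> \<open>The Lindley comparison covers integer times. A general time is an integer n plus
    a remainder in [0,1], during which the rise is at most the jump sum of a unit interval. Hence
    exceeding \<open>R1 + real l\<close> requires being above \<open>R1\<close> at time n or a jump
    sum above \<open>real l\<close>, each of probability at most
    \<open>\<epsilon> / 2\<close>.\<close>
  have tight: "\<exists>R'>0. \<forall>t\<ge>0. \<forall>x\<in>{0<..R}. measure (\<kappa> t x) {R'<..} \<le> \<epsilon>" if \<epsilon>: "0 < \<epsilon>" for R \<epsilon>
  proof -
    obtain r where r: "r > 0" "\<And>n x. x > 0 \<Longrightarrow> measure (\<kappa> (real n) x) {max (x - real n * \<delta>) (K + c) + r<..} \<le> \<epsilon> / 2"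
      using unif[of "\<epsilon> / 2"] \<epsilon> by auto
    define R1 where "R1 = max R (K + c) + r"
    have R1: "0 < R1" using r(1) kc(3) by (auto simp: R1_def)
    have "(\<lambda>n. measure \<rho> {real n<..}) \<longlonglongrightarrow> measure \<rho> (\<Inter>n. {real n<..})"
      by (intro R.M.finite_Lim_measure_decseq) (auto simp: decseq_def)
    moreover have "(\<Inter>n. {real n<..}) = {}"
    proof -
      have "\<exists>n. \<not> real n < x" for x using real_arch_simple[of x] by (auto simp: not_less)
      then show ?thesis by auto
    qed
    ultimately have "(\<lambda>n. measure \<rho> {real n<..}) \<longlonglongrightarrow> 0" by simp
    then have "\<forall>\<^sub>F n in sequentially. measure \<rho> {real n<..} < \<epsilon> / 2"
      using \<epsilon> by (intro order_tendstoD) auto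
    then obtain l where l: "measure \<rho> {real l<..} < \<epsilon> / 2" by (auto simp: eventually_sequentially)
    define R' where "R' = R1 + real l"
    have R': "0 < R'" using R1 by (simp add: R'_def)
    have "measure (\<kappa> t x) {R'<..} \<le> \<epsilon>" if t: "0 \<le> t" and x: "x \<in> {0<..R}" for t x
    proof -
      have xpos: "0 < x" using x by simp
      define n where "n = nat \<lfloor>t\<rfloor>"
      define u where "u = t - real n"
      have u: "0 \<le> u" "u \<le> 1" "t = real n + u" using t by (auto simp: u_def n_def) linarith
      interpret T: prob_space "\<kappa> t x" by (rule k.prob_space_kernel[OF t xpos])
      interpret N: prob_space "\<kappa> (real n) x" by (rule k.prob_space_kernel[OF _ xpos]) simp
      have sets_n: "sets (\<kappa> (real n) x) = sets state_space" by (rule k.sets_kernel[OF _ xpos]) simp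
      have space_n: "space (\<kappa> (real n) x) = {0<..}"
        using sets_eq_imp_space_eq[OF sets_n] by (simp add: space_restrict_space)
      have ray: "{R'<..} \<in> sets state_space" using ray_sets[of R'] R' by simp
      have ray1: "{R1<..} \<in> sets (\<kappa> (real n) x)" using ray_sets[of R1] R1 by (simp add: sets_n)
      have "emeasure (\<kappa> t x) {R'<..} = (\<integral>\<^sup>+y. emeasure (\<kappa> u y) {R'<..} \<partial>\<kappa> (real n) x)"
        unfolding u(3) by (rule k.emeasure_chapman_kolmogorov) (use u xpos ray in auto)
      also have "\<dots> \<le> (\<integral>\<^sup>+y. indicator {R1<..} y + ennreal (\<epsilon> / 2) \<partial>\<kappa> (real n) x)"
      proof (rule nn_integral_mono)
        fix y assume "y \<in> space (\<kappa> (real n) x)"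
        then have y: "0 < y" by (simp add: space_n)
        show "emeasure (\<kappa> u y) {R'<..} \<le> indicator {R1<..} y + ennreal (\<epsilon> / 2)"
        proof (cases "y \<le> R1")
          case True
          have "emeasure (\<kappa> u y) {R'<..} = emeasure (\<kappa> u y) {max R' 0<..}" using R' by simp
          also have "\<dots> \<le> emeasure \<rho> {z. R' < y + z}" by (rule short_time_tail[OF y u(1,2)])
          also have "\<dots> \<le> emeasure \<rho> {real l<..}"
            using True by (intro emeasure_mono) (auto simp: R'_def)
          also have "\<dots> \<le> ennreal (\<epsilon> / 2)" using l by (simp add: R.M.emeasure_eq_measure ennreal_leI)
          finally show ?thesis by (simp add: add_increasing)
        next
          case False
          interpret U: prob_space "\<kappa> u y" by (rule k.prob_space_kernel[OF u(1) y])
          show ?thesis using False U.emeasure_le_1[of "{R'<..}"] by (simp add: add_increasing2)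
        qed
      qed
      also have "\<dots> = emeasure (\<kappa> (real n) x) {R1<..} + ennreal (\<epsilon> / 2)"
        using ray1 N.emeasure_space_1 by (subst nn_integral_add) auto
      also have "emeasure (\<kappa> (real n) x) {R1<..} \<le> ennreal (\<epsilon> / 2)"
      proof -
        have "measure (\<kappa> (real n) x) {R1<..} \<le> measure (\<kappa> (real n) x) {max (x - real n * \<delta>) (K + c) + r<..}"
        proof (rule mono)
          have "0 \<le> real n * \<delta>" using kc(1) by simp
          then have "x - real n * \<delta> \<le> R" using x by (simp add: algebra_simps)
          then show "max (x - real n * \<delta>) (K + c) + r \<le> R1" by (auto simp: R1_def)
          show "0 < max (x - real n * \<delta>) (K + c) + r" using kc(3) r(1) by (auto simp: max_def)
        qed (use xpos in auto)
        also have "\<dots> \<le> \<epsilon> / 2" by (rule r(2)[OF xpos])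
        finally show ?thesis by (simp add: N.emeasure_eq_measure ennreal_leI)
      qed
      finally have "ennreal (measure (\<kappa> t x) {R'<..}) \<le> ennreal (\<epsilon> / 2) + ennreal (\<epsilon> / 2)"
        by (simp add: T.emeasure_eq_measure add_right_mono)
      also have "\<dots> = ennreal \<epsilon>" using \<epsilon> by (simp flip: ennreal_plus)
      finally show ?thesis using \<epsilon> by simp
    qed
    then show ?thesis using R' by blast
  qed
  \<comment> \<open>Here the tail probability 1/2 suffices. The resulting \<open>R0\<close> does not
    depend on the radius of the starting points, and neither will \<open>\<gamma>\<close>.\<close>
  obtain r where r: "r > 0" "\<And>n x. x > 0 \<Longrightarrow> measure (\<kappa> (real n) x) {max (x - real n * \<delta>) (K + c) + r<..} \<le> 1 / 2"
    using unif[of "1 / 2"] by auto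
  define R0 where "R0 = K + c + r"
  have R0: "0 < R0" using r(1) kc(3) by (simp add: R0_def)
  have jfin: "emeasure \<mu>2 {0<..} = ennreal (measure \<mu>2 {0<..})" by (rule mu2.emeasure_eq_measure)
  define j where "j = measure \<mu>2 {0<..}"
  have j: "0 < j"
  proof -
    have "0 < emeasure \<mu>2 {0<..<1}" by (rule mu2_interval_pos) auto
    also have "\<dots> \<le> emeasure \<mu>2 {0<..}" by (rule emeasure_mono) (auto simp: mu2_sets)
    finally show ?thesis by (simp add: jfin j_def)
  qed
  \<comment> \<open>The tolerance \<open>j / 4\<close> is spent twice, on a set and on its
    complement, so half of the total mass \<open>j\<close> survives.\<close>
  obtain \<delta>0 where \<delta>0: "\<delta>0 > 0" "\<And>x A. x\<in>{0<..\<delta>0} \<Longrightarrow> A\<in>sets state_space \<Longrightarrow>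
      ennreal (exp (- lam)) * landing0 A \<le> emeasure (\<kappa> 1 x) A + ennreal (exp (- lam)) * ennreal (j / 4)"
    using near_0_lower_bound[of "j / 4"] j by auto
  obtain t0 where t0: "t0 \<ge> 0" "\<And>s. s \<ge> t0 \<Longrightarrow> flow s R0 \<le> \<delta>0" using flow_small[OF \<delta>0(1) R0] by blast
  define t where "t = t0 + 1"
  have t: "0 < t" "flow t R0 \<le> \<delta>0" using t0 by (auto simp: t_def)
  define \<theta> where "\<theta> = exp (- (lam * t)) * exp (- lam)"
  have \<theta>: "0 < \<theta>" by (simp add: \<theta>_def)
  define J where "J A = enn2real (landing0 A)" for A
  have J_add: "J A + J ({0<..} - A) = j" and J_eq: "landing0 A = ennreal (J A)" if A: "A \<in> sets state_space" for A
  proof -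
    have sum: "landing0 A + landing0 ({0<..} - A) = ennreal j"
      using landing0_add[OF A] by (simp add: jfin j_def)
    have "landing0 A \<le> ennreal j" "landing0 ({0<..} - A) \<le> ennreal j"
      unfolding sum[symmetric] by (simp_all add: add_increasing add_increasing2)
    then have fin: "landing0 A < \<infinity>" "landing0 ({0<..} - A) < \<infinity>"
      using le_less_trans[OF _ ennreal_less_top] by auto
    then show "landing0 A = ennreal (J A)" by (simp add: J_def)
    have "J A + J ({0<..} - A) = enn2real (landing0 A + landing0 ({0<..} - A))"
      unfolding J_def using fin by (intro enn2real_plus[symmetric]) auto
    then show "J A + J ({0<..} - A) = j" unfolding sum using j by simp
  qed
  have J_nonneg: "0 \<le> J A" for A by (simp add: J_def)
  \<comment> \<open>All of \<open>{0<..R0}\<close> is brought into \<open>{0<..\<delta>0}\<close> by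
    one common time, since the flow is monotone in the starting point; then the bound near 0
    applies. The factor \<open>\<theta>\<close> is the price for no jump up to t and for the
    subsequent single jump.\<close>
  have small: "\<theta> * (J A - j / 4) \<le> measure (\<kappa> (t + 1) y) A" if y: "y \<in> {0<..R0}" and A: "A \<in> sets state_space" for y A
  proof -
    have ypos: "0 < y" using y by simp
    let ?f = "flow t y"
    have f: "?f \<in> {0<..\<delta>0}"
      using flow_pos[OF ypos, of t] flow_mono[OF ypos, of R0 t] y t by auto
    then have fpos: "0 < ?f" by simp
    interpret f: prob_space "\<kappa> 1 ?f" by (rule k.prob_space_kernel[OF _ fpos]) simp
    interpret y: prob_space "\<kappa> (t + 1) y" by (rule k.prob_space_kernel[OF _ ypos]) (use t in simp)
    have "ennreal (exp (- lam) * J A) \<le> ennreal (measure (\<kappa> 1 ?f) A + exp (- lam) * (j / 4))"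
      using \<delta>0(2)[OF f A] j
      by (simp only: J_eq[OF A] f.emeasure_eq_measure ennreal_exp_mult[symmetric] ennreal_plus[symmetric]
          measure_nonneg mult_nonneg_nonneg exp_ge_zero divide_nonneg_pos less_imp_le zero_less_numeral)
    then have 1: "exp (- lam) * (J A - j / 4) \<le> measure (\<kappa> 1 ?f) A"
      using j by (subst (asm) ennreal_le_iff) (auto simp: algebra_simps)
    have "ennreal (exp (- (lam * t)) * measure (\<kappa> 1 ?f) A) \<le> ennreal (measure (\<kappa> (t + 1) y) A)"
      using kernel_via_flow[OF ypos t(1) A]
      by (simp only: f.emeasure_eq_measure y.emeasure_eq_measure ennreal_exp_mult)
    then have 2: "exp (- (lam * t)) * measure (\<kappa> 1 ?f) A \<le> measure (\<kappa> (t + 1) y) A"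
      by (subst (asm) ennreal_le_iff) auto
    have "\<theta> * (J A - j / 4) = exp (- (lam * t)) * (exp (- lam) * (J A - j / 4))" by (simp add: \<theta>_def)
    also have "\<dots> \<le> exp (- (lam * t)) * measure (\<kappa> 1 ?f) A" using 1 by (intro mult_left_mono) auto
    finally show ?thesis using 2 by simp
  qed
  \<comment> \<open>The factor 1/2 for the mass in \<open>{0<..R0}\<close> times
    \<open>\<theta>\<close> times the surviving mass \<open>j / 2\<close> is
    \<open>\<theta> * j / 4\<close>; the minimum with 1/2 ensures
    \<open>\<gamma> < 1\<close>.\<close>
  define \<gamma> where "\<gamma> = min (\<theta> * j / 4) (1 / 2)"
  have "tight_contracting_kernel \<kappa> \<gamma>"
  proof
    show "0 < \<gamma>" "\<gamma> < 1" using \<theta> j by (auto simp: \<gamma>_def)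
    show "\<exists>R'>0. \<forall>t\<ge>0. \<forall>x\<in>{0<..R}. measure (\<kappa> t x) {R'<..} \<le> \<epsilon>" if "0 < \<epsilon>" for R \<epsilon>
      by (rule tight[OF that])
    fix R :: real
    \<comment> \<open>After n steps the surplus drift \<open>\<delta>\<close> per step has brought
      every start in \<open>{0<..R}\<close> below the level \<open>K + c\<close>. This number of
      steps is the part of the overlap time that depends on \<open>R\<close>.\<close>
    obtain n where n: "(R - (K + c)) / \<delta> \<le> real n" using real_arch_simple by blast
    then have n': "R - real n * \<delta> \<le> K + c" using kc(1) by (simp add: field_simps)
    have lower: "\<theta> / 2 * (J A - j / 4) \<le> measure (\<kappa> (real n + (t + 1)) x) A"
      if x: "x \<in> {0<..R}" and A: "A \<in> sets state_space" for x A
    \<comment> \<open>For small \<open>J A\<close> the claimed lower bound is nonpositive; otherwise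
      its factor is positive and may be multiplied by the half of the mass lying in
      \<open>{0<..R0}\<close>.\<close>
    proof (cases "J A \<le> j / 4")
      case True
      then have "\<theta> / 2 * (J A - j / 4) \<le> 0" using \<theta> by (intro mult_nonneg_nonpos) auto
      then show ?thesis using measure_nonneg order_trans by blast
    next
      case False
      have xpos: "0 < x" using x by simp
      interpret N: prob_space "\<kappa> (real n) x" by (rule k.prob_space_kernel[OF _ xpos]) simp
      have sets_n: "sets (\<kappa> (real n) x) = sets state_space" by (rule k.sets_kernel[OF _ xpos]) simp
      have space_n: "space (\<kappa> (real n) x) = {0<..}"
        using sets_eq_imp_space_eq[OF sets_n] by (simp add: space_restrict_space)
      have ray: "{R0<..} \<in> N.events" using ray_sets[of R0] R0 by (simp add: sets_n)
      have "max (x - real n * \<delta>) (K + c) + r = R0" using x n' by (auto simp: R0_def max_def)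
      then have "N.prob {R0<..} \<le> 1 / 2" using r(2)[OF xpos, of n] by simp
      then have half: "1 / 2 \<le> N.prob {0<..R0}"
      proof -
        have "N.prob (space (\<kappa> (real n) x) - {R0<..}) = 1 - N.prob {R0<..}" by (rule N.prob_compl[OF ray])
        moreover have "space (\<kappa> (real n) x) - {R0<..} = {0<..R0}" by (auto simp: space_n)
        ultimately show ?thesis using \<open>N.prob {R0<..} \<le> 1 / 2\<close> by simp
      qed
      have ev: "{0<..R0} \<in> N.events"
      proof -
        have "space (\<kappa> (real n) x) - {R0<..} \<in> N.events" using ray by auto
        moreover have "space (\<kappa> (real n) x) - {R0<..} = {0<..R0}" by (auto simp: space_n)
        ultimately show ?thesis by simp
      qed
      have meas: "(\<lambda>y. measure (\<kappa> (t + 1) y) A) \<in> borel_measurable (\<kappa> (real n) x)"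
        using t by (intro k.measurable_kernel' A xpos) auto
      have "\<theta> / 2 * (J A - j / 4) \<le> N.prob {0<..R0} * (\<theta> * (J A - j / 4))"
        using half mult_right_mono[OF half, of "\<theta> * (J A - j / 4)"] False \<theta> by simp
      also have "\<dots> = (\<integral>y. indicator {0<..R0} y * (\<theta> * (J A - j / 4)) \<partial>\<kappa> (real n) x)"
        using ev by (simp add: sets.sets_into_space Int_absorb2)
      also have "\<dots> \<le> (\<integral>y. measure (\<kappa> (t + 1) y) A \<partial>\<kappa> (real n) x)"
      proof (rule integral_mono)
        show "integrable (\<kappa> (real n) x) (\<lambda>y. indicator {0<..R0} y * (\<theta> * (J A - j / 4)))"
          using ev by (intro integrable_mult_left) (simp add: N.emeasure_eq_measure)
        show "integrable (\<kappa> (real n) x) (\<lambda>y. measure (\<kappa> (t + 1) y) A)"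
        proof (rule N.integrable_const_bound[where B=1])
          show "AE y in \<kappa> (real n) x. norm (measure (\<kappa> (t + 1) y) A) \<le> 1"
          proof (rule AE_I2)
            fix y assume "y \<in> space (\<kappa> (real n) x)"
            then have "0 < y" by (simp add: space_n)
            then show "norm (measure (\<kappa> (t + 1) y) A) \<le> 1"
              using prob_space.prob_le_1[OF k.prob_space_kernel[of "t + 1" y]] t by simp
          qed
        qed (rule meas)
        fix y
        show "indicator {0<..R0} y * (\<theta> * (J A - j / 4)) \<le> measure (\<kappa> (t + 1) y) A"
          using small[OF _ A, of y] by (cases "y \<in> {0<..R0}") auto
      qed
      also have "\<dots> = measure (\<kappa> (real n + (t + 1)) x) A"
        using t by (intro k.chapman_kolmogorov[symmetric] A xpos) auto
      finally show ?thesis .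
    qed
    show "\<exists>t\<ge>0. \<forall>x\<in>{0<..R}. \<forall>y\<in>{0<..R}. \<forall>A\<in>sets state_space. measure (\<kappa> t x) A - measure (\<kappa> t y) A \<le> 1 - \<gamma>"
    proof (intro exI[of _ "real n + (t + 1)"] conjI ballI)
      show "0 \<le> real n + (t + 1)" using t by simp
      fix x y A assume x: "x \<in> {0<..R}" and y: "y \<in> {0<..R}" and A: "A \<in> sets state_space"
      let ?t = "real n + (t + 1)"
      have xpos: "0 < x" and t': "0 \<le> ?t" using x t by auto
      interpret x: prob_space "\<kappa> ?t x" by (rule k.prob_space_kernel[OF t' xpos])
      have sets_x: "sets (\<kappa> ?t x) = sets state_space" by (rule k.sets_kernel[OF t' xpos])
      have space_x: "space (\<kappa> ?t x) = {0<..}"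
        using sets_eq_imp_space_eq[OF sets_x] by (simp add: space_restrict_space)
      have A': "{0<..} - A \<in> sets state_space"
        using sets.compl_sets[OF A] by (simp add: space_restrict_space)
      have "x.prob ({0<..} - A) = 1 - x.prob A"
        using x.prob_compl[of A] A by (simp add: sets_x space_x)
      \<comment> \<open>The lower bound is applied to the complement of \<open>A\<close> from x and
        to \<open>A\<close> itself from y; the two limiting masses add up to \<open>j\<close>,
        whatever \<open>A\<close> is.\<close>
      then have "x.prob A \<le> 1 - \<theta> / 2 * (J ({0<..} - A) - j / 4)" using lower[OF x A'] by linarith
      moreover have "\<theta> / 2 * (J A - j / 4) \<le> measure (\<kappa> ?t y) A" by (rule lower[OF y A])
      ultimately have "x.prob A - measure (\<kappa> ?t y) A \<le> 1 - (\<theta> / 2 * (J ({0<..} - A) - j / 4) + \<theta> / 2 * (J A - j / 4))"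
        by linarith
      also have "\<theta> / 2 * (J ({0<..} - A) - j / 4) + \<theta> / 2 * (J A - j / 4) = \<theta> / 2 * ((J A + J ({0<..} - A)) - j / 2)"
        by (simp add: algebra_simps)
      also have "\<dots> = \<theta> * j / 4" unfolding J_add[OF A] by simp
      finally show "x.prob A - measure (\<kappa> ?t y) A \<le> 1 - \<gamma>" by (auto simp: \<gamma>_def)
    qed
  qed
  then show ?thesis by (rule ergodicI)
qed

end

theorem lemma3p6:
  fixes \<pi> :: "real \<Rightarrow> real" and \<mu> \<mu>1 \<mu>2 :: "real measure"
    and C C' \<alpha> :: real
    and P F :: "real \<Rightarrow> 'a measure" and L X :: "real \<Rightarrow> 'a \<Rightarrow> real"
  assumes pi_prob: "prob_space (density (restrict_space lborel {0<..}) (\<lambda>x. ennreal (\<pi> x)))"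
    and pi_pos: "\<forall>x>0. 0 < \<pi> x"
    and pi_pwd: "piecewise_weakly_differentiable \<pi>"
    and consts_pos: "0 < C" "0 < C'" "0 < \<alpha>"
    and pi_tail: "((\<lambda>x. \<pi> x * exp (\<alpha> * x)) \<longlongrightarrow> C) at_top"
    and pi_zero: "\<forall>\<^sub>F x in at_right 0. (LINT z:{0<..<x}|lborel. \<pi> z) \<le> C' * \<pi> x * x"
    and mu_sets: "sets \<mu> = sets borel"
    and mu_supp: "measure_support \<mu> \<subseteq> {0..}"
    and mu_moment: "(\<integral>\<^sup>+z\<in>{0<..}. ennreal (max 1 z) \<partial>\<mu>) < \<infinity>"
    and L_cpp: "\<forall>x>0. compound_poisson_process (P x) \<mu> L"
    and X_markov: "markov_process P F X"
    and X_sol: "\<forall>x>0. sde_solution (drift \<mu> \<pi>) (P x) F L X"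
    and mu1_sets: "sets \<mu>1 = sets borel"
    and mu2_sets: "sets \<mu>2 = sets borel"
    and mu_sum: "\<forall>A\<in>sets borel. emeasure \<mu> A = emeasure \<mu>1 A + emeasure \<mu>2 A"
    and mu2_ac: "absolutely_continuous lborel \<mu>2"
    and mu2_pos: "\<forall>I. open I \<and> is_interval I \<and> I \<noteq> {} \<and> I \<subseteq> {0<..} \<longrightarrow> 0 < emeasure \<mu>2 I"
  shows "skeleton_irreducible P X 1 \<and> ergodic P X"
proof -
  have "L1_loc {0<..} \<pi>" using pi_pwd by (simp add: piecewise_weakly_differentiable_def)
  then interpret generalized_ou \<pi> \<mu> \<mu>1 \<mu>2 C C' \<alpha> P F L X
    using assms by (intro generalized_ou.intro)
  show ?thesis using irreducible ergodic_solution by blast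
qed

end
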